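(* Let $A\in W^{1,q}(\mathbb{D},\mathbb{B})$ with $q>2$. The Dirichlet problem $$\begin{cases}(\bar\partial-A)^2 w=0, & \text{in }\mathbb{D},\\ w=0, & \text{on }\partial\mathbb{D},\end{cases}$$ for bicomplex-valued functions $w$, has infinitely many solutions.
   Context: $\mathbb{D}$ is the open unit disk in $\mathbb{C}$. The bicomplex numbers $\mathbb{B}$ are the commutative algebra of elements $z_1+jz_2$ with $z_1,z_2\in\mathbb{C}$, $j^2=-1$, $ij=ji$. With $w^\pm=z_1\mp iz_2$ for $w=z_1+jz_2$, the norm is $\|w\|_{\mathbb{B}}=\sqrt{(|w^+|^2+|w^-|^2)/2}$. $W^{1,q}(\mathbb{D},\mathbb{B})$ is the Sobolev space of $\mathbb{B}$-valued functions on $\mathbb{D}$ that, together with their first-order derivatives, have $\|\cdot\|_{\mathbb{B}}$ in $L^q(\mathbb{D})$. The operator $\bar\partial=\frac12\left(\frac{\partial}{\partial x}+j\frac{\partial}{\partial y}\right)$ acts on $\mathbb{B}$-valued functions of $z=x+iy$, and $(\bar\partial-A)^2$ is $w\mapsto\bar\partial w-Aw$ composed with itself. The boundary condition prescribes boundary values in the usual sense of the Dirichlet problem. *)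

theory Defs
  imports "HOL-Analysis.Analysis"
begin

section \<open>Bicomplex numbers\<close>

text \<open>\<open>Bicomplex z1 z2\<close> stands for \<open>z1 + j z2\<close>.\<close>

datatype bicomplex = Bicomplex (bc1: complex) (bc2: complex)

lemma bicomplex_eq_iff: "w = v \<longleftrightarrow> bc1 w = bc1 v \<and> bc2 w = bc2 v"
  by (cases w; cases v) auto

definition bc_plus :: "bicomplex \<Rightarrow> complex"
  where "bc_plus w = bc1 w - \<i> * bc2 w"

definition bc_minus :: "bicomplex \<Rightarrow> complex"
  where "bc_minus w = bc1 w + \<i> * bc2 w"

definition bc_j :: bicomplex
  where "bc_j = Bicomplex 0 1"

instantiation bicomplex :: comm_ring_1
begin

definition "0 = Bicomplex 0 0"
definition "1 = Bicomplex 1 0"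
definition "w + v = Bicomplex (bc1 w + bc1 v) (bc2 w + bc2 v)"
definition "w - v = Bicomplex (bc1 w - bc1 v) (bc2 w - bc2 v)"
definition "- w = Bicomplex (- bc1 w) (- bc2 w)"
definition "w * v = Bicomplex (bc1 w * bc1 v - bc2 w * bc2 v) (bc1 w * bc2 v + bc2 w * bc1 v)"

lemmas bicomplex_ring_defs =
  zero_bicomplex_def one_bicomplex_def plus_bicomplex_def minus_bicomplex_def
  uminus_bicomplex_def times_bicomplex_def

instance
  by standard (simp_all add: bicomplex_ring_defs algebra_simps)

end

lemma bc_j_square: "bc_j * bc_j = -1"
  by (simp add: bc_j_def bicomplex_ring_defs)

instantiation bicomplex :: real_algebra_1
begin

definition "r *\<^sub>R w = Bicomplex (r *\<^sub>R bc1 w) (r *\<^sub>R bc2 w)"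

instance
  by standard (simp_all add: scaleR_bicomplex_def bicomplex_ring_defs algebra_simps)

end

text \<open>The norm is only submultiplicative up to the factor \<open>sqrt 2\<close>, so there is no
  \<^class>\<open>real_normed_algebra\<close> instance.\<close>

instantiation bicomplex :: real_inner
begin

definition "inner w v = (inner (bc_plus w) (bc_plus v) + inner (bc_minus w) (bc_minus v)) / 2"
definition "norm w = sqrt (((cmod (bc_plus w))\<^sup>2 + (cmod (bc_minus w))\<^sup>2) / 2)"
definition "dist w v = norm (w - v :: bicomplex)"
definition "sgn w = w /\<^sub>R norm (w :: bicomplex)"
definition [code del]: "(uniformity :: (bicomplex \<times> bicomplex) filter) =
  (INF e\<in>{0<..}. principal {(x, y). dist x y < e})"
definition [code del]: "open (U :: bicomplex set) \<longleftrightarrow>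
  (\<forall>x\<in>U. eventually (\<lambda>(x', y). x' = x \<longrightarrow> y \<in> U) uniformity)"

lemma inner_bicomplex_components:
  "inner w v = inner (bc1 w) (bc1 v) + inner (bc2 w) (bc2 v)" for w v :: bicomplex
  by (simp add: inner_bicomplex_def bc_plus_def bc_minus_def inner_complex_def field_simps)

instance
proof
  fix w v u :: bicomplex and r :: real
  show "dist w v = norm (w - v)" by (rule dist_bicomplex_def)
  show "sgn w = w /\<^sub>R norm w" by (rule sgn_bicomplex_def)
  show "uniformity = (INF e\<in>{0<..}. principal {(x, y :: bicomplex). dist x y < e})"
    by (rule uniformity_bicomplex_def)
  show "open U \<longleftrightarrow> (\<forall>x\<in>U. eventually (\<lambda>(x', y). x' = x \<longrightarrow> y \<in> U) uniformity)"
    for U :: "bicomplex set" by (rule open_bicomplex_def)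
  show "inner w v = inner v w"
    by (simp add: inner_bicomplex_components inner_commute)
  show "inner (w + v) u = inner w u + inner v u"
    by (simp add: inner_bicomplex_components plus_bicomplex_def inner_add_left)
  show "inner (r *\<^sub>R w) v = r * inner w v"
    by (simp add: inner_bicomplex_components scaleR_bicomplex_def algebra_simps)
  show "0 \<le> inner w w"
    by (simp add: inner_bicomplex_components)
  show "inner w w = 0 \<longleftrightarrow> w = 0"
    by (simp add: inner_bicomplex_components add_nonneg_eq_0_iff bicomplex_eq_iff zero_bicomplex_def)
  show "norm w = sqrt (inner w w)"
    by (simp add: norm_bicomplex_def inner_bicomplex_def power2_norm_eq_inner)
qed

end

instantiation bicomplex :: euclidean_space
begin

definition "Basis = {Bicomplex 1 0, Bicomplex \<i> 0, Bicomplex 0 1, Bicomplex 0 \<i>}"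

instance
proof
  show "(Basis :: bicomplex set) \<noteq> {}" "finite (Basis :: bicomplex set)"
    by (simp_all add: Basis_bicomplex_def)
  show "\<And>u v :: bicomplex. u \<in> Basis \<Longrightarrow> v \<in> Basis \<Longrightarrow> inner u v = (if u = v then 1 else 0 :: real)"
    by (auto simp: Basis_bicomplex_def inner_bicomplex_components inner_complex_def)
  show "(\<forall>u\<in>Basis. inner x u = 0) \<longleftrightarrow> x = 0" for x :: bicomplex
    by (simp only: Basis_bicomplex_def ball_simps inner_bicomplex_components inner_complex_def
        bicomplex_eq_iff zero_bicomplex_def complex_eq_iff) auto
qed

end

section \<open>Weak derivatives and Sobolev functions on plane domains\<close>

text \<open>The plane is identified with \<^typ>\<open>complex\<close>; the directions \<open>1\<close> and \<open>\<i>\<close> give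
  \<open>\<partial>/\<partial>x\<close> and \<open>\<partial>/\<partial>y\<close>.\<close>

primrec C_k :: "nat \<Rightarrow> (complex \<Rightarrow> real) \<Rightarrow> bool" where
  "C_k 0 \<phi> \<longleftrightarrow> continuous_on UNIV \<phi>"
| "C_k (Suc k) \<phi> \<longleftrightarrow> \<phi> differentiable_on UNIV \<and>
     C_k k (\<lambda>z. frechet_derivative \<phi> (at z) 1) \<and> C_k k (\<lambda>z. frechet_derivative \<phi> (at z) \<i>)"

definition test_function :: "complex set \<Rightarrow> (complex \<Rightarrow> real) \<Rightarrow> bool" where
  "test_function S \<phi> \<longleftrightarrow> (\<forall>k. C_k k \<phi>) \<and>
     compact (closure {z. \<phi> z \<noteq> 0}) \<and> closure {z. \<phi> z \<noteq> 0} \<subseteq> S"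

definition locally_integrable :: "complex set \<Rightarrow> (complex \<Rightarrow> bicomplex) \<Rightarrow> bool" where
  "locally_integrable S f \<longleftrightarrow> (\<forall>K. compact K \<and> K \<subseteq> S \<longrightarrow> f absolutely_integrable_on K)"

definition has_weak_deriv ::
  "complex set \<Rightarrow> complex \<Rightarrow> (complex \<Rightarrow> bicomplex) \<Rightarrow> (complex \<Rightarrow> bicomplex) \<Rightarrow> bool" where
  "has_weak_deriv S e f g \<longleftrightarrow> locally_integrable S f \<and> locally_integrable S g \<and>
     (\<forall>\<phi>. test_function S \<phi> \<longrightarrow>
        (LINT z:S|lebesgue. frechet_derivative \<phi> (at z) e *\<^sub>R f z) =
        - (LINT z:S|lebesgue. \<phi> z *\<^sub>R g z))"

definition L_space :: "real \<Rightarrow> complex set \<Rightarrow> (complex \<Rightarrow> bicomplex) set" where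
  "L_space q S = {f. set_borel_measurable lebesgue S f \<and>
     set_integrable lebesgue S (\<lambda>z. norm (f z) powr q)}"

definition W1_space :: "real \<Rightarrow> complex set \<Rightarrow> (complex \<Rightarrow> bicomplex) set" where
  "W1_space q S = {f \<in> L_space q S. \<exists>fx\<in>L_space q S. \<exists>fy\<in>L_space q S.
     has_weak_deriv S 1 f fx \<and> has_weak_deriv S \<i> f fy}"

section \<open>The Dirichlet problem\<close>

text \<open>With \<open>dbar = (\<partial>/\<partial>x + j \<partial>/\<partial>y) / 2\<close> taken in the weak sense, \<open>dbar w - A w\<close>
  is determined only up to null sets; hence the operator \<open>w \<mapsto> dbar w - A w\<close> is a relation
  between \<open>w\<close> and the representatives \<open>v\<close> of its image, and its square is the relational
  composition \<^const>\<open>relcompp\<close> with itself.\<close>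

definition dbar_minus ::
  "complex set \<Rightarrow> (complex \<Rightarrow> bicomplex) \<Rightarrow>
   (complex \<Rightarrow> bicomplex) \<Rightarrow> (complex \<Rightarrow> bicomplex) \<Rightarrow> bool" where
  "dbar_minus S A w v \<longleftrightarrow>
     (\<exists>wx wy. has_weak_deriv S 1 w wx \<and> has_weak_deriv S \<i> w wy \<and>
        (AE z in lebesgue. z \<in> S \<longrightarrow>
           v z = (1/2) *\<^sub>R (wx z + bc_j * wy z) - A z * w z))"

text \<open>Boundary values are attained continuously.  Requiring \<^term>\<open>w \<in> extensional (cball 0 1)\<close>
  makes two solutions equal as soon as they agree on the closed disk, so that values off the
  disk do not create spurious solutions; by continuity, solutions equal almost everywhere in
  the disk are equal as well.\<close>

definition dirichlet_solution ::
  "(complex \<Rightarrow> bicomplex) \<Rightarrow> (complex \<Rightarrow> bicomplex) \<Rightarrow> bool" where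
  "dirichlet_solution A w \<longleftrightarrow> w \<in> extensional (cball 0 1) \<and> continuous_on (cball 0 1) w \<and>
     (dbar_minus (ball 0 1) A OO dbar_minus (ball 0 1) A) w (\<lambda>z. 0) \<and>
     (\<forall>z\<in>sphere 0 1. w z = 0)"

end

theory Submission imports Defs begin

text \<open>
  In the idempotent components \<open>w\<^sup>+\<close>, \<open>w\<^sup>-\<close> the operator \<open>dbar\<close> acts as \<open>\<partial>/\<partial>z\<close> on \<open>w\<^sup>+\<close> and as
  \<open>\<partial>/\<partial>zbar\<close> on \<open>w\<^sup>-\<close>, so one may put \<open>w\<^sup>+ = 0\<close> and solve a scalar problem.  If
  \<open>\<partial>\<alpha>/\<partial>zbar = A\<^sup>-\<close>, then \<open>w\<^sup>- = k (1 - z zbar) exp \<alpha>\<close> vanishes on the circle, \<open>dbar - A\<close> maps it to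
  \<open>- k z exp \<alpha>\<close>, and \<open>dbar - A\<close> annihilates the latter; each real \<open>k\<close> gives a solution.

  A function \<open>\<alpha>\<close> that is continuous on the plane and \<open>C\<^sup>1\<close> in the disc is a multiple of the
  Cauchy transform of \<open>A\<^sup>-\<close>.  It is the uniform limit of convolutions with the smooth kernels
  \<open>cnj t / (\<bar>t\<bar>\<^sup>2 + e)\<close>.  The weak derivatives of \<open>A\<^sup>-\<close>, tested against these kernels times a cutoff,
  show that the gradients of the convolutions converge locally uniformly (this is where
  \<open>q > 2\<close> enters), and their \<open>dbar\<close>-derivatives are convolutions with the approximate identity
  \<open>e / (\<bar>t\<bar>\<^sup>2 + e)\<^sup>2\<close>, whose total mass never has to be computed.
\<close>

section \<open>Smooth functions on the plane\<close>

text \<open>The weak equation is solved by classical calculus: once \<alpha> is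
  \<open>C\<^sup>1\<close> in the disc, product and chain rule apply to the solutions, and their
  classical derivatives are weak ones. The obstacle is that regularity. The gradient of the Cauchy
  transform of a function that is merely in \<open>L\<^sup>q\<close> is a singular integral and need
  not be continuous. One weak derivative of \<open>A\<close> turns it, locally, into Cauchy
  transforms of \<open>L\<^sup>q\<close> functions plus a smooth remainder, and for
  \<open>q > 2\<close> the conjugate exponent is below \<open>2\<close>, so the kernel
  \<open>1 / t\<close> is integrable enough to make these continuous.

  The factor \<open>1 - z zbar\<close> has its origin in the Bitsadze equation. Writing
  \<open>w\<^sup>- = f exp \<alpha>\<close> removes \<open>A\<close> and leaves the twice iterated
  derivative of \<open>f\<close> by \<open>zbar\<close> equal to zero, whose solutions are
  \<open>h0 + zbar h1\<close> with \<open>h0\<close>, \<open>h1\<close> holomorphic. On the circle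
  \<open>zbar = 1 / z\<close>, so \<open>h1 = - z h0\<close> gives zero boundary values; constants
  \<open>h0 = k\<close> are enough.\<close>

lemma C_k_SucI:
  assumes "\<And>z. (f has_derivative D z) (at z)"
    and "C_k k (\<lambda>z. D z 1)" "C_k k (\<lambda>z. D z \<i>)"
  shows "C_k (Suc k) f"
proof -
  have "frechet_derivative f (at z) = D z" for z
    using assms(1) frechet_derivative_at by metis
  then show ?thesis
    using assms by (auto simp: differentiable_on_def differentiable_def intro: has_derivative_at_withinI)
qed

lemma C_k_SucD:
  assumes "C_k (Suc k) f"
  shows "(f has_derivative frechet_derivative f (at z)) (at z)"
    and "C_k k (\<lambda>z. frechet_derivative f (at z) 1)" "C_k k (\<lambda>z. frechet_derivative f (at z) \<i>)"
  using assms by (auto simp: differentiable_on_def frechet_derivative_works)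

lemma C_k_const: "C_k k (\<lambda>z. c)"
proof (induction k arbitrary: c)
  case (Suc k)
  show ?case by (rule C_k_SucI[where D="\<lambda>_ _. 0"]) (auto simp: Suc)
qed auto

lemma C_k_continuous:
  assumes "C_k k f" shows "continuous_on UNIV f"
  using assms by (cases k) (auto intro: differentiable_imp_continuous_on)

lemma C_k_mono_Suc: "C_k (Suc k) f \<Longrightarrow> C_k k f"
proof (induction k arbitrary: f)
  case 0
  then show ?case by (auto intro: differentiable_imp_continuous_on)
next
  case (Suc k)
  note f = C_k_SucD[OF Suc.prems]
  show ?case
    by (rule C_k_SucI[OF f(1)]; rule Suc.IH, fact f)
qed

lemma C_k_add:
  assumes "C_k k f" "C_k k g" shows "C_k k (\<lambda>z. f z + g z)"
  using assms
proof (induction k arbitrary: f g)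
  case (Suc k)
  note f = C_k_SucD[OF Suc.prems(1)] and g = C_k_SucD[OF Suc.prems(2)]
  show ?case
    by (rule C_k_SucI[OF has_derivative_add[OF f(1) g(1)]]; intro Suc.IH f g)
qed (simp add: continuous_on_add)

lemma C_k_mult:
  assumes "C_k k f" "C_k k g" shows "C_k k (\<lambda>z. f z * g z)"
  using assms
proof (induction k arbitrary: f g)
  case (Suc k)
  note f = C_k_SucD[OF Suc.prems(1)] and g = C_k_SucD[OF Suc.prems(2)]
  show ?case
    by (rule C_k_SucI[OF has_derivative_mult[OF f(1) g(1)]];
      intro C_k_add Suc.IH f(2,3) g(2,3) C_k_mono_Suc[OF Suc.prems(1)] C_k_mono_Suc[OF Suc.prems(2)])
qed (simp add: continuous_on_mult)

lemma C_k_diff: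
  assumes "C_k k f" "C_k k g" shows "C_k k (\<lambda>z. f z - g z)"
  using C_k_add[OF assms(1) C_k_mult[OF C_k_const assms(2)], of "-1"] by simp

lemma C_k_inverse:
  assumes "C_k k f" "\<And>z. f z \<noteq> 0" shows "C_k k (\<lambda>z. inverse (f z))"
  using assms
proof (induction k arbitrary: f)
  case (Suc k)
  note f = C_k_SucD[OF Suc.prems(1)]
  have i: "C_k k (\<lambda>z. inverse (f z))"
    by (rule Suc.IH[OF C_k_mono_Suc[OF Suc.prems(1)] Suc.prems(2)])
  have d: "C_k k (\<lambda>z. - (inverse (f z) * d z * inverse (f z)))" if "C_k k d" for d
    using C_k_mult[OF C_k_const C_k_mult[OF C_k_mult[OF i that] i], of "-1"] by simp
  show ?case
    by (intro C_k_SucI[OF Deriv.has_derivative_inverse[OF Suc.prems(2) f(1)]] d f)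
qed (simp add: continuous_on_inverse)

lemma C_k_divide:
  assumes "C_k k f" "C_k k g" "\<And>z. g z \<noteq> 0" shows "C_k k (\<lambda>z. f z / g z)"
  using C_k_mult[OF assms(1) C_k_inverse[OF assms(2,3)]] by (simp add: divide_inverse)

lemma C_k_Re: "C_k k Re"
proof (cases k)
  case 0
  then show ?thesis using continuous_on_Re[OF continuous_on_id, of UNIV] by simp
next
  case (Suc j)
  have "(Re has_derivative Re) (at z)" for z
    by (rule bounded_linear_imp_has_derivative[OF bounded_linear_Re])
  then show ?thesis unfolding Suc
    by (rule C_k_SucI) (simp_all add: C_k_const)
qed

lemma C_k_Im: "C_k k Im"
proof (cases k)
  case 0
  then show ?thesis using continuous_on_Im[OF continuous_on_id, of UNIV] by simp
next
  case (Suc j)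
  have "(Im has_derivative Im) (at z)" for z
    by (rule bounded_linear_imp_has_derivative[OF bounded_linear_Im])
  then show ?thesis unfolding Suc
    by (rule C_k_SucI) (simp_all add: C_k_const)
qed

lemma C_k_norm_squared: "C_k k (\<lambda>z. (cmod z)\<^sup>2)"
proof -
  have "C_k k (\<lambda>z. Re z * Re z + Im z * Im z)"
    by (intro C_k_add C_k_mult C_k_Re C_k_Im)
  then show ?thesis by (simp add: cmod_def power2_eq_square)
qed

text \<open>The derivative of \<open>x\<^sup>-\<^sup>n exp (-1/x)\<close> is a combination of functions of the same kind, which
  makes the class of these profiles (as \<open>n\<close> varies) stable under differentiation.\<close>

definition flat_exp :: "nat \<Rightarrow> real \<Rightarrow> real" where
  "flat_exp n x = (if x > 0 then inverse x ^ n * exp (- inverse x) else 0)"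

lemma flat_exp_nonneg: "flat_exp n x \<ge> 0"
  and flat_exp_pos_iff: "flat_exp n x > 0 \<longleftrightarrow> x > 0"
  and flat_exp_eq_0: "x \<le> 0 \<Longrightarrow> flat_exp n x = 0"
  by (auto simp: flat_exp_def)

text \<open>Since \<open>flat_exp n 0 = 0\<close>, this is the difference quotient at
  \<open>0\<close>, so the limit is the derivative there. On the right \<open>y = 1/x\<close> turns
  it into \<open>y ^ (n + 1) * exp (- y)\<close>; on the left it is constantly zero.\<close>

lemma flat_exp_tendsto: "((\<lambda>x. flat_exp n x / x) \<longlongrightarrow> 0) (at 0)"
proof -
  have "((\<lambda>y. y ^ Suc n * exp (- y)) \<longlongrightarrow> 0) (at_top :: real filter)"
    using tendsto_power_div_exp_0[of "Suc n"] by (simp add: exp_minus field_simps)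
  then have "((\<lambda>x::real. inverse x ^ Suc n * exp (- inverse x)) \<longlongrightarrow> 0) (at_right 0)"
    by (rule filterlim_compose[OF _ filterlim_inverse_at_top_right])
  then have "((\<lambda>x. flat_exp n x / x) \<longlongrightarrow> 0) (at_right 0)"
    by (rule Lim_transform_eventually)
      (auto simp: flat_exp_def field_simps intro!: eventually_at_right_less[THEN eventually_mono])
  moreover have "((\<lambda>x. flat_exp n x / x) \<longlongrightarrow> 0) (at_left 0)"
    by (rule Lim_transform_eventually[OF tendsto_const])
      (auto simp: flat_exp_def eventually_at_filter)
  ultimately show ?thesis by (simp add: filterlim_split_at)
qed

lemma flat_exp_DERIV:
  "(flat_exp n has_real_derivative (flat_exp (n + 2) x - real n * flat_exp (n + 1) x)) (at x)"
proof (cases x "0::real" rule: linorder_cases)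
  case less
  have "((\<lambda>x. 0) has_real_derivative 0) (at x)" by simp
  then have "(flat_exp n has_real_derivative 0) (at x)"
    by (rule has_field_derivative_transform_within_open[where S="{..<0}"])
      (use less in \<open>auto simp: flat_exp_def\<close>)
  then show ?thesis using less by (simp add: flat_exp_def)
next
  case equal
  have "(flat_exp n has_real_derivative 0) (at 0)"
    unfolding DERIV_def using flat_exp_tendsto[of n] by (simp add: flat_exp_eq_0)
  then show ?thesis using equal by (simp add: flat_exp_def)
next
  case greater
  define y where "y = inverse x"
  have "((\<lambda>x. inverse x ^ n * exp (- inverse x)) has_real_derivative
      real n * y ^ (n - 1) * (- (y * y)) * exp (- y) + y ^ n * (exp (- y) * (y * y))) (at x)"
    unfolding y_def by (rule derivative_eq_intros refl | use greater in force)+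
  also have "real n * y ^ (n - 1) * (- (y * y)) * exp (- y) + y ^ n * (exp (- y) * (y * y))
      = y ^ (n + 2) * exp (- y) - real n * (y ^ (n + 1) * exp (- y))"
    by (cases n) (simp_all add: algebra_simps)
  finally have "((\<lambda>x. inverse x ^ n * exp (- inverse x)) has_real_derivative
      (flat_exp (n + 2) x - real n * flat_exp (n + 1) x)) (at x)"
    using greater unfolding y_def flat_exp_def by simp
  then show ?thesis
    by (rule has_field_derivative_transform_within_open[where S="{0<..}"])
      (use greater in \<open>auto simp: flat_exp_def\<close>)
qed

lemma C_k_flat_exp:
  assumes "\<And>k. C_k k u" shows "C_k k (\<lambda>z. flat_exp n (u z))"
proof (induction k arbitrary: n)
  case 0
  have "isCont (flat_exp n) x" for x by (rule DERIV_isCont[OF flat_exp_DERIV])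
  then have "continuous_on UNIV (flat_exp n)" by (simp add: continuous_at_imp_continuous_on)
  then show ?case
    using continuous_on_compose2[OF _ C_k_continuous[OF assms]] by auto
next
  case (Suc k)
  have d: "((\<lambda>z. flat_exp n (u z)) has_derivative
     (\<lambda>h. (flat_exp (n + 2) (u z) - real n * flat_exp (n + 1) (u z)) * frechet_derivative u (at z) h)) (at z)" for z
    using has_derivative_compose[OF C_k_SucD(1)[OF assms] flat_exp_DERIV[unfolded has_field_derivative_def]] .
  show ?case
    by (rule C_k_SucI[OF d]; intro C_k_mult C_k_diff C_k_const Suc C_k_SucD assms)
qed

text \<open>A quotient \<open>f / (f + g)\<close> of flat profiles: \<open>f\<close> lives inside
  radius \<open>R\<close>, \<open>g\<close> outside radius \<open>r\<close>, and
  \<open>r < R\<close> leaves no point where both vanish. Squared moduli appear because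
  \<open>cmod\<close> is not smooth at the origin.\<close>

lemma smooth_cutoff:
  assumes "0 < r" "r < R"
  obtains \<eta> :: "complex \<Rightarrow> real" where "\<And>k. C_k k \<eta>" "\<And>z. cmod z \<le> r \<Longrightarrow> \<eta> z = 1"
    "\<And>z. cmod z \<ge> R \<Longrightarrow> \<eta> z = 0" "\<And>z. 0 \<le> \<eta> z" "\<And>z. \<eta> z \<le> 1"
proof
  let ?f = "\<lambda>z. flat_exp 0 (R\<^sup>2 - (cmod z)\<^sup>2)" and ?g = "\<lambda>z. flat_exp 0 ((cmod z)\<^sup>2 - r\<^sup>2)"
  let ?\<eta> = "\<lambda>z. ?f z / (?f z + ?g z)"
  have sq: "r\<^sup>2 < R\<^sup>2" using assms by (intro power_strict_mono) auto
  have pos: "?f z + ?g z > 0" for z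
  proof (cases "(cmod z)\<^sup>2 < R\<^sup>2")
    case True
    then show ?thesis
      by (intro add_pos_nonneg) (auto simp: flat_exp_pos_iff flat_exp_nonneg)
  next
    case False
    then have "(cmod z)\<^sup>2 > r\<^sup>2" using sq by linarith
    then show ?thesis
      by (intro add_nonneg_pos) (auto simp: flat_exp_pos_iff flat_exp_nonneg)
  qed
  show "C_k k ?\<eta>" for k
    by (intro C_k_divide C_k_add C_k_flat_exp C_k_diff C_k_const C_k_norm_squared)
      (metis pos less_irrefl)
  show "?\<eta> z = 1" if "cmod z \<le> r" for z
  proof -
    have "?g z = 0" using that by (intro flat_exp_eq_0) (simp add: power_mono)
    then show ?thesis using pos[of z] by simp
  qed
  show "?\<eta> z = 0" if "cmod z \<ge> R" for z
  proof -
    have "?f z = 0" using that assms by (intro flat_exp_eq_0) (simp add: power_mono)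
    then show ?thesis by simp
  qed
  show "0 \<le> ?\<eta> z" for z by (intro divide_nonneg_pos flat_exp_nonneg pos)
  show "?\<eta> z \<le> 1" for z
    using pos[of z] flat_exp_nonneg[of 0 "(cmod z)\<^sup>2 - r\<^sup>2"] by (simp add: divide_le_eq)
qed

text \<open>Lets a kernel that is smooth on the plane but not compactly supported serve as a test
  function; \<open>R < 1\<close> keeps the support away from the circle.\<close>

lemma test_function_mult:
  assumes "\<And>k. C_k k \<eta>" "\<And>k. C_k k \<psi>" "\<And>z. cmod z \<ge> R \<Longrightarrow> \<eta> z = 0" "R < 1"
  shows "test_function (ball 0 1) (\<lambda>z. \<eta> z * \<psi> z)"
proof -
  have "closure {z. \<eta> z * \<psi> z \<noteq> 0} \<subseteq> cball 0 R"
    by (rule closure_minimal) (use assms(3) in \<open>auto simp: not_le[symmetric]\<close>, force)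
  then show ?thesis unfolding test_function_def
    using assms by (auto intro!: C_k_mult simp: compact_eq_bounded_closed intro: bounded_subset[OF bounded_cball])
qed

section \<open>Classical derivatives are weak derivatives\<close>

lemma integral_lborel_translate:
  fixes f :: "'a::euclidean_space \<Rightarrow> 'b::{banach, second_countable_topology}"
  assumes [measurable]: "f \<in> borel_measurable borel"
  shows "(\<integral>z. f (c + z) \<partial>lborel) = (\<integral>z. f z \<partial>lborel)"
  using integral_distr[of "(+) c" lborel borel f] by (simp add: lborel_distr_plus)

lemma integrable_lborel_translate:
  fixes f :: "'a::euclidean_space \<Rightarrow> 'b::{banach, second_countable_topology}"
  assumes "integrable lborel f"
  shows "integrable lborel (\<lambda>z. f (c + z))"
  using assms integrable_distr[of "(+) c" lborel borel f] by (simp add: lborel_distr_plus)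

lemma integrable_continuous_compact_support:
  fixes g :: "'a::euclidean_space \<Rightarrow> 'b::euclidean_space"
  assumes "continuous_on UNIV g" "compact K" "\<And>z. z \<notin> K \<Longrightarrow> g z = 0"
  shows "integrable lborel g"
proof -
  have "integrable lborel (\<lambda>x. indicator K x *\<^sub>R g x)"
    by (rule borel_integrable_compact[OF assms(2) continuous_on_subset[OF assms(1)]]) auto
  moreover have "(\<lambda>x. indicator K x *\<^sub>R g x) = g"
    using assms(3) by (auto simp: indicator_def fun_eq_iff)
  ultimately show ?thesis by simp
qed

lemma continuous_compact_support_bounded:
  fixes g :: "'a::euclidean_space \<Rightarrow> 'b::real_normed_vector"
  assumes "continuous_on UNIV g" "compact K" "\<And>z. z \<notin> K \<Longrightarrow> g z = 0"
  obtains M where "M \<ge> 0" "\<And>z. norm (g z) \<le> M"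
proof -
  have "bounded (g ` K)"
    using assms by (intro compact_imp_bounded compact_continuous_image) (auto intro: continuous_on_subset)
  then obtain M where "M > 0" "\<And>z. z \<in> K \<Longrightarrow> norm (g z) \<le> M"
    by (auto simp: bounded_pos)
  then have "norm (g z) \<le> M" for z using assms(3)[of z] by (cases "z \<in> K") auto
  with \<open>M > 0\<close> show ?thesis using that[of M] by simp
qed

text \<open>The open sets \<open>S\<close> and \<open>- K\<close> cover the space, and on the second
  the extension is identically zero.\<close>

lemma continuous_extend_by_zero:
  fixes g :: "'a::topological_space \<Rightarrow> 'b::real_normed_vector"
  assumes "open S" "continuous_on S g" "closed K" "K \<subseteq> S" "\<And>z. z \<in> S - K \<Longrightarrow> g z = 0"
  shows "continuous_on UNIV (\<lambda>z. if z \<in> S then g z else 0)"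
proof -
  have "continuous_on (S \<union> - K) (\<lambda>z. if z \<in> S then g z else 0)"
  proof (rule continuous_on_open_Un)
    show "continuous_on S (\<lambda>z. if z \<in> S then g z else 0)"
      using assms(2) by (rule continuous_on_eq) simp
    show "continuous_on (- K) (\<lambda>z. if z \<in> S then g z else 0)"
      using continuous_on_const[of _ 0] by (rule continuous_on_eq) (use assms(5) in auto)
  qed (use assms in auto)
  moreover have "S \<union> - K = UNIV" using assms(4) by auto
  ultimately show ?thesis by simp
qed

text \<open>The difference quotients of a compactly supported function have integral zero by
  translation invariance, so no iterated integral is needed.\<close>

lemma integral_directional_derivative_eq_0:
  fixes f :: "'a::euclidean_space \<Rightarrow> 'b::euclidean_space"
  assumes d: "\<And>z. (f has_derivative D z) (at z)" and c: "continuous_on UNIV (\<lambda>z. D z e)"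
    and K: "compact K" "\<And>z. z \<notin> K \<Longrightarrow> f z = 0"
  shows "(\<integral>z. D z e \<partial>lborel) = 0"
proof -
  \<comment> \<open>\<open>f\<close> vanishes on the open set \<open>- K\<close>, hence so does its
    derivative; compact support then gives the bound \<open>M\<close>.\<close>
  have D0: "D z e = 0" if "z \<notin> K" for z
  proof -
    have "(f has_derivative (\<lambda>_. 0)) (at z)"
      by (rule has_derivative_transform_within_open[OF has_derivative_const[of 0], where s="- K"])
        (use K that in \<open>auto intro: compact_imp_closed\<close>)
    then have "D z = (\<lambda>_. 0)" using d has_derivative_unique by blast
    then show ?thesis by simp
  qed
  obtain M where M: "M \<ge> 0" "\<And>z. norm (D z e) \<le> M"
    using continuous_compact_support_bounded[OF c K(1) D0] by blast
  have cf: "continuous_on UNIV f"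
    using has_derivative_continuous[OF d] by (simp add: continuous_at_imp_continuous_on)
  have fi: "integrable lborel f"
    by (rule integrable_continuous_compact_support[OF cf K])
  have fb [measurable]: "f \<in> borel_measurable borel"
    using fi by (simp add: borel_measurable_integrable)
  have [measurable]: "(\<lambda>z. D z e) \<in> borel_measurable borel"
    by (rule borel_measurable_continuous_onI[OF c])
  obtain B where B: "K \<subseteq> cball 0 B"
    using compact_imp_bounded[OF K(1)] by (metis bounded_iff mem_cball_0 subsetI)
  define g where "g n z = real (Suc n) *\<^sub>R (f (inverse (real (Suc n)) *\<^sub>R e + z) - f z)" for n z
  have lip: "norm (f (t *\<^sub>R e + z) - f z) \<le> M * \<bar>t\<bar>" for t z
  proof -
    have "norm (f (t *\<^sub>R e + z) - f (0 *\<^sub>R e + z)) \<le> M * norm (t - 0)"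
    proof (rule differentiable_bound[where S=UNIV and f="\<lambda>s. f (s *\<^sub>R e + z)" and f'="\<lambda>s h. D (s *\<^sub>R e + z) (h *\<^sub>R e)"])
      show "((\<lambda>s. f (s *\<^sub>R e + z)) has_derivative (\<lambda>h. D (s *\<^sub>R e + z) (h *\<^sub>R e))) (at s)" for s
        by (rule has_derivative_compose[OF _ d]) (auto intro!: derivative_eq_intros)
      show "onorm (\<lambda>h. D (s *\<^sub>R e + z) (h *\<^sub>R e)) \<le> M" for s
      proof (rule onorm_le)
        have "linear (D (s *\<^sub>R e + z))"
          using d has_derivative_linear by blast
        then show "norm (D (s *\<^sub>R e + z) (h *\<^sub>R e)) \<le> M * norm h" for h
          using M(2)[of "s *\<^sub>R e + z"] by (simp add: linear_cmul mult.commute[of M] mult_left_mono)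
      qed
    qed auto
    then show ?thesis by simp
  qed
  \<comment> \<open>By the mean value bound \<open>lip\<close> the quotients are at most
    \<open>M\<close>. The steps are at most \<open>1\<close>, so points move by at most
    \<open>norm e\<close> and every quotient vanishes outside the ball of radius
    \<open>B + norm e\<close>.\<close>
  have "(\<lambda>n. \<integral>z. g n z \<partial>lborel) \<longlonglongrightarrow> (\<integral>z. D z e \<partial>lborel)"
  proof (rule integral_dominated_convergence[where w="\<lambda>z. M * indicator (cball 0 (B + norm e)) z"])
    show "g n \<in> borel_measurable lborel" for n unfolding g_def by measurable
    show "integrable lborel (\<lambda>z. M * indicator (cball 0 (B + norm e)) z :: real)"
      by (intro integrable_mult_right integrable_real_indicator)
        (use emeasure_lborel_cball_finite in simp_all)
    show "AE z in lborel. (\<lambda>n. g n z) \<longlonglongrightarrow> D z e"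
    proof (rule AE_I2)
      fix z
      have l: "linear (D z)" using d has_derivative_linear by blast
      have "(f has_derivative D z) (at (0 *\<^sub>R e + z))" using d[of z] by simp
      then have "((\<lambda>s. f (s *\<^sub>R e + z)) has_derivative (\<lambda>h. D z (h *\<^sub>R e))) (at 0)"
        by (rule has_derivative_compose[rotated]) (auto intro!: derivative_eq_intros)
      then have "((\<lambda>h. norm (f (h *\<^sub>R e + z) - f z - h *\<^sub>R D z e) / norm h) \<longlongrightarrow> 0) (at 0)"
        by (simp add: has_derivative_at linear_cmul[OF l])
      moreover have "filterlim (\<lambda>n. inverse (real (Suc n))) (at 0) sequentially"
        by (intro filterlim_atI LIMSEQ_inverse_real_of_nat) auto
      ultimately have "(\<lambda>n. norm (f (inverse (real (Suc n)) *\<^sub>R e + z) - f z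
          - inverse (real (Suc n)) *\<^sub>R D z e) / norm (inverse (real (Suc n)))) \<longlonglongrightarrow> 0"
        by (rule filterlim_compose)
      moreover have "norm (f (inverse (real (Suc n)) *\<^sub>R e + z) - f z
          - inverse (real (Suc n)) *\<^sub>R D z e) / norm (inverse (real (Suc n))) = norm (g n z - D z e)" for n
      proof -
        have "g n z - D z e = real (Suc n) *\<^sub>R (f (inverse (real (Suc n)) *\<^sub>R e + z) - f z
          - inverse (real (Suc n)) *\<^sub>R D z e)"
          by (simp only: g_def scaleR_diff_right scaleR_scaleR) simp
        then show ?thesis by (simp only: norm_scaleR) (simp add: field_simps)
      qed
      ultimately have "(\<lambda>n. norm (g n z - D z e)) \<longlonglongrightarrow> 0" by (simp only:)
      then show "(\<lambda>n. g n z) \<longlonglongrightarrow> D z e"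
        by (rule LIM_zero_cancel[OF tendsto_norm_zero_cancel])
    qed
    show "AE z in lborel. norm (g n z) \<le> M * indicator (cball 0 (B + norm e)) z" for n
    proof (rule AE_I2)
      fix z
      let ?t = "inverse (real (Suc n))"
      show "norm (g n z) \<le> M * indicator (cball 0 (B + norm e)) z"
      proof (cases "z \<in> cball 0 (B + norm e)")
        case True
        have "norm (g n z) = real (Suc n) * norm (f (?t *\<^sub>R e + z) - f z)"
          by (simp add: g_def del: of_nat_Suc)
        also have "\<dots> \<le> real (Suc n) * (M * \<bar>?t\<bar>)"
          by (intro mult_left_mono lip) simp
        also have "\<dots> = M" by simp
        finally show ?thesis using True by simp
      next
        case False
        have "norm (?t *\<^sub>R e) \<le> norm e"
          by (simp add: divide_simps distrib_left)
        then have "norm (?t *\<^sub>R e + z) > B"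
          using False norm_triangle_ineq4[of "?t *\<^sub>R e + z" "?t *\<^sub>R e"] by simp
        moreover have "norm z > B" using False norm_ge_zero[of e] by (simp del: norm_ge_zero)
        ultimately have "f (?t *\<^sub>R e + z) = 0" "f z = 0" using B by (auto intro!: K(2))
        then show ?thesis using False by (simp add: g_def)
      qed
    qed
  qed simp
  moreover have "(\<integral>z. g n z \<partial>lborel) = 0" for n
    unfolding g_def using integral_lborel_translate[OF fb] integrable_lborel_translate[OF fi] fi
    by simp
  ultimately show ?thesis by (simp add: LIMSEQ_const_iff)
qed

lemma locally_integrable_continuous:
  assumes "continuous_on S g" shows "locally_integrable S g"
  unfolding locally_integrable_def
proof (intro allI impI)
  fix K assume K: "compact K \<and> K \<subseteq> S"
  have "integrable lborel (\<lambda>x. indicator K x *\<^sub>R g x)"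
    by (rule borel_integrable_compact) (use K assms in \<open>auto intro: continuous_on_subset\<close>)
  then show "g absolutely_integrable_on K"
    by (simp add: set_integrable_def integrable_completion borel_measurable_integrable)
qed

lemma test_functionD:
  assumes "test_function S \<phi>"
  shows "C_k k \<phi>" "(\<phi> has_derivative frechet_derivative \<phi> (at z)) (at z)"
    "e \<in> {1, \<i>} \<Longrightarrow> C_k k (\<lambda>z. frechet_derivative \<phi> (at z) e)"
  using assms C_k_SucD[of 0 \<phi>] C_k_SucD(2,3)[of k \<phi>] unfolding test_function_def by blast+

lemma test_function_support:
  assumes "test_function S \<phi>"
  obtains K where "compact K" "K \<subseteq> S" "\<And>z. z \<notin> K \<Longrightarrow> \<phi> z = 0"
    "\<And>z e. z \<notin> K \<Longrightarrow> frechet_derivative \<phi> (at z) e = 0"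
proof
  let ?K = "closure {z. \<phi> z \<noteq> 0}"
  show "compact ?K" "?K \<subseteq> S" using assms unfolding test_function_def by auto
  show z: "\<phi> z = 0" if "z \<notin> ?K" for z
    using that closure_subset[of "{z. \<phi> z \<noteq> 0}"] by auto
  show "frechet_derivative \<phi> (at z) e = 0" if "z \<notin> ?K" for z e
  proof -
    have "(\<phi> has_derivative (\<lambda>_. 0)) (at z)"
      by (rule has_derivative_transform_within_open[OF has_derivative_const[of 0], where s="- ?K"])
        (use that in \<open>simp_all only: Compl_iff z open_Compl closed_closure not_False_eq_True\<close>)
    then show ?thesis by (metis frechet_derivative_at)
  qed
qed

text \<open>The defining identity says that the derivative of \<open>\<phi> z *\<^sub>R f z\<close>
  in direction \<open>e\<close> has integral zero. Continued by zero outside \<open>S\<close>, this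
  product is differentiable on the plane with compact support, so
  \<open>integral_directional_derivative_eq_0\<close> applies.\<close>

lemma has_weak_deriv_classical:
  fixes f :: "complex \<Rightarrow> bicomplex"
  assumes S: "open S" and e: "e \<in> {1, \<i>}"
    and d: "\<And>z. z \<in> S \<Longrightarrow> (f has_derivative D z) (at z)" and c: "continuous_on S (\<lambda>z. D z e)"
  shows "has_weak_deriv S e f (\<lambda>z. D z e)"
  unfolding has_weak_deriv_def
proof (intro conjI allI impI)
  have cf: "continuous_on S f"
    using d has_derivative_continuous continuous_at_imp_continuous_on by blast
  show "locally_integrable S f" "locally_integrable S (\<lambda>z. D z e)"
    using c cf by (auto intro: locally_integrable_continuous)
  fix \<phi> assume \<phi>: "test_function S \<phi>"
  note d\<phi> = test_functionD(2)[OF \<phi>]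
  obtain K where K: "compact K" "K \<subseteq> S" "\<And>z. z \<notin> K \<Longrightarrow> \<phi> z = 0"
    "\<And>z e. z \<notin> K \<Longrightarrow> frechet_derivative \<phi> (at z) e = 0"
    using test_function_support[OF \<phi>] by blast
  have cont: "continuous_on S \<phi>" "continuous_on S (\<lambda>z. frechet_derivative \<phi> (at z) e)"
    using C_k_continuous[OF test_functionD(1)[OF \<phi>]] C_k_continuous[OF test_functionD(3)[OF \<phi> e]]
      continuous_on_subset by blast+
  define g1 where "g1 z = (if z \<in> S then frechet_derivative \<phi> (at z) e *\<^sub>R f z else 0)" for z
  define g2 where "g2 z = (if z \<in> S then \<phi> z *\<^sub>R D z e else 0)" for z
  define F where "F z = (if z \<in> S then \<phi> z *\<^sub>R f z else 0)" for z
  define F' where "F' z h = (if z \<in> S then \<phi> z *\<^sub>R D z h + frechet_derivative \<phi> (at z) h *\<^sub>R f z else 0)" for z h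
  have g1c: "continuous_on UNIV g1" and g2c: "continuous_on UNIV g2"
    unfolding g1_def g2_def using K S c cf cont compact_imp_closed
    by (intro continuous_extend_by_zero[of _ _ K] continuous_intros; auto)+
  have g1i: "integrable lborel g1" and g2i: "integrable lborel g2"
    using K by (auto intro!: integrable_continuous_compact_support[OF g1c K(1)]
        integrable_continuous_compact_support[OF g2c K(1)] simp: g1_def g2_def)
  have "(\<integral>z. F' z e \<partial>lborel) = 0"
  proof (rule integral_directional_derivative_eq_0[OF _ _ K(1), where f=F])
    show "(F has_derivative F' z) (at z)" for z
    proof (cases "z \<in> S")
      case True
      have "((\<lambda>z. \<phi> z *\<^sub>R f z) has_derivative F' z) (at z)"
        unfolding F'_def using True has_derivative_scaleR[OF d\<phi> d[OF True]] by simp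
      then show ?thesis
        by (rule has_derivative_transform_within_open[OF _ S True]) (simp add: F_def)
    next
      case False
      have "F' z = (\<lambda>_. 0)" using False by (simp add: F'_def fun_eq_iff)
      moreover have "(F has_derivative (\<lambda>_. 0)) (at z)"
        by (rule has_derivative_transform_within_open[OF has_derivative_const[of 0], where s="- K"])
          (use K False in \<open>auto intro: compact_imp_closed simp: F_def\<close>)
      ultimately show ?thesis by simp
    qed
    have "(\<lambda>z. F' z e) = (\<lambda>z. g2 z + g1 z)" by (auto simp: F'_def g1_def g2_def)
    then show "continuous_on UNIV (\<lambda>z. F' z e)" by (simp only: continuous_on_add g1c g2c)
    show "F z = 0" if "z \<notin> K" for z using that K by (simp add: F_def)
  qed
  also have "(\<lambda>z. F' z e) = (\<lambda>z. g1 z + g2 z)" by (auto simp: F'_def g1_def g2_def)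
  finally have "(\<integral>z. g1 z \<partial>lborel) = - (\<integral>z. g2 z \<partial>lborel)"
    unfolding Bochner_Integration.integral_add[OF g1i g2i] by (simp only: eq_neg_iff_add_eq_0)
  moreover have "(LINT z:S|lebesgue. frechet_derivative \<phi> (at z) e *\<^sub>R f z) = (\<integral>z. g1 z \<partial>lborel)"
    "(LINT z:S|lebesgue. \<phi> z *\<^sub>R D z e) = (\<integral>z. g2 z \<partial>lborel)"
    using g1i g2i unfolding set_lebesgue_integral_def
    by (subst integral_completion[symmetric];
        auto intro!: Bochner_Integration.integral_cong simp: g1_def g2_def indicator_def)+
  ultimately show "(LINT z:S|lebesgue. frechet_derivative \<phi> (at z) e *\<^sub>R f z) =
      - (LINT z:S|lebesgue. \<phi> z *\<^sub>R D z e)" by simp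
qed

section \<open>The regularised Cauchy kernel\<close>

text \<open>For \<open>e = 0\<close> this is the Cauchy kernel \<open>1 / t\<close>.\<close>

definition cauchy_reg :: "real \<Rightarrow> complex \<Rightarrow> complex" where
  "cauchy_reg e t = cnj t / of_real ((cmod t)\<^sup>2 + e)"

text \<open>The real-linear Frechet derivative of \<open>cauchy_reg e\<close> at \<open>t\<close> in
  direction \<open>h\<close>. The coefficient of \<open>cnj h\<close> is, up to a constant factor,
  an approximate identity as \<open>e\<close> tends to \<open>0\<close>; the coefficient of
  \<open>h\<close> tends to \<open>- 1 / t\<^sup>2\<close>.\<close>

definition cauchy_reg' :: "real \<Rightarrow> complex \<Rightarrow> complex \<Rightarrow> complex" where
  "cauchy_reg' e t h = (of_real e * cnj h - (cnj t)\<^sup>2 * h) / (of_real ((cmod t)\<^sup>2 + e))\<^sup>2"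

lemma norm_cauchy_reg: "e \<ge> 0 \<Longrightarrow> cmod (cauchy_reg e t) = cmod t / ((cmod t)\<^sup>2 + e)"
  unfolding cauchy_reg_def norm_divide norm_of_real by simp

text \<open>A crude bound for fixed \<open>e\<close>: it only has to make each regularised
  convolution integrable and continuous, so its growth as \<open>e\<close> tends to \<open>0\<close>
  does no harm.\<close>

lemma norm_cauchy_reg_le:
  assumes "e > 0" shows "cmod (cauchy_reg e t) \<le> 1 + 1 / e"
proof -
  have "cmod t \<le> (cmod t)\<^sup>2 + 1"
    using zero_le_power2[of "cmod t - 1"] by (simp add: power2_diff power2_eq_square algebra_simps)
      (smt (verit) norm_ge_zero mult_nonneg_nonneg)
  also have "\<dots> \<le> (1 + 1 / e) * ((cmod t)\<^sup>2 + e)"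
    using assms by (simp add: field_simps)
  finally show ?thesis using assms by (simp add: norm_cauchy_reg divide_le_eq add_nonneg_pos)
qed

lemma has_derivative_cauchy_reg:
  assumes "e > 0" shows "(cauchy_reg e has_derivative cauchy_reg' e t) (at t)"
proof -
  have N: "of_real ((cmod z)\<^sup>2 + e) = z * cnj z + of_real e" for z
    using complex_norm_square[of z] by simp
  have nz: "t * cnj t + of_real e \<noteq> 0"
    unfolding N[symmetric] of_real_eq_0_iff using assms by (smt (verit) zero_le_power2)
  have c: "(cnj has_derivative cnj) (at t)"
    by (rule bounded_linear_imp_has_derivative[OF bounded_linear_cnj])
  have "((\<lambda>z. cnj z / (z * cnj z + of_real e)) has_derivative
      (\<lambda>h. (cnj h * (t * cnj t + of_real e) - cnj t * (t * cnj h + h * cnj t + 0))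
        / ((t * cnj t + of_real e) * (t * cnj t + of_real e)))) (at t)"
    by (rule has_derivative_divide'[OF c
          has_derivative_add[OF has_derivative_mult[OF has_derivative_ident c] has_derivative_const] nz])
  also have "(\<lambda>h. (cnj h * (t * cnj t + of_real e) - cnj t * (t * cnj h + h * cnj t + 0))
        / ((t * cnj t + of_real e) * (t * cnj t + of_real e))) = cauchy_reg' e t"
    unfolding cauchy_reg'_def N fun_eq_iff by (simp add: power2_eq_square algebra_simps)
  finally have "((\<lambda>z. cnj z / (z * cnj z + of_real e)) has_derivative cauchy_reg' e t) (at t)" .
  then show ?thesis unfolding cauchy_reg_def[abs_def] N .
qed

lemma norm_cauchy_reg'_le:
  assumes "e > 0" shows "cmod (cauchy_reg' e t h) \<le> cmod h / e"
proof -
  let ?N = "(cmod t)\<^sup>2 + e"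
  have N: "?N > 0" using assms by (simp add: add_nonneg_pos)
  have "cmod (of_real e * cnj h - (cnj t)\<^sup>2 * h) \<le> e * cmod h + (cmod t)\<^sup>2 * cmod h"
    using assms by (intro norm_triangle_ineq4[THEN order_trans]) (simp add: norm_mult norm_power)
  also have "\<dots> = ?N * cmod h" by (simp add: algebra_simps)
  finally have "cmod (cauchy_reg' e t h) \<le> ?N * cmod h / ?N\<^sup>2"
    unfolding cauchy_reg'_def norm_divide norm_power norm_of_real by (simp add: divide_right_mono)
  also have "\<dots> = cmod h / ?N" using N by (simp add: power2_eq_square)
  also have "\<dots> \<le> cmod h / e" using assms N by (intro divide_left_mono) auto
  finally show ?thesis .
qed

text \<open>For \<open>t \<noteq> 0\<close> the left side equals
  \<open>e / ((\<bar>t\<bar>\<^sup>2 + e) * \<bar>t\<bar>)\<close>. Bounding the sum from below by a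
  weighted geometric mean of \<open>e\<close> and \<open>\<bar>t\<bar>\<^sup>2\<close> trades
  singularity for rate: the gain \<open>e powr \<sigma>\<close> costs \<open>2 * \<sigma>\<close> in
  the exponent of the singularity.\<close>

lemma cauchy_reg_diff_le:
  assumes e: "e > 0" and \<sigma>: "0 \<le> \<sigma>" "\<sigma> \<le> 1"
  shows "cmod (cauchy_reg e t - 1 / t) \<le> e powr \<sigma> * cmod t powr - (1 + 2 * \<sigma>)"
proof (cases "t = 0")
  \<comment> \<open>Here \<open>1 / 0 = 0\<close> and \<open>cauchy_reg e 0 = 0\<close>, so the left
    side is zero.\<close>
  case True
  then show ?thesis by (simp add: cauchy_reg_def)
next
  case False
  let ?r = "cmod t"
  let ?N = "?r\<^sup>2 + e"
  have r: "?r > 0" using False by simp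
  have N: "?N > 0" using e by (simp add: add_nonneg_pos)
  have "cauchy_reg e t - 1 / t = (t * cnj t - of_real ?N) / (of_real ?N * t)"
    unfolding cauchy_reg_def using False N
    by (simp add: field_simps del: of_real_add of_real_power)
  also have "t * cnj t - of_real ?N = - of_real e"
    using complex_norm_square[of t] by simp
  finally have eq: "cmod (cauchy_reg e t - 1 / t) = e / (?N * ?r)"
    using e N by (simp add: norm_divide norm_mult del: of_real_add of_real_power)
  \<comment> \<open>Both bases are at most \<open>m\<close>, and the exponents
    \<open>1 - \<sigma>\<close> and \<sigma> are nonnegative with sum \<open>1\<close>; so the
    geometric mean is at most \<open>m\<close>, which is at most \<open>?N\<close>.\<close>
  define m where "m = max (?r\<^sup>2) e"
  have m: "m > 0" "m \<le> ?N" "e \<le> m" "?r\<^sup>2 \<le> m" using e by (auto simp: m_def)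
  have "e powr (1 - \<sigma>) * ?r powr (2 * \<sigma>) = e powr (1 - \<sigma>) * (?r\<^sup>2) powr \<sigma>"
    using r by (simp add: powr_powr flip: powr_numeral)
  also have "\<dots> \<le> m powr (1 - \<sigma>) * m powr \<sigma>"
    using e \<sigma> m by (intro mult_mono powr_mono2) auto
  also have "\<dots> = m" using m by (simp flip: powr_add)
  finally have *: "e powr (1 - \<sigma>) * ?r powr (2 * \<sigma>) \<le> ?N" using m by simp
  have "e / (?N * ?r) \<le> e / ((e powr (1 - \<sigma>) * ?r powr (2 * \<sigma>)) * ?r)"
    using e r N * by (intro divide_left_mono mult_right_mono) auto
  also have "\<dots> = e powr \<sigma> * ?r powr - (1 + 2 * \<sigma>)"
    using e r by (simp add: powr_minus powr_add powr_diff field_simps)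
  finally show ?thesis using eq by simp
qed

text \<open>\<open>- h / t\<^sup>2\<close> is the derivative of \<open>1 / t\<close>. The fourth
  power in the denominator is not integrable at the origin of the plane, so this estimate serves
  only at positive distance from the singularity.\<close>

lemma cauchy_reg'_diff_le:
  assumes e: "e > 0" and t: "t \<noteq> 0"
  shows "cmod (cauchy_reg' e t h - (- h / t\<^sup>2)) \<le> 3 * e / (cmod t) ^ 4 * cmod h"
proof -
  let ?r2 = "(cmod t)\<^sup>2"
  let ?N = "?r2 + e"
  have r: "?r2 > 0" using t by simp
  have N: "?N > 0" using e by (simp add: add_nonneg_pos)
  have r2: "(of_real ?r2 :: complex) = t * cnj t" using complex_norm_square[of t] by simp
  have "cauchy_reg' e t h - (- h / t\<^sup>2)
      = (of_real e * t\<^sup>2 * cnj h + ((of_real ?N)\<^sup>2 - (t * cnj t)\<^sup>2) * h) / ((of_real ?N)\<^sup>2 * t\<^sup>2)"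
    unfolding cauchy_reg'_def using t N
    by (simp add: field_simps power_mult_distrib del: of_real_add of_real_power)
  also have "(of_real ?N)\<^sup>2 - (t * cnj t)\<^sup>2 = (of_real (e * (2 * ?r2 + e)) :: complex)"
    unfolding r2[symmetric] by (simp add: power2_eq_square algebra_simps)
  finally have "cmod (cauchy_reg' e t h - (- h / t\<^sup>2))
      = cmod (of_real e * t\<^sup>2 * cnj h + of_real (e * (2 * ?r2 + e)) * h) / (?N\<^sup>2 * ?r2)"
    by (simp only: norm_divide norm_mult norm_power norm_of_real power2_abs)
  also have "\<dots> \<le> (e * ?r2 * cmod h + e * (2 * ?r2 + e) * cmod h) / (?N\<^sup>2 * ?r2)"
    by (intro divide_right_mono norm_triangle_ineq[THEN order_trans])
      (use e in \<open>simp_all add: norm_mult norm_power del: of_real_add of_real_mult\<close>)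
  \<comment> \<open>The constant comes from \<open>?r2 + (2 * ?r2 + e) \<le> 3 * ?N\<close>.\<close>
  also have "\<dots> \<le> (3 * e * ?N * cmod h) / (?N\<^sup>2 * ?r2)"
    using e by (intro divide_right_mono) (auto simp: algebra_simps)
  also have "\<dots> = 3 * e * cmod h / (?N * ?r2)"
    using N by (simp add: power2_eq_square)
  also have "\<dots> \<le> 3 * e * cmod h / (?r2 * ?r2)"
    using e r by (intro divide_left_mono mult_right_mono mult_pos_pos N) auto
  also have "\<dots> = 3 * e / (cmod t) ^ 4 * cmod h" by (simp add: power2_eq_square power4_eq_xxxx)
  finally show ?thesis .
qed

text \<open>Test functions are real valued, so the kernel enters them through its real and imaginary
  parts, as functions of the integration variable \<zeta>.\<close>

lemma
  assumes "e > 0"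
  shows C_k_Re_cauchy_reg: "C_k k (\<lambda>\<zeta>. Re (cauchy_reg e (z - \<zeta>)))"
    and C_k_Im_cauchy_reg: "C_k k (\<lambda>\<zeta>. Im (cauchy_reg e (z - \<zeta>)))"
proof -
  let ?x = "\<lambda>\<zeta>. Re z - Re \<zeta>" and ?y = "\<lambda>\<zeta>. Im z - Im \<zeta>"
  let ?N = "\<lambda>\<zeta>. ?x \<zeta> * ?x \<zeta> + ?y \<zeta> * ?y \<zeta> + e"
  have N: "?N \<zeta> \<noteq> 0" for \<zeta> using assms by (smt (verit) zero_le_square)
  have "Re (cauchy_reg e (z - \<zeta>)) = ?x \<zeta> / ?N \<zeta>" "Im (cauchy_reg e (z - \<zeta>)) = (0 - ?y \<zeta>) / ?N \<zeta>" for \<zeta>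
    unfolding cauchy_reg_def Re_divide_of_real Im_divide_of_real cmod_power2
    by (simp_all add: power2_eq_square)
  then show "C_k k (\<lambda>\<zeta>. Re (cauchy_reg e (z - \<zeta>)))" "C_k k (\<lambda>\<zeta>. Im (cauchy_reg e (z - \<zeta>)))"
    using N by (auto intro!: C_k_divide C_k_add C_k_mult C_k_diff C_k_const C_k_Re C_k_Im)
qed

lemma continuous_on_cauchy_reg:
  assumes "e > 0" "continuous_on S f" shows "continuous_on S (\<lambda>x. cauchy_reg e (f x))"
  unfolding cauchy_reg_def using assms(2)
  by (intro continuous_intros) (use assms(1) in \<open>auto simp del: of_real_add of_real_power simp: add_nonneg_pos order_less_imp_not_eq2\<close>)

lemma continuous_on_cauchy_reg':
  assumes "e > 0" "continuous_on S f" shows "continuous_on S (\<lambda>x. cauchy_reg' e (f x) h)"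
  unfolding cauchy_reg'_def using assms(2)
  by (intro continuous_intros) (use assms(1) in \<open>auto simp del: of_real_add of_real_power simp: add_nonneg_pos order_less_imp_not_eq2\<close>)

lemma borel_measurable_cauchy_reg [measurable]: "cauchy_reg e \<in> borel_measurable borel"
  unfolding cauchy_reg_def[abs_def]
  by (intro borel_measurable_divide) (auto intro!: borel_measurable_continuous_onI continuous_intros)

lemma borel_measurable_cauchy_reg' [measurable]: "(\<lambda>t. cauchy_reg' e t h) \<in> borel_measurable borel"
  unfolding cauchy_reg'_def[abs_def]
  by (intro borel_measurable_divide) (auto intro!: borel_measurable_continuous_onI continuous_intros)

section \<open>Integrability of radial singularities\<close>

lemma borel_ball_cball [measurable]:
  fixes a :: "'a::metric_space"
  shows "ball a r \<in> sets borel" "cball a r \<in> sets borel"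
  by auto

lemma emeasure_cball_complex: "r \<ge> 0 \<Longrightarrow> emeasure lborel (cball (0::complex) r) = ennreal (pi * r\<^sup>2)"
  by (simp add: emeasure_cball unit_ball_vol_2)

text \<open>\<open>f\<close> is dominated by the series of \<open>c n\<close> times the indicator of
  the disc of radius \<open>r n\<close>, whose terms have integral
  \<open>pi * c n * (r n)\<^sup>2\<close>. Full discs in place of annuli are affordable, and only
  the area of a disc is needed.\<close>

lemma integrable_dyadic:
  fixes f :: "complex \<Rightarrow> real"
  assumes [measurable]: "f \<in> borel_measurable borel" and f0: "\<And>t. 0 \<le> f t"
    and c: "\<And>n. 0 \<le> c n" "\<And>n. 0 \<le> r n" and s: "summable (\<lambda>n::nat. c n * (r n)\<^sup>2)"
    and le: "\<And>t. f t \<noteq> 0 \<Longrightarrow> \<exists>n. cmod t \<le> r n \<and> f t \<le> c n"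
  shows "integrable lborel f"
proof (rule integrableI_nonneg)
  have "(\<integral>\<^sup>+t. ennreal (f t) \<partial>lborel) \<le> (\<integral>\<^sup>+t. (\<Sum>n. ennreal (c n) * indicator (cball (0::complex) (r n)) t) \<partial>lborel)"
  proof (rule nn_integral_mono)
    fix t :: complex
    show "ennreal (f t) \<le> (\<Sum>n. ennreal (c n) * indicator (cball (0::complex) (r n)) t)"
    proof (cases "f t = 0")
      case False
      then obtain n where n: "cmod t \<le> r n" "f t \<le> c n" using le by blast
      define g where "g n = ennreal (c n) * indicator (cball 0 (r n)) t" for n
      have "ennreal (f t) \<le> sum g {n}"
        using n by (simp add: g_def ennreal_leI)
      also have "\<dots> \<le> suminf g" by (rule sum_le_suminf) auto
      finally show ?thesis unfolding g_def .
    qed simp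
  qed
  also have "\<dots> = (\<Sum>n. \<integral>\<^sup>+t. ennreal (c n) * indicator (cball (0::complex) (r n)) t \<partial>lborel)"
    by (rule nn_integral_suminf) measurable
  also have "\<dots> = (\<Sum>n. ennreal (pi * (c n * (r n)\<^sup>2)))"
    using c by (simp add: nn_integral_cmult_indicator emeasure_cball_complex ennreal_mult[symmetric] algebra_simps)
  also have "\<dots> = ennreal (\<Sum>n. pi * (c n * (r n)\<^sup>2))"
    using c s by (intro suminf_ennreal2 summable_mult) auto
  finally show "(\<integral>\<^sup>+t. ennreal (f t) \<partial>lborel) < \<infinity>"
    by (rule order_le_less_trans) simp
qed (use f0 in auto)

lemma integrable_norm_powr_unit_ball:
  assumes p: "0 \<le> p" "p < 2"
  shows "integrable lborel (\<lambda>t::complex. indicator (cball 0 1) t * cmod t powr - p)"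
\<comment> \<open>For the annulus \<open>(1/2) ^ Suc n < \<bar>t\<bar> \<le> (1/2) ^ n\<close>,
  \<open>r n\<close> is the outer radius and \<open>c n\<close> the value of the function at the
  inner one. The series is geometric with ratio \<open>2 powr p / 4\<close>, below \<open>1\<close>
  because \<open>p < 2\<close>.\<close>
proof (rule integrable_dyadic[where c="\<lambda>n. (2 powr p) ^ Suc n" and r="\<lambda>n. (1/2) ^ n"])
  have "(2::real) powr p < 2 powr 2" using p by (intro powr_less_mono) auto
  then have "2 powr p / 4 < 1" by simp
  then have "summable (\<lambda>n. 2 powr p * (2 powr p / 4) ^ n)"
    by (intro summable_mult summable_geometric) simp
  moreover have "(2 powr p) ^ Suc n * ((1/2) ^ n)\<^sup>2 = 2 powr p * (2 powr p / 4) ^ n" for n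
  proof -
    have "((1/2::real) ^ n)\<^sup>2 = (1/4) ^ n"
      by (simp add: power2_eq_square flip: power_mult_distrib)
    then show ?thesis by (simp add: power_divide)
  qed
  ultimately show "summable (\<lambda>n. (2 powr p) ^ Suc n * ((1/2) ^ n)\<^sup>2)" by (simp only:)
  fix t :: complex
  assume "indicator (cball 0 1) t * cmod t powr - p \<noteq> 0"
  \<comment> \<open>Since \<open>0 powr x = 0\<close>, a nonzero value excludes the origin.\<close>
  then have t: "cmod t \<le> 1" "cmod t > 0" by (auto simp: indicator_def split: if_splits)
  define n where "n = (LEAST n. (1/2) ^ Suc n < cmod t)"
  have "\<exists>n. (1/2) ^ Suc n < cmod t"
  proof -
    obtain n where "(1/2) ^ n < cmod t" using real_arch_pow_inv[OF t(2), of "1/2"] by auto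
    moreover have "(1/2::real) ^ Suc n \<le> (1/2) ^ n" by simp
    ultimately show ?thesis by (meson order_le_less_trans)
  qed
  then have n: "(1/2) ^ Suc n < cmod t" unfolding n_def by (rule LeastI_ex)
  have "cmod t \<le> (1/2) ^ n"
  proof (cases n)
    case 0
    then show ?thesis using t by simp
  next
    case (Suc m)
    then have "m < n" by simp
    then have "\<not> (1/2) ^ Suc m < cmod t" unfolding n_def by (rule not_less_Least)
    then show ?thesis using Suc by simp
  qed
  moreover have "cmod t powr - p \<le> ((1/2) ^ Suc n) powr - p"
    using n p by (intro powr_mono2') auto
  moreover have "((1/2) ^ Suc n) powr - p = (2 powr p) ^ Suc n"
  proof -
    have "((1/2) ^ Suc n) powr - p = (2 powr - real (Suc n)) powr - p"
      by (subst powr_minus, subst powr_realpow) (simp_all add: power_one_over inverse_eq_divide)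
    also have "\<dots> = (2 powr p) powr real (Suc n)" by (simp only: powr_powr mult.commute minus_mult_minus)
    also have "\<dots> = (2 powr p) ^ Suc n" by (rule powr_realpow) simp
    finally show ?thesis .
  qed
  ultimately show "\<exists>n. cmod t \<le> (1/2) ^ n \<and> indicator (cball 0 1) t * cmod t powr - p \<le> (2 powr p) ^ Suc n"
    using t by (intro exI[of _ n]) simp
qed auto

lemma integrable_dbar_mass_density:
  "integrable lborel (\<lambda>t::complex. 1 / ((cmod t)\<^sup>2 + 1)\<^sup>2)"
\<comment> \<open>Where \<open>2 ^ (n - 1) < \<bar>t\<bar> \<le> 2 ^ n\<close> with
  \<open>n > 0\<close>, the density is below \<open>1 / \<bar>t\<bar> ^ 4\<close>, hence below
  \<open>16 / 16 ^ n\<close>; for \<open>n = 0\<close> the bound is \<open>16\<close> while the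
  density is at most \<open>1\<close>.\<close>
proof (rule integrable_dyadic[where c="\<lambda>n. 16 / 16 ^ n" and r="\<lambda>n. 2 ^ n"])
  have "summable (\<lambda>n. 16 * (1 / 4 :: real) ^ n)"
    by (intro summable_mult summable_geometric) simp
  moreover have "16 / 16 ^ n * (2 ^ n)\<^sup>2 = 16 * (1 / 4 :: real) ^ n" for n
  proof -
    have "(2 ^ n)\<^sup>2 = (4::real) ^ n" by (simp add: power2_eq_square flip: power_mult_distrib)
    moreover have "(16::real) ^ n = 4 ^ n * 4 ^ n" by (simp flip: power_mult_distrib)
    ultimately show ?thesis by (simp add: power_one_over)
  qed
  ultimately show "summable (\<lambda>n. 16 / 16 ^ n * (2 ^ n :: real)\<^sup>2)" by (simp only:)
  fix t :: complex
  define n where "n = (LEAST n. cmod t \<le> 2 ^ n)"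
  have "\<exists>n. cmod t \<le> 2 ^ n"
    using real_arch_pow[of 2 "cmod t"] by (auto intro: less_imp_le)
  then have n: "cmod t \<le> 2 ^ n" unfolding n_def by (rule LeastI_ex)
  have pos: "((cmod t)\<^sup>2 + 1)\<^sup>2 \<ge> 1"
    by (rule one_le_power) simp
  have "16 ^ n / 16 \<le> ((cmod t)\<^sup>2 + 1)\<^sup>2"
  proof (cases n)
    case 0
    then have "16 ^ n / 16 \<le> (1::real)" by simp
    then show ?thesis using pos by linarith
  next
    case (Suc m)
    then have "m < n" by simp
    then have "\<not> cmod t \<le> 2 ^ m" unfolding n_def by (rule not_less_Least)
    then have "(2 ^ m) ^ 4 \<le> (cmod t) ^ 4" by (intro power_mono) auto
    also have "\<dots> = ((cmod t)\<^sup>2)\<^sup>2" by simp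
    also have "\<dots> \<le> ((cmod t)\<^sup>2 + 1)\<^sup>2" by (intro power_mono) auto
    also have "(2 ^ m) ^ 4 = (16::real) ^ m" by (simp add: power4_eq_xxxx flip: power_mult_distrib)
    finally show ?thesis using Suc by simp
  qed
  then have "1 / ((cmod t)\<^sup>2 + 1)\<^sup>2 \<le> 16 / 16 ^ n"
    using le_imp_inverse_le[of "16 ^ n / 16" "((cmod t)\<^sup>2 + 1)\<^sup>2"] by (simp add: inverse_eq_divide)
  then show "\<exists>n. cmod t \<le> 2 ^ n \<and> 1 / ((cmod t)\<^sup>2 + 1)\<^sup>2 \<le> 16 / 16 ^ n"
    using n by blast
qed auto

text \<open>Young's inequality without its optimal constants: if
  \<open>y \<le> x powr (q - 1)\<close> the first summand alone dominates, otherwise the second.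
  Integrated, it takes the place of Hoelder's inequality.\<close>

lemma mult_le_powr_add_powr:
  fixes x y q :: real
  assumes "x \<ge> 0" "y \<ge> 0" "q > 1"
  shows "x * y \<le> x powr q + y powr (q / (q - 1))"
proof (cases "x = 0 \<or> y = 0")
  case False
  then have xy: "x > 0" "y > 0" using assms by auto
  show ?thesis
  proof (cases "y \<le> x powr (q - 1)")
    case True
    then have "x * y \<le> x powr 1 * x powr (q - 1)" using xy by (simp add: mult_left_mono)
    also have "\<dots> = x powr q" by (subst powr_add[symmetric]) simp
    finally show ?thesis by (smt (verit) powr_ge_zero)
  next
    case False
    then have "(x powr (q - 1)) powr (1 / (q - 1)) \<le> y powr (1 / (q - 1))"
      using assms by (intro powr_mono2) auto
    then have "x \<le> y powr (1 / (q - 1))" using xy assms by (simp add: powr_powr)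
    then have "x * y \<le> y powr (1 / (q - 1)) * y powr 1" using xy by (simp add: mult_right_mono)
    also have "\<dots> = y powr (q / (q - 1))"
    proof -
      have "1 / (q - 1) + 1 = q / (q - 1)" using assms by (simp add: field_simps)
      then show ?thesis by (simp only: powr_add[symmetric])
    qed
    finally show ?thesis by (smt (verit) powr_ge_zero)
  qed
qed auto

lemma integrable_indicator_ball: "integrable lborel (indicator (ball 0 1) :: complex \<Rightarrow> real)"
  using emeasure_bounded_finite[of "ball 0 1 :: complex set"] by (intro integrable_real_indicator) auto

text \<open>The bound is uniform in \<open>z\<close>: where
  \<open>cmod (z - \<zeta>) \<le> 1\<close> the integrand is below a translate of one fixed
  integrable singularity, elsewhere it is at most the indicator of the disc.\<close>

lemma riesz_potential_unit_ball_bounded: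
  assumes p: "0 \<le> p" "p < 2"
  obtains M where
    "\<And>z. integrable lborel (\<lambda>\<zeta>::complex. indicator (ball 0 1) \<zeta> * cmod (z - \<zeta>) powr - p)"
    "\<And>z. (\<integral>\<zeta>. indicator (ball (0::complex) 1) \<zeta> * cmod (z - \<zeta>) powr - p \<partial>lborel) \<le> M"
proof
  let ?J = "\<lambda>t::complex. indicator (cball 0 1) t * cmod t powr - p :: real"
  let ?I = "indicator (ball 0 1) :: complex \<Rightarrow> real"
  note J = integrable_norm_powr_unit_ball[OF p]
  fix z :: complex
  have Jz: "integrable lborel (\<lambda>\<zeta>. ?J (- z + \<zeta>))" by (rule integrable_lborel_translate[OF J])
  have le: "?I \<zeta> * cmod (z - \<zeta>) powr - p \<le> ?J (- z + \<zeta>) + ?I \<zeta>" for \<zeta>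
  proof (cases "cmod (z - \<zeta>) \<le> 1")
    case True
    then show ?thesis by (auto simp: indicator_def norm_minus_commute)
  next
    case False
    then have "cmod (z - \<zeta>) powr - p \<le> 1" using powr_mono[of "- p" 0 "cmod (z - \<zeta>)"] p by (auto split: if_splits)
    then show ?thesis by (auto simp: indicator_def intro: order_trans)
  qed
  show i: "integrable lborel (\<lambda>\<zeta>::complex. ?I \<zeta> * cmod (z - \<zeta>) powr - p)"
    by (rule Bochner_Integration.integrable_bound[OF Bochner_Integration.integrable_add[OF Jz integrable_indicator_ball]])
      (use le in \<open>auto simp: abs_mult intro!: AE_I2\<close>)
  have "(\<integral>\<zeta>. ?I \<zeta> * cmod (z - \<zeta>) powr - p \<partial>lborel) \<le> (\<integral>\<zeta>. ?J (- z + \<zeta>) + ?I \<zeta> \<partial>lborel)"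
    by (rule integral_mono[OF i Bochner_Integration.integrable_add[OF Jz integrable_indicator_ball] le])
  also have "\<dots> = (\<integral>t. ?J t \<partial>lborel) + (\<integral>t. ?I t \<partial>lborel)"
    using Jz integrable_indicator_ball integral_lborel_translate[of ?J "- z"] J
    by (simp add: Bochner_Integration.integral_add)
  finally show "(\<integral>\<zeta>. ?I \<zeta> * cmod (z - \<zeta>) powr - p \<partial>lborel) \<le> (\<integral>t. ?J t \<partial>lborel) + (\<integral>t. ?I t \<partial>lborel)" .
qed

section \<open>Cauchy transforms\<close>

text \<open>Borel functions vanishing off the disc, so that all integrals can be taken over the
  plane with respect to \<open>lborel\<close>, where translation, dilation and Fubini are at
  hand.\<close>

definition Lq_disc :: "real \<Rightarrow> (complex \<Rightarrow> complex) \<Rightarrow> bool" where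
  "Lq_disc q f \<longleftrightarrow> f \<in> borel_measurable borel \<and> (\<forall>z. z \<notin> ball 0 1 \<longrightarrow> f z = 0) \<and>
     integrable lborel (\<lambda>z. cmod (f z) powr q)"

lemma Lq_disc_integrable:
  assumes f: "Lq_disc q f" and q: "q > 1"
  shows "integrable lborel f"
proof (rule Bochner_Integration.integrable_bound)
  show "integrable lborel (\<lambda>z. indicator (ball 0 1) z + cmod (f z) powr q)"
    using f integrable_indicator_ball by (auto simp: Lq_disc_def)
  show "AE z in lborel. cmod (f z) \<le> norm (indicator (ball 0 1) z + cmod (f z) powr q)"
  proof (rule AE_I2)
    fix z
    show "cmod (f z) \<le> norm (indicator (ball 0 1) z + cmod (f z) powr q)"
    proof (cases "z \<in> ball 0 1")
      case True
      then show ?thesis using mult_le_powr_add_powr[of "cmod (f z)" 1 q] q by simp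
    next
      case False
      then show ?thesis using f by (simp add: Lq_disc_def)
    qed
  qed
qed (use f in \<open>simp add: Lq_disc_def\<close>)

lemma norm_integral_le_integral:
  fixes f :: "'a \<Rightarrow> 'b::{banach, second_countable_topology}"
  assumes "integrable M f" "integrable M g" "\<And>x. norm (f x) \<le> g x"
  shows "norm (integral\<^sup>L M f) \<le> integral\<^sup>L M g"
  using integral_norm_bound[of M f] integral_mono[OF integrable_norm[OF assms(1)] assms(2)] assms(3)
  by (meson order_trans)

lemma Lq_disc_bounded_mult:
  assumes f: "Lq_disc q f" and q: "q > 1"
    and g [measurable]: "g \<in> borel_measurable borel" and C: "\<And>z. cmod (g z) \<le> C"
  shows "Lq_disc q (\<lambda>z. g z * f z)"
proof -
  have [measurable]: "f \<in> borel_measurable borel" using f by (simp add: Lq_disc_def)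
  have "integrable lborel (\<lambda>z. cmod (g z * f z) powr q)"
  proof (rule Bochner_Integration.integrable_bound)
    show "integrable lborel (\<lambda>z. C powr q * cmod (f z) powr q)"
      using f by (simp add: Lq_disc_def)
    show "AE z in lborel. norm (cmod (g z * f z) powr q) \<le> norm (C powr q * cmod (f z) powr q)"
      using q C by (auto intro!: AE_I2 mult_right_mono powr_mono2 simp: norm_mult powr_mult)
  qed simp
  then show ?thesis using f by (auto simp: Lq_disc_def)
qed

lemma Lq_disc_add:
  assumes f: "Lq_disc q f" and g: "Lq_disc q g" and q: "q > 1"
  shows "Lq_disc q (\<lambda>z. f z + g z)"
proof -
  have [measurable]: "f \<in> borel_measurable borel" "g \<in> borel_measurable borel"
    using f g by (simp_all add: Lq_disc_def)
  have "integrable lborel (\<lambda>z. cmod (f z + g z) powr q)"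
  proof (rule Bochner_Integration.integrable_bound)
    show "integrable lborel (\<lambda>z. 2 powr q * (cmod (f z) powr q + cmod (g z) powr q))"
      using f g by (auto simp: Lq_disc_def)
    have "cmod (f z + g z) powr q \<le> 2 powr q * (cmod (f z) powr q + cmod (g z) powr q)" for z
    proof -
      have "cmod (f z + g z) \<le> 2 * max (cmod (f z)) (cmod (g z))"
        using norm_triangle_ineq[of "f z" "g z"] by simp
      then have "cmod (f z + g z) powr q \<le> 2 powr q * max (cmod (f z)) (cmod (g z)) powr q"
        using q powr_mono2[of q "cmod (f z + g z)" "2 * max (cmod (f z)) (cmod (g z))"]
        by (simp add: powr_mult)
      also have "max (cmod (f z)) (cmod (g z)) powr q \<le> cmod (f z) powr q + cmod (g z) powr q"
        by (simp add: max_def)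
      finally show ?thesis by simp
    qed
    then show "AE z in lborel. norm (cmod (f z + g z) powr q)
        \<le> norm (2 powr q * (cmod (f z) powr q + cmod (g z) powr q))"
      by (intro AE_I2) (simp add: abs_mult)
  qed simp
  then show ?thesis using f g by (auto simp: Lq_disc_def)
qed

text \<open>\<open>q / (q - 1)\<close> is the conjugate exponent, and the assumption on
  \<open>s\<close> says that the kernel raised to it is still locally integrable. For
  \<open>q > 2\<close> this leaves room for some \<open>s > 1\<close>.\<close>

lemma riesz_potential_Lq_bounded:
  assumes f: "Lq_disc q f" and q: "q > 1" and s: "0 \<le> s" "s * (q / (q - 1)) < 2"
  obtains M where "\<And>z. integrable lborel (\<lambda>\<zeta>. cmod (f \<zeta>) * cmod (z - \<zeta>) powr - s)"
    "\<And>z. (\<integral>\<zeta>. cmod (f \<zeta>) * cmod (z - \<zeta>) powr - s \<partial>lborel) \<le> M"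
proof -
  define p where "p = s * (q / (q - 1))"
  have p: "0 \<le> p" "p < 2" using s q by (simp_all add: p_def)
  obtain M where M:
    "\<And>z. integrable lborel (\<lambda>\<zeta>::complex. indicator (ball 0 1) \<zeta> * cmod (z - \<zeta>) powr - p)"
    "\<And>z. (\<integral>\<zeta>. indicator (ball (0::complex) 1) \<zeta> * cmod (z - \<zeta>) powr - p \<partial>lborel) \<le> M"
    using riesz_potential_unit_ball_bounded[OF p] by blast
  have [measurable]: "f \<in> borel_measurable borel" using f by (simp add: Lq_disc_def)
  have fq: "integrable lborel (\<lambda>z. cmod (f z) powr q)" using f by (simp add: Lq_disc_def)
  have le: "cmod (f \<zeta>) * cmod (z - \<zeta>) powr - s
      \<le> cmod (f \<zeta>) powr q + indicator (ball 0 1) \<zeta> * cmod (z - \<zeta>) powr - p" for z \<zeta>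
  proof (cases "\<zeta> \<in> ball 0 1")
    case True
    have "(cmod (z - \<zeta>) powr - s) powr (q / (q - 1)) = cmod (z - \<zeta>) powr - p"
      by (simp add: powr_powr p_def)
    then show ?thesis
      using mult_le_powr_add_powr[of "cmod (f \<zeta>)" "cmod (z - \<zeta>) powr - s" q] q True by simp
  next
    case False
    then show ?thesis using f by (simp add: Lq_disc_def)
  qed
  have i: "integrable lborel (\<lambda>\<zeta>. cmod (f \<zeta>) * cmod (z - \<zeta>) powr - s)" for z
    by (rule Bochner_Integration.integrable_bound[OF Bochner_Integration.integrable_add[OF fq M(1)[of z]]])
      (use le in \<open>auto simp: abs_mult intro!: AE_I2\<close>)
  have "(\<integral>\<zeta>. cmod (f \<zeta>) * cmod (z - \<zeta>) powr - s \<partial>lborel) \<le> (\<integral>\<zeta>. cmod (f \<zeta>) powr q \<partial>lborel) + M" for z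
  proof -
    have "(\<integral>\<zeta>. cmod (f \<zeta>) * cmod (z - \<zeta>) powr - s \<partial>lborel)
       \<le> (\<integral>\<zeta>. cmod (f \<zeta>) powr q + indicator (ball 0 1) \<zeta> * cmod (z - \<zeta>) powr - p \<partial>lborel)"
      by (rule integral_mono[OF i Bochner_Integration.integrable_add[OF fq M(1)] le])
    also have "\<dots> = (\<integral>\<zeta>. cmod (f \<zeta>) powr q \<partial>lborel)
        + (\<integral>\<zeta>. indicator (ball (0::complex) 1) \<zeta> * cmod (z - \<zeta>) powr - p \<partial>lborel)"
      by (rule Bochner_Integration.integral_add[OF fq M(1)])
    finally show ?thesis using M(2)[of z] by linarith
  qed
  then show ?thesis using that i by blast
qed

text \<open>The square makes the natural length scale, the root of the parameter, equal to
  \<open>1 / real (Suc n)\<close>; this is the dilation used for the approximate identity.\<close>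

definition reg_param :: "nat \<Rightarrow> real" where "reg_param n = 1 / (real (Suc n))\<^sup>2"

lemma reg_param_pos: "reg_param n > 0"
  by (simp add: reg_param_def)

lemma reg_param_tendsto: "reg_param \<longlonglongrightarrow> 0"
proof -
  have "(\<lambda>n. (inverse (real (Suc n)))\<^sup>2) \<longlonglongrightarrow> 0\<^sup>2"
    by (intro tendsto_power LIMSEQ_inverse_real_of_nat)
  then show ?thesis unfolding reg_param_def[abs_def] by (simp add: inverse_eq_divide power_one_over)
qed

text \<open>The error at \<open>z\<close> is at most \<open>reg_param n powr \<sigma>\<close> times
  a Riesz potential of exponent slightly above \<open>1\<close>, which is bounded independently of
  \<open>z\<close>. Uniformity on the whole plane later makes the Cauchy transform continuous up to
  the circle.\<close>

lemma uniform_limit_cauchy_reg: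
  assumes f: "Lq_disc q f" and q: "q > 2"
  shows "uniform_limit UNIV (\<lambda>n z. \<integral>\<zeta>. cauchy_reg (reg_param n) (z - \<zeta>) * f \<zeta> \<partial>lborel)
    (\<lambda>z. \<integral>\<zeta>. f \<zeta> / (z - \<zeta>) \<partial>lborel) sequentially"
proof -
  \<comment> \<open>The potential estimate needs
    \<open>(1 + 2 * \<sigma>) * (q / (q - 1)) < 2\<close>, that is
    \<open>\<sigma> < (q - 2) / (2 * q)\<close>; half of this threshold is taken.\<close>
  define \<sigma> where "\<sigma> = (q - 2) / (4 * q)"
  define s where "s = 1 + 2 * \<sigma>"
  have q1: "q > 1" using q by simp
  have \<sigma>: "0 < \<sigma>" "\<sigma> \<le> 1" using q by (simp_all add: \<sigma>_def field_simps)
  have sq: "s * (q / (q - 1)) = (3 * q - 2) / (2 * (q - 1))"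
    using q by (simp add: s_def \<sigma>_def field_simps)
  have s: "0 \<le> s" "s * (q / (q - 1)) < 2" "s \<ge> 1"
    unfolding sq using q \<sigma> by (auto simp: s_def divide_less_eq)
  obtain M where M: "\<And>z. integrable lborel (\<lambda>\<zeta>. cmod (f \<zeta>) * cmod (z - \<zeta>) powr - s)"
    "\<And>z. (\<integral>\<zeta>. cmod (f \<zeta>) * cmod (z - \<zeta>) powr - s \<partial>lborel) \<le> M"
    using riesz_potential_Lq_bounded[OF f q1 s(1,2)] by blast
  have [measurable]: "f \<in> borel_measurable borel" using f by (simp add: Lq_disc_def)
  have fi: "integrable lborel f" by (rule Lq_disc_integrable[OF f q1])
  have i0: "integrable lborel (\<lambda>\<zeta>. f \<zeta> / (z - \<zeta>))" for z
  proof (rule Bochner_Integration.integrable_bound[OF Bochner_Integration.integrable_add[OF integrable_norm[OF fi] M(1)[of z]]])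
    have "cmod (f \<zeta> / (z - \<zeta>)) \<le> norm (cmod (f \<zeta>) + cmod (f \<zeta>) * cmod (z - \<zeta>) powr - s)" for \<zeta>
    proof -
      have "1 / cmod (z - \<zeta>) \<le> 1 + cmod (z - \<zeta>) powr - s"
      \<comment> \<open>On the diagonal \<open>1 / 0 = 0\<close>, so it goes with the points at
        distance at least \<open>1\<close>; elsewhere \<open>s \<ge> 1\<close> makes the stronger
        singularity dominate.\<close>
      proof (cases "z = \<zeta> \<or> cmod (z - \<zeta>) \<ge> 1")
        case True
        then have "1 / cmod (z - \<zeta>) \<le> 1" by (auto simp: divide_le_eq)
        then show ?thesis by (smt (verit) powr_ge_zero)
      next
        case False
        then have "cmod (z - \<zeta>) powr - 1 \<le> cmod (z - \<zeta>) powr - s"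
          using s by (intro powr_mono') auto
        then show ?thesis using False by (simp add: powr_minus inverse_eq_divide)
      qed
      then have "cmod (f \<zeta>) * (1 / cmod (z - \<zeta>)) \<le> cmod (f \<zeta>) * (1 + cmod (z - \<zeta>) powr - s)"
        by (rule mult_left_mono) simp
      then show ?thesis by (simp add: norm_divide algebra_simps)
    qed
    then show "AE \<zeta> in lborel. cmod (f \<zeta> / (z - \<zeta>)) \<le> norm (cmod (f \<zeta>) + cmod (f \<zeta>) * cmod (z - \<zeta>) powr - s)"
      by simp
  qed simp
  have in': "integrable lborel (\<lambda>\<zeta>. cauchy_reg (reg_param n) (z - \<zeta>) * f \<zeta>)" for n z
  proof (rule Bochner_Integration.integrable_bound[OF integrable_mult_right[OF integrable_norm[OF fi], of "1 + 1 / reg_param n"]])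
    show "AE \<zeta> in lborel. cmod (cauchy_reg (reg_param n) (z - \<zeta>) * f \<zeta>) \<le> norm ((1 + 1 / reg_param n) * cmod (f \<zeta>))"
    proof (intro AE_I2)
      fix \<zeta>
      have "cmod (cauchy_reg (reg_param n) (z - \<zeta>) * f \<zeta>) \<le> (1 + 1 / reg_param n) * cmod (f \<zeta>)"
        unfolding norm_mult by (intro mult_right_mono norm_cauchy_reg_le reg_param_pos) simp
      then show "cmod (cauchy_reg (reg_param n) (z - \<zeta>) * f \<zeta>) \<le> norm ((1 + 1 / reg_param n) * cmod (f \<zeta>))"
        by simp
    qed
  qed measurable
  have bound: "cmod ((\<integral>\<zeta>. cauchy_reg (reg_param n) (z - \<zeta>) * f \<zeta> \<partial>lborel) - (\<integral>\<zeta>. f \<zeta> / (z - \<zeta>) \<partial>lborel))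
      \<le> reg_param n powr \<sigma> * M" for n z
  proof -
    have "(\<integral>\<zeta>. cauchy_reg (reg_param n) (z - \<zeta>) * f \<zeta> \<partial>lborel) - (\<integral>\<zeta>. f \<zeta> / (z - \<zeta>) \<partial>lborel)
      = (\<integral>\<zeta>. cauchy_reg (reg_param n) (z - \<zeta>) * f \<zeta> - f \<zeta> / (z - \<zeta>) \<partial>lborel)"
      by (rule Bochner_Integration.integral_diff[OF in' i0, symmetric])
    also have "cmod \<dots> \<le> (\<integral>\<zeta>. reg_param n powr \<sigma> * (cmod (f \<zeta>) * cmod (z - \<zeta>) powr - s) \<partial>lborel)"
    proof (rule norm_integral_le_integral)
      fix \<zeta>
      have "cmod (cauchy_reg (reg_param n) (z - \<zeta>) * f \<zeta> - f \<zeta> / (z - \<zeta>))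
        = cmod (cauchy_reg (reg_param n) (z - \<zeta>) - 1 / (z - \<zeta>)) * cmod (f \<zeta>)"
        by (simp add: left_diff_distrib flip: norm_mult)
      also have "\<dots> \<le> (reg_param n powr \<sigma> * cmod (z - \<zeta>) powr - (1 + 2 * \<sigma>)) * cmod (f \<zeta>)"
        using \<sigma> by (intro mult_right_mono cauchy_reg_diff_le reg_param_pos) auto
      finally show "cmod (cauchy_reg (reg_param n) (z - \<zeta>) * f \<zeta> - f \<zeta> / (z - \<zeta>))
          \<le> reg_param n powr \<sigma> * (cmod (f \<zeta>) * cmod (z - \<zeta>) powr - s)"
        by (simp add: s_def mult_ac)
    qed (intro Bochner_Integration.integrable_diff integrable_mult_right in' i0 M(1))+
    also have "\<dots> \<le> reg_param n powr \<sigma> * M"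
      using M(2)[of z] by (simp add: mult_left_mono)
    finally show ?thesis .
  qed
  have "(\<lambda>n. reg_param n powr \<sigma> * M) \<longlonglongrightarrow> 0 * M"
    using reg_param_tendsto \<sigma> reg_param_pos
    by (intro tendsto_mult_right tendsto_zero_powrI[of _ _ _ \<sigma>]) (auto simp: less_imp_le)
  then have lim: "(\<lambda>n. reg_param n powr \<sigma> * M) \<longlonglongrightarrow> 0" by simp
  show ?thesis
  proof (rule uniform_limitI)
    fix e :: real assume "e > 0"
    then have "\<forall>\<^sub>F n in sequentially. reg_param n powr \<sigma> * M < e"
      using lim by (simp add: order_tendstoD(2))
    then show "\<forall>\<^sub>F n in sequentially. \<forall>z\<in>UNIV. dist (\<integral>\<zeta>. cauchy_reg (reg_param n) (z - \<zeta>) * f \<zeta> \<partial>lborel)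
        (\<integral>\<zeta>. f \<zeta> / (z - \<zeta>) \<partial>lborel) < e"
    proof eventually_elim
      case (elim n)
      then show ?case unfolding dist_norm using bound order_le_less_trans by blast
    qed
  qed
qed

section \<open>Continuity and differentiation of convolutions with bounded kernels\<close>

lemma integrable_bounded_mult:
  fixes f g :: "complex \<Rightarrow> complex"
  assumes f: "integrable lborel f" and [measurable]: "g \<in> borel_measurable borel"
    and C: "\<And>z. cmod (g z) \<le> C"
  shows "integrable lborel (\<lambda>z. g z * f z)"
proof (rule Bochner_Integration.integrable_bound)
  show "integrable lborel (\<lambda>z. C * cmod (f z))" using f by simp
  have [measurable]: "f \<in> borel_measurable borel" using f by (simp add: borel_measurable_integrable)
  show "(\<lambda>z. g z * f z) \<in> borel_measurable lborel" by measurable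
  have "cmod (g z * f z) \<le> C * cmod (f z)" for z
    unfolding norm_mult using C by (rule mult_right_mono) simp
  then show "AE z in lborel. cmod (g z * f z) \<le> norm (C * cmod (f z))"
    by (intro AE_I2) (simp add: order_trans[OF _ abs_ge_self])
qed

lemma continuous_on_convolution:
  fixes f k :: "complex \<Rightarrow> complex"
  assumes f: "integrable lborel f" and k: "continuous_on UNIV k" and B: "\<And>t. cmod (k t) \<le> B"
  shows "continuous_on UNIV (\<lambda>z. \<integral>\<zeta>. k (z - \<zeta>) * f \<zeta> \<partial>lborel)"
  unfolding continuous_on_sequentially
proof (intro allI ballI impI)
  fix x :: "nat \<Rightarrow> complex" and a
  assume "(\<forall>n. x n \<in> UNIV) \<and> x \<longlonglongrightarrow> a"
  then have x: "x \<longlonglongrightarrow> a" by simp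
  have [measurable]: "f \<in> borel_measurable borel" "k \<in> borel_measurable borel"
    using f borel_measurable_continuous_onI[OF k] by (auto simp: borel_measurable_integrable)
  show "((\<lambda>z. \<integral>\<zeta>. k (z - \<zeta>) * f \<zeta> \<partial>lborel) \<circ> x) \<longlonglongrightarrow> (\<integral>\<zeta>. k (a - \<zeta>) * f \<zeta> \<partial>lborel)"
    unfolding o_def
  proof (rule integral_dominated_convergence[where w="\<lambda>\<zeta>. B * cmod (f \<zeta>)"])
    show "integrable lborel (\<lambda>\<zeta>. B * cmod (f \<zeta>))" using f by simp
    have "isCont k t" for t using k by (simp add: continuous_on_eq_continuous_at)
    then have "(\<lambda>n. k (x n - \<zeta>) * f \<zeta>) \<longlonglongrightarrow> k (a - \<zeta>) * f \<zeta>" for \<zeta>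
      by (intro tendsto_mult isCont_tendsto_compose[where g=k] tendsto_diff x tendsto_const)
    then show "AE \<zeta> in lborel. (\<lambda>n. k (x n - \<zeta>) * f \<zeta>) \<longlonglongrightarrow> k (a - \<zeta>) * f \<zeta>" by simp
    show "AE \<zeta> in lborel. cmod (k (x n - \<zeta>) * f \<zeta>) \<le> B * cmod (f \<zeta>)" for n
      unfolding norm_mult by (intro AE_I2 mult_right_mono B) simp
  qed measurable
qed

text \<open>Differentiation under the integral sign: along any null sequence of increments the
  normalised remainder tends to zero pointwise and, by the mean value inequality, is dominated by
  \<open>2 * M * cmod (f \<zeta>)\<close>. The regularised kernels satisfy both bounds; the Cauchy
  kernel satisfies neither.\<close>

lemma has_derivative_convolution:
  fixes f k :: "complex \<Rightarrow> complex"
  assumes f: "integrable lborel f"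
    and k: "\<And>t. (k has_derivative k' t) (at t)"
    and B: "\<And>t. cmod (k t) \<le> B" and M: "\<And>t h. cmod (k' t h) \<le> M * cmod h"
    and [measurable]: "\<And>h. (\<lambda>t. k' t h) \<in> borel_measurable borel"
  shows "((\<lambda>z. \<integral>\<zeta>. k (z - \<zeta>) * f \<zeta> \<partial>lborel) has_derivative
    (\<lambda>h. \<integral>\<zeta>. k' (z - \<zeta>) h * f \<zeta> \<partial>lborel)) (at z)"
proof -
  have k_cont: "continuous_on UNIV k"
    using has_derivative_continuous[OF k] by (simp add: continuous_at_imp_continuous_on)
  have [measurable]: "f \<in> borel_measurable borel" "k \<in> borel_measurable borel"
    using f borel_measurable_continuous_onI[OF k_cont] by (auto simp: borel_measurable_integrable)
  have lin: "linear (k' t)" for t using has_derivative_linear[OF k] .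
  have ik: "integrable lborel (\<lambda>\<zeta>. k (w - \<zeta>) * f \<zeta>)" for w
    by (rule integrable_bounded_mult[OF f _ B]) measurable
  have ik': "integrable lborel (\<lambda>\<zeta>. k' (z - \<zeta>) h * f \<zeta>)" for h
    by (rule integrable_bounded_mult[OF f _ M]) measurable
  have lip: "cmod (k (t + h) - k t) \<le> M * cmod h" for t h
    using differentiable_bound[of UNIV k k' M "t + h" t] k M by (auto intro: onorm_le)
  let ?\<Phi> = "\<lambda>z. \<integral>\<zeta>. k (z - \<zeta>) * f \<zeta> \<partial>lborel" and ?\<Phi>' = "\<lambda>h. \<integral>\<zeta>. k' (z - \<zeta>) h * f \<zeta> \<partial>lborel"
  have "bounded_linear ?\<Phi>'"
  proof (rule linear_conv_bounded_linear[THEN iffD1], rule linearI)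
    show "?\<Phi>' (b1 + b2) = ?\<Phi>' b1 + ?\<Phi>' b2" for b1 b2
      unfolding linear_add[OF lin] distrib_right by (rule Bochner_Integration.integral_add[OF ik' ik'])
    show "?\<Phi>' (r *\<^sub>R b) = r *\<^sub>R ?\<Phi>' b" for r b
      unfolding linear_cmul[OF lin] mult_scaleR_left by (rule integral_scaleR_right)
  qed
  moreover have "((\<lambda>h. norm (?\<Phi> (z + h) - ?\<Phi> z - ?\<Phi>' h) / norm h) \<longlongrightarrow> 0) (at 0)"
    unfolding tendsto_at_iff_sequentially o_def
  proof (intro allI impI)
    fix X :: "nat \<Rightarrow> complex"
    assume X: "\<forall>i. X i \<in> UNIV - {0}" "X \<longlonglongrightarrow> 0"
    let ?g = "\<lambda>n \<zeta>. (inverse (cmod (X n)) *\<^sub>R (k (z + X n - \<zeta>) - k (z - \<zeta>) - k' (z - \<zeta>) (X n))) * f \<zeta>"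
    have "(\<lambda>n. \<integral>\<zeta>. ?g n \<zeta> \<partial>lborel) \<longlonglongrightarrow> (\<integral>\<zeta>. 0 \<partial>(lborel :: complex measure))"
    proof (rule integral_dominated_convergence[where w="\<lambda>\<zeta>. (2 * M) * cmod (f \<zeta>)"])
      show "integrable lborel (\<lambda>\<zeta>. 2 * M * cmod (f \<zeta>))" using f by simp
      show "AE \<zeta> in lborel. (\<lambda>n. ?g n \<zeta>) \<longlonglongrightarrow> 0"
      proof (rule AE_I2)
        fix \<zeta>
        have "((\<lambda>h. norm (k ((z - \<zeta>) + h) - k (z - \<zeta>) - k' (z - \<zeta>) h) / norm h) \<longlongrightarrow> 0) (at 0)"
          using k[of "z - \<zeta>"] by (simp add: has_derivative_at)
        then have "(\<lambda>n. norm (k ((z - \<zeta>) + X n) - k (z - \<zeta>) - k' (z - \<zeta>) (X n)) / norm (X n)) \<longlonglongrightarrow> 0"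
          using X unfolding tendsto_at_iff_sequentially o_def by blast
        moreover have e: "(z - \<zeta>) + X n = z + X n - \<zeta>" for n by simp
        ultimately have "(\<lambda>n. norm (inverse (cmod (X n)) *\<^sub>R (k (z + X n - \<zeta>) - k (z - \<zeta>) - k' (z - \<zeta>) (X n)))) \<longlonglongrightarrow> 0"
          unfolding e norm_scaleR by (simp only: divide_inverse abs_inverse abs_norm_cancel mult.commute)
        then have "(\<lambda>n. ?g n \<zeta>) \<longlonglongrightarrow> 0 * f \<zeta>"
          by (intro tendsto_mult_right) (rule tendsto_norm_zero_cancel)
        then show "(\<lambda>n. ?g n \<zeta>) \<longlonglongrightarrow> 0" by simp
      qed
      show "AE \<zeta> in lborel. cmod (?g n \<zeta>) \<le> 2 * M * cmod (f \<zeta>)" for n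
      proof (rule AE_I2)
        fix \<zeta>
        have "cmod (k (z + X n - \<zeta>) - k (z - \<zeta>) - k' (z - \<zeta>) (X n)) \<le> M * cmod (X n) + M * cmod (X n)"
        proof -
          have "cmod (k (z + X n - \<zeta>) - k (z - \<zeta>)) \<le> M * cmod (X n)"
            using lip[of "z - \<zeta>" "X n"] by (simp add: algebra_simps)
          then show ?thesis
            using M[of "z - \<zeta>" "X n"] norm_triangle_ineq4[of "k (z + X n - \<zeta>) - k (z - \<zeta>)" "k' (z - \<zeta>) (X n)"]
            by linarith
        qed
        then have "inverse (cmod (X n)) * cmod (k (z + X n - \<zeta>) - k (z - \<zeta>) - k' (z - \<zeta>) (X n)) \<le> 2 * M"
          using X(1) by (simp add: field_simps)
        then show "cmod (?g n \<zeta>) \<le> 2 * M * cmod (f \<zeta>)"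
          unfolding norm_mult norm_scaleR by (intro mult_right_mono) simp_all
      qed
    qed measurable
    then have "(\<lambda>n. cmod (\<integral>\<zeta>. ?g n \<zeta> \<partial>lborel)) \<longlonglongrightarrow> 0"
      unfolding Bochner_Integration.integral_zero by (rule tendsto_norm_zero)
    moreover have "cmod (\<integral>\<zeta>. ?g n \<zeta> \<partial>lborel) = norm (?\<Phi> (z + X n) - ?\<Phi> z - ?\<Phi>' (X n)) / norm (X n)" for n
    proof -
      have "(\<integral>\<zeta>. ?g n \<zeta> \<partial>lborel) = inverse (cmod (X n)) *\<^sub>R
          (\<integral>\<zeta>. k (z + X n - \<zeta>) * f \<zeta> - k (z - \<zeta>) * f \<zeta> - k' (z - \<zeta>) (X n) * f \<zeta> \<partial>lborel)"
        unfolding mult_scaleR_left integral_scaleR_right left_diff_distrib ..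
      also have "\<dots> = inverse (cmod (X n)) *\<^sub>R (?\<Phi> (z + X n) - ?\<Phi> z - ?\<Phi>' (X n))"
        using ik ik' by (simp add: Bochner_Integration.integral_diff)
      finally show ?thesis
        by (simp only: norm_scaleR divide_inverse abs_inverse abs_norm_cancel mult.commute)
    qed
    ultimately show "(\<lambda>n. norm (?\<Phi> (z + X n) - ?\<Phi> z - ?\<Phi>' (X n)) / norm (X n)) \<longlonglongrightarrow> 0"
      by (simp only:)
  qed
  ultimately show ?thesis by (simp add: has_derivative_at)
qed

section \<open>Locally uniform convergence of the gradients\<close>

definition weak_deriv_disc :: "complex \<Rightarrow> (complex \<Rightarrow> complex) \<Rightarrow> (complex \<Rightarrow> complex) \<Rightarrow> bool" where
  "weak_deriv_disc d a b \<longleftrightarrow> (\<forall>\<phi>. test_function (ball 0 1) \<phi> \<longrightarrow>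
     (\<integral>\<zeta>. frechet_derivative \<phi> (at \<zeta>) d *\<^sub>R a \<zeta> \<partial>lborel) = - (\<integral>\<zeta>. \<phi> \<zeta> *\<^sub>R b \<zeta> \<partial>lborel))"

lemma linear_Re_Im_split:
  fixes f :: "complex \<Rightarrow> 'a::real_vector"
  assumes "linear f" shows "f h = Re h *\<^sub>R f 1 + Im h *\<^sub>R f \<i>"
proof -
  have "h = Re h *\<^sub>R 1 + Im h *\<^sub>R \<i>" by (simp add: complex_eq_iff)
  then have "f h = f (Re h *\<^sub>R 1 + Im h *\<^sub>R \<i>)" by simp
  then show ?thesis by (simp only: linear_add[OF assms] linear_cmul[OF assms])
qed

lemma integrable_scaleR_compact_support:
  fixes f :: "complex \<Rightarrow> 'a::euclidean_space" and g :: "complex \<Rightarrow> real"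
  assumes f: "integrable M f" and [measurable]: "g \<in> borel_measurable M"
    and g: "continuous_on UNIV g" "compact K" "\<And>z. z \<notin> K \<Longrightarrow> g z = 0"
  shows "integrable M (\<lambda>z. g z *\<^sub>R f z)"
proof -
  obtain C where C: "C \<ge> 0" "\<And>z. norm (g z) \<le> C"
    using continuous_compact_support_bounded[OF g] by blast
  have [measurable]: "f \<in> borel_measurable M" using f by (rule borel_measurable_integrable)
  show ?thesis
  proof (rule Bochner_Integration.integrable_bound)
    show "integrable M (\<lambda>z. C * norm (f z))" using f by simp
    show "AE z in M. norm (g z *\<^sub>R f z) \<le> norm (C * norm (f z))"
      using C by (intro AE_I2) (simp add: mult_right_mono)
  qed measurable
qed

lemma integrable_test_function_scaleR:
  fixes f :: "complex \<Rightarrow> 'a::euclidean_space"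
  assumes \<phi>: "test_function S \<phi>" and f: "integrable lborel f"
  shows "integrable lborel (\<lambda>z. \<phi> z *\<^sub>R f z)"
    and "d \<in> {1, \<i>} \<Longrightarrow> integrable lborel (\<lambda>z. frechet_derivative \<phi> (at z) d *\<^sub>R f z)"
proof -
  obtain K where K: "compact K" "K \<subseteq> S" "\<And>z. z \<notin> K \<Longrightarrow> \<phi> z = 0"
    "\<And>z e. z \<notin> K \<Longrightarrow> frechet_derivative \<phi> (at z) e = 0"
    using test_function_support[OF \<phi>] by blast
  have c: "continuous_on UNIV \<phi>" by (rule C_k_continuous[OF test_functionD(1)[OF \<phi>]])
  show "integrable lborel (\<lambda>z. \<phi> z *\<^sub>R f z)"
    by (rule integrable_scaleR_compact_support[OF f _ c K(1,3)]) (simp add: borel_measurable_continuous_onI[OF c])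
  show "integrable lborel (\<lambda>z. frechet_derivative \<phi> (at z) d *\<^sub>R f z)" if "d \<in> {1, \<i>}"
  proof -
    have c': "continuous_on UNIV (\<lambda>z. frechet_derivative \<phi> (at z) d)"
      by (rule C_k_continuous[OF test_functionD(3)[OF \<phi> that]])
    show ?thesis
      by (rule integrable_scaleR_compact_support[OF f _ c' K(1,4)]) (simp add: borel_measurable_continuous_onI[OF c'])
  qed
qed

text \<open>Integration by parts. Differentiating \<open>cauchy_reg e (z - \<zeta>)\<close> in
  \<open>z\<close> is minus differentiating it in \<zeta>, and the cutoff turns the kernel into a
  test function, at the price of the term with the derivative of \<eta>. On the right the kernel
  stays undifferentiated, so the limit meets only the integrable singularity
  \<open>1 / t\<close>.\<close>

lemma weak_deriv_cauchy_reg: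
  assumes d: "d \<in> {1, \<i>}" and w: "weak_deriv_disc d a b"
    and ai: "integrable lborel a" and bi: "integrable lborel b"
    and \<eta>: "\<And>k. C_k k \<eta>" "\<And>z. cmod z \<ge> R \<Longrightarrow> \<eta> z = 0" "R < 1" "\<And>z. \<bar>\<eta> z\<bar> \<le> 1"
    and C: "\<And>z. \<bar>frechet_derivative \<eta> (at z) d\<bar> \<le> C"
    and e: "e > 0"
  shows "(\<integral>\<zeta>. cauchy_reg' e (z - \<zeta>) d * (of_real (\<eta> \<zeta>) * a \<zeta>) \<partial>lborel) =
    (\<integral>\<zeta>. cauchy_reg e (z - \<zeta>) * (of_real (frechet_derivative \<eta> (at \<zeta>) d) * a \<zeta> + of_real (\<eta> \<zeta>) * b \<zeta>) \<partial>lborel)"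
proof -
  let ?\<eta>' = "\<lambda>\<zeta>. frechet_derivative \<eta> (at \<zeta>) d"
  let ?K = "\<lambda>\<zeta>. cauchy_reg e (z - \<zeta>)" and ?K' = "\<lambda>\<zeta>. cauchy_reg' e (z - \<zeta>) d"
  \<comment> \<open>The complex test function, cutoff times kernel, is split into real and imaginary
    parts; the two identities are recombined with factors \<open>1\<close> and
    \<open>\<i>\<close>.\<close>
  define \<phi>1 where "\<phi>1 \<zeta> = \<eta> \<zeta> * Re (?K \<zeta>)" for \<zeta>
  define \<phi>2 where "\<phi>2 \<zeta> = \<eta> \<zeta> * Im (?K \<zeta>)" for \<zeta>
  have t: "test_function (ball 0 1) \<phi>1" "test_function (ball 0 1) \<phi>2"
    unfolding \<phi>1_def[abs_def] \<phi>2_def[abs_def]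
    by (rule test_function_mult[OF \<eta>(1) C_k_Re_cauchy_reg[OF e] \<eta>(2,3)]; assumption)
      (rule test_function_mult[OF \<eta>(1) C_k_Im_cauchy_reg[OF e] \<eta>(2,3)]; assumption)
  have dK: "(?K has_derivative (\<lambda>h. - cauchy_reg' e (z - \<zeta>) h)) (at \<zeta>)" for \<zeta>
  proof -
    have "linear (cauchy_reg' e (z - \<zeta>))"
      using has_derivative_linear[OF has_derivative_cauchy_reg[OF e]] .
    moreover have "(?K has_derivative (\<lambda>h. cauchy_reg' e (z - \<zeta>) (- h))) (at \<zeta>)"
      by (rule has_derivative_compose[OF _ has_derivative_cauchy_reg[OF e]]) (auto intro!: derivative_eq_intros)
    ultimately show ?thesis by (simp add: linear_neg)
  qed
  have d1: "frechet_derivative \<phi>1 (at \<zeta>) d = \<eta> \<zeta> * - Re (?K' \<zeta>) + ?\<eta>' \<zeta> * Re (?K \<zeta>)" for \<zeta>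
  proof -
    have "(\<phi>1 has_derivative (\<lambda>h. \<eta> \<zeta> * Re (- cauchy_reg' e (z - \<zeta>) h)
        + frechet_derivative \<eta> (at \<zeta>) h * Re (?K \<zeta>))) (at \<zeta>)"
      unfolding \<phi>1_def[abs_def]
      by (rule has_derivative_mult[OF C_k_SucD(1)[OF \<eta>(1)] has_derivative_Re[OF dK]])
    then show ?thesis by (subst frechet_derivative_at[symmetric]) simp_all
  qed
  have d2: "frechet_derivative \<phi>2 (at \<zeta>) d = \<eta> \<zeta> * - Im (?K' \<zeta>) + ?\<eta>' \<zeta> * Im (?K \<zeta>)" for \<zeta>
  proof -
    have "(\<phi>2 has_derivative (\<lambda>h. \<eta> \<zeta> * Im (- cauchy_reg' e (z - \<zeta>) h)
        + frechet_derivative \<eta> (at \<zeta>) h * Im (?K \<zeta>))) (at \<zeta>)"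
      unfolding \<phi>2_def[abs_def]
      by (rule has_derivative_mult[OF C_k_SucD(1)[OF \<eta>(1)] has_derivative_Im[OF dK]])
    then show ?thesis by (subst frechet_derivative_at[symmetric]) simp_all
  qed
  note i1 = integrable_test_function_scaleR(2)[OF t(1) ai d] integrable_test_function_scaleR(1)[OF t(1) bi]
  note i2 = integrable_test_function_scaleR(2)[OF t(2) ai d] integrable_test_function_scaleR(1)[OF t(2) bi]
  let ?A = "\<lambda>\<zeta>. of_real (?\<eta>' \<zeta>) * a \<zeta>" and ?H = "\<lambda>\<zeta>. of_real (\<eta> \<zeta>) * a \<zeta>" and ?B = "\<lambda>\<zeta>. of_real (\<eta> \<zeta>) * b \<zeta>"
  have [measurable]: "\<eta> \<in> borel_measurable borel" "?\<eta>' \<in> borel_measurable borel"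
    "a \<in> borel_measurable borel" "b \<in> borel_measurable borel"
    using borel_measurable_continuous_onI[OF C_k_continuous[OF \<eta>(1)]] ai bi
      borel_measurable_continuous_onI[OF C_k_continuous, OF C_k_SucD(2)[OF \<eta>(1)]]
      borel_measurable_continuous_onI[OF C_k_continuous, OF C_k_SucD(3)[OF \<eta>(1)]] d
    by (auto simp: borel_measurable_integrable)
  have I: "integrable lborel ?A" "integrable lborel ?H" "integrable lborel ?B"
    by (rule integrable_bounded_mult[OF ai _ , of _ C] integrable_bounded_mult[OF ai _ , of _ 1]
        integrable_bounded_mult[OF bi _ , of _ 1]; use C \<eta>(4) in simp)+
  have J: "integrable lborel (\<lambda>\<zeta>. ?K' \<zeta> * ?H \<zeta>)" "integrable lborel (\<lambda>\<zeta>. ?K \<zeta> * ?A \<zeta>)"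
    "integrable lborel (\<lambda>\<zeta>. ?K \<zeta> * ?B \<zeta>)"
    by (rule integrable_bounded_mult[OF I(1) _ norm_cauchy_reg_le[OF e]]
        integrable_bounded_mult[OF I(2) _ norm_cauchy_reg'_le[OF e]]
        integrable_bounded_mult[OF I(3) _ norm_cauchy_reg_le[OF e]]; measurable)+
  have "(\<integral>\<zeta>. ?K \<zeta> * ?A \<zeta> \<partial>lborel) - (\<integral>\<zeta>. ?K' \<zeta> * ?H \<zeta> \<partial>lborel)
      = (\<integral>\<zeta>. ?K \<zeta> * ?A \<zeta> - ?K' \<zeta> * ?H \<zeta> \<partial>lborel)"
    by (rule Bochner_Integration.integral_diff[OF J(2,1), symmetric])
  also have "(\<lambda>\<zeta>. ?K \<zeta> * ?A \<zeta> - ?K' \<zeta> * ?H \<zeta>)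
      = (\<lambda>\<zeta>. frechet_derivative \<phi>1 (at \<zeta>) d *\<^sub>R a \<zeta> + \<i> * (frechet_derivative \<phi>2 (at \<zeta>) d *\<^sub>R a \<zeta>))"
    unfolding d1 d2 by (auto simp: fun_eq_iff complex_eq_iff algebra_simps)
  also have "(\<integral>\<zeta>. frechet_derivative \<phi>1 (at \<zeta>) d *\<^sub>R a \<zeta> + \<i> * (frechet_derivative \<phi>2 (at \<zeta>) d *\<^sub>R a \<zeta>) \<partial>lborel)
      = (\<integral>\<zeta>. frechet_derivative \<phi>1 (at \<zeta>) d *\<^sub>R a \<zeta> \<partial>lborel) + \<i> * (\<integral>\<zeta>. frechet_derivative \<phi>2 (at \<zeta>) d *\<^sub>R a \<zeta> \<partial>lborel)"
    unfolding integral_mult_right_zero[symmetric]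
    by (rule Bochner_Integration.integral_add[OF i1(1) integrable_mult_right[OF i2(1)]])
  also have "\<dots> = - ((\<integral>\<zeta>. \<phi>1 \<zeta> *\<^sub>R b \<zeta> \<partial>lborel) + \<i> * (\<integral>\<zeta>. \<phi>2 \<zeta> *\<^sub>R b \<zeta> \<partial>lborel))"
    using w t unfolding weak_deriv_disc_def by simp
  also have "(\<integral>\<zeta>. \<phi>1 \<zeta> *\<^sub>R b \<zeta> \<partial>lborel) + \<i> * (\<integral>\<zeta>. \<phi>2 \<zeta> *\<^sub>R b \<zeta> \<partial>lborel)
      = (\<integral>\<zeta>. \<phi>1 \<zeta> *\<^sub>R b \<zeta> + \<i> * (\<phi>2 \<zeta> *\<^sub>R b \<zeta>) \<partial>lborel)"
    unfolding integral_mult_right_zero[symmetric]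
    by (rule Bochner_Integration.integral_add[OF i1(2) integrable_mult_right[OF i2(2)], symmetric])
  also have "(\<lambda>\<zeta>. \<phi>1 \<zeta> *\<^sub>R b \<zeta> + \<i> * (\<phi>2 \<zeta> *\<^sub>R b \<zeta>)) = (\<lambda>\<zeta>. ?K \<zeta> * ?B \<zeta>)"
    unfolding \<phi>1_def \<phi>2_def by (auto simp: fun_eq_iff complex_eq_iff algebra_simps)
  finally have "(\<integral>\<zeta>. ?K' \<zeta> * ?H \<zeta> \<partial>lborel) = (\<integral>\<zeta>. ?K \<zeta> * ?A \<zeta> \<partial>lborel) + (\<integral>\<zeta>. ?K \<zeta> * ?B \<zeta> \<partial>lborel)"
    by (simp only: diff_eq_eq) (simp add: algebra_simps)
  also have "\<dots> = (\<integral>\<zeta>. ?K \<zeta> * (?A \<zeta> + ?B \<zeta>) \<partial>lborel)"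
    unfolding distrib_left by (rule Bochner_Integration.integral_add[OF J(2,3), symmetric])
  finally show ?thesis .
qed

text \<open>Points of the smaller disc keep distance \<open>r1 - r\<close> from the support of
  \<open>f\<close>, so the differentiated kernels converge uniformly where they matter and
  integrability of \<open>f\<close> is enough.\<close>

lemma uniform_limit_cauchy_reg'_away:
  assumes f: "integrable lborel f" and d: "cmod d \<le> 1" and r: "r < r1"
    and supp: "\<And>\<zeta>. cmod \<zeta> \<le> r1 \<Longrightarrow> f \<zeta> = 0"
  shows "uniform_limit (cball 0 r) (\<lambda>n z. \<integral>\<zeta>. cauchy_reg' (reg_param n) (z - \<zeta>) d * f \<zeta> \<partial>lborel)
    (\<lambda>z. \<integral>\<zeta>. (- d / (z - \<zeta>)\<^sup>2) * f \<zeta> \<partial>lborel) sequentially"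
proof -
  define \<delta> where "\<delta> = r1 - r"
  have \<delta>: "\<delta> > 0" using r by (simp add: \<delta>_def)
  have [measurable]: "f \<in> borel_measurable borel" using f by (simp add: borel_measurable_integrable)
  have far: "cmod (z - \<zeta>) \<ge> \<delta>" if "z \<in> cball 0 r" "f \<zeta> \<noteq> 0" for z \<zeta>
  proof -
    have "r1 < cmod \<zeta>" using that(2) supp[of \<zeta>] by force
    then show ?thesis
      using that(1) norm_triangle_ineq2[of \<zeta> z] by (simp add: \<delta>_def norm_minus_commute)
  qed
  define I where "I = (\<integral>\<zeta>. cmod (f \<zeta>) \<partial>lborel)"
  have bound: "cmod ((\<integral>\<zeta>. cauchy_reg' (reg_param n) (z - \<zeta>) d * f \<zeta> \<partial>lborel)
      - (\<integral>\<zeta>. (- d / (z - \<zeta>)\<^sup>2) * f \<zeta> \<partial>lborel)) \<le> reg_param n * (3 / \<delta> ^ 4 * I)"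
    if z: "z \<in> cball 0 r" for n z
  proof -
    have i1: "integrable lborel (\<lambda>\<zeta>. cauchy_reg' (reg_param n) (z - \<zeta>) d * f \<zeta>)"
      by (rule integrable_bounded_mult[OF f _ norm_cauchy_reg'_le[OF reg_param_pos]]) measurable
    have i2: "integrable lborel (\<lambda>\<zeta>. (- d / (z - \<zeta>)\<^sup>2) * f \<zeta>)"
    proof (rule Bochner_Integration.integrable_bound)
      show "integrable lborel (\<lambda>\<zeta>. 1 / \<delta>\<^sup>2 * cmod (f \<zeta>))" using f by simp
      have "cmod ((- d / (z - \<zeta>)\<^sup>2) * f \<zeta>) \<le> 1 / \<delta>\<^sup>2 * cmod (f \<zeta>)" for \<zeta>
      proof (cases "f \<zeta> = 0")
        case False
        then have "cmod d / (cmod (z - \<zeta>))\<^sup>2 \<le> 1 / \<delta>\<^sup>2"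
          using \<delta> d far[OF z] by (intro frac_le power_mono) auto
        then show ?thesis
          unfolding norm_mult norm_divide norm_power norm_minus_cancel by (rule mult_right_mono) simp
      qed simp
      then show "AE \<zeta> in lborel. cmod ((- d / (z - \<zeta>)\<^sup>2) * f \<zeta>) \<le> norm (1 / \<delta>\<^sup>2 * cmod (f \<zeta>))"
        by (intro AE_I2) (simp add: order_trans[OF _ abs_ge_self])
    qed measurable
    have "cmod ((\<integral>\<zeta>. cauchy_reg' (reg_param n) (z - \<zeta>) d * f \<zeta> \<partial>lborel)
      - (\<integral>\<zeta>. (- d / (z - \<zeta>)\<^sup>2) * f \<zeta> \<partial>lborel)) =
       cmod (\<integral>\<zeta>. cauchy_reg' (reg_param n) (z - \<zeta>) d * f \<zeta> - (- d / (z - \<zeta>)\<^sup>2) * f \<zeta> \<partial>lborel)"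
      by (simp only: Bochner_Integration.integral_diff[OF i1 i2])
    also have "\<dots> \<le> (\<integral>\<zeta>. 3 * reg_param n / \<delta> ^ 4 * cmod (f \<zeta>) \<partial>lborel)"
    proof (rule norm_integral_le_integral[OF Bochner_Integration.integrable_diff[OF i1 i2]])
      show "integrable lborel (\<lambda>\<zeta>. 3 * reg_param n / \<delta> ^ 4 * cmod (f \<zeta>))" using f by simp
      fix \<zeta>
      show "cmod (cauchy_reg' (reg_param n) (z - \<zeta>) d * f \<zeta> - (- d / (z - \<zeta>)\<^sup>2) * f \<zeta>)
          \<le> 3 * reg_param n / \<delta> ^ 4 * cmod (f \<zeta>)"
      proof (cases "f \<zeta> = 0")
        case False
        then have t: "cmod (z - \<zeta>) \<ge> \<delta>" by (rule far[OF z])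
        then have nz: "z - \<zeta> \<noteq> 0" using \<delta> by auto
        have "cmod (cauchy_reg' (reg_param n) (z - \<zeta>) d - (- d / (z - \<zeta>)\<^sup>2))
            \<le> 3 * reg_param n / cmod (z - \<zeta>) ^ 4 * cmod d"
          by (rule cauchy_reg'_diff_le[OF reg_param_pos nz])
        also have "\<dots> \<le> 3 * reg_param n / \<delta> ^ 4 * 1"
          using d t \<delta> reg_param_pos[of n]
          by (intro mult_mono divide_left_mono power_mono mult_pos_pos zero_less_power) auto
        finally show ?thesis
          unfolding left_diff_distrib[symmetric] norm_mult by (intro mult_right_mono) simp_all
      qed simp
    qed
    also have "\<dots> = reg_param n * (3 / \<delta> ^ 4 * I)" by (simp add: I_def)
    finally show ?thesis .
  qed
  have lim: "(\<lambda>n. reg_param n * (3 / \<delta> ^ 4 * I)) \<longlonglongrightarrow> 0"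
    by (rule tendsto_mult_left_zero[OF reg_param_tendsto])
  show ?thesis
  proof (rule uniform_limitI)
    fix e :: real assume "e > 0"
    then have "\<forall>\<^sub>F n in sequentially. reg_param n * (3 / \<delta> ^ 4 * I) < e"
      using lim by (simp add: order_tendstoD(2))
    then show "\<forall>\<^sub>F n in sequentially. \<forall>z\<in>cball 0 r. dist (\<integral>\<zeta>. cauchy_reg' (reg_param n) (z - \<zeta>) d * f \<zeta> \<partial>lborel)
        (\<integral>\<zeta>. (- d / (z - \<zeta>)\<^sup>2) * f \<zeta> \<partial>lborel) < e"
    proof eventually_elim
      case (elim n)
      then show ?case unfolding dist_norm using bound order_le_less_trans by blast
    qed
  qed
qed

text \<open>Near the disc of radius \<open>r\<close> the weak derivative moves the differentiation from the kernel to
  \<open>a\<close>; away from it the kernel is smooth.\<close>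

lemma uniform_limit_cauchy_reg':
  assumes a: "Lq_disc q a" and b: "Lq_disc q b" and q: "q > 2" and d: "d \<in> {1, \<i>}"
    and w: "weak_deriv_disc d a b" and r: "0 < r" "r < 1"
  shows "\<exists>L. uniform_limit (cball 0 r) (\<lambda>n z. \<integral>\<zeta>. cauchy_reg' (reg_param n) (z - \<zeta>) d * a \<zeta> \<partial>lborel) L sequentially"
proof -
  have q1: "q > 1" using q by simp
  have ai: "integrable lborel a" and bi: "integrable lborel b"
    using Lq_disc_integrable[OF a q1] Lq_disc_integrable[OF b q1] by auto
  \<comment> \<open>\<open>r1\<close> and \<open>R\<close> trisect the interval from
    \<open>r\<close> to \<open>1\<close>: the cutoff is \<open>1\<close> on a disc strictly larger
    than the target disc and vanishes before the unit circle.\<close>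
  define r1 where "r1 = (2 * r + 1) / 3"
  define R where "R = (r + 2) / 3"
  have rr: "r < r1" "0 < r1" "r1 < R" "R < 1" using r by (simp_all add: r1_def R_def)
  obtain \<eta> where \<eta>: "\<And>k. C_k k \<eta>" "\<And>z. cmod z \<le> r1 \<Longrightarrow> \<eta> z = 1"
    "\<And>z. cmod z \<ge> R \<Longrightarrow> \<eta> z = 0" "\<And>z. 0 \<le> \<eta> z" "\<And>z. \<eta> z \<le> 1"
    using smooth_cutoff[OF rr(2,3)] by blast
  have \<eta>1: "\<bar>\<eta> z\<bar> \<le> 1" for z using \<eta>(4,5)[of z] by simp
  let ?\<eta>' = "\<lambda>\<zeta>. frechet_derivative \<eta> (at \<zeta>) d"
  have t: "test_function (ball 0 1) \<eta>"
    using test_function_mult[OF \<eta>(1) C_k_const \<eta>(3) rr(4), of 1] by simp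
  obtain K where K: "compact K" "\<And>z e. z \<notin> K \<Longrightarrow> frechet_derivative \<eta> (at z) e = 0"
    using test_function_support[OF t] by metis
  have \<eta>'c: "continuous_on UNIV ?\<eta>'" by (rule C_k_continuous[OF test_functionD(3)[OF t d]])
  obtain C where C: "\<And>z. norm (?\<eta>' z) \<le> C"
    using continuous_compact_support_bounded[OF \<eta>'c K] by blast
  have [measurable]: "\<eta> \<in> borel_measurable borel" "?\<eta>' \<in> borel_measurable borel"
    using borel_measurable_continuous_onI[OF C_k_continuous[OF \<eta>(1)]]
      borel_measurable_continuous_onI[OF \<eta>'c] by auto
  \<comment> \<open>\<open>f\<close> gathers what integration by parts leaves under the
    undifferentiated kernel; it lies in \<open>L\<^sup>q\<close>, so
    \<open>uniform_limit_cauchy_reg\<close> applies. The part \<open>g\<close> of \<open>a\<close>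
    removed by the cutoff vanishes on the disc of radius \<open>r1\<close>.\<close>
  define f where "f \<zeta> = of_real (?\<eta>' \<zeta>) * a \<zeta> + of_real (\<eta> \<zeta>) * b \<zeta>" for \<zeta>
  have f: "Lq_disc q f"
    unfolding f_def[abs_def]
    by (intro Lq_disc_add Lq_disc_bounded_mult[OF a q1, of _ C] Lq_disc_bounded_mult[OF b q1, of _ 1] q1)
      (use C \<eta>1 in auto)
  define g where "g \<zeta> = of_real (1 - \<eta> \<zeta>) * a \<zeta>" for \<zeta>
  have hi: "integrable lborel (\<lambda>\<zeta>. of_real (\<eta> \<zeta>) * a \<zeta>)"
    by (rule integrable_bounded_mult[OF ai, of _ 1]) (use \<eta>1 in auto)
  have gi: "integrable lborel g"
    unfolding g_def[abs_def]
    by (rule integrable_bounded_mult[OF ai, of _ 1])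
      (use \<eta>(4,5) in \<open>auto simp del: of_real_diff simp: norm_of_real\<close>)
  have "uniform_limit (cball 0 r) (\<lambda>n z. (\<integral>\<zeta>. cauchy_reg (reg_param n) (z - \<zeta>) * f \<zeta> \<partial>lborel)
      + (\<integral>\<zeta>. cauchy_reg' (reg_param n) (z - \<zeta>) d * g \<zeta> \<partial>lborel))
     (\<lambda>z. (\<integral>\<zeta>. f \<zeta> / (z - \<zeta>) \<partial>lborel) + (\<integral>\<zeta>. (- d / (z - \<zeta>)\<^sup>2) * g \<zeta> \<partial>lborel)) sequentially"
    using uniform_limit_on_subset[OF uniform_limit_cauchy_reg[OF f q], of "cball 0 r"]
      uniform_limit_cauchy_reg'_away[OF gi _ rr(1), of d] d \<eta>(2)
    by (intro uniform_limit_add) (auto simp: g_def)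
  moreover have "(\<integral>\<zeta>. cauchy_reg (reg_param n) (z - \<zeta>) * f \<zeta> \<partial>lborel)
      + (\<integral>\<zeta>. cauchy_reg' (reg_param n) (z - \<zeta>) d * g \<zeta> \<partial>lborel)
      = (\<integral>\<zeta>. cauchy_reg' (reg_param n) (z - \<zeta>) d * a \<zeta> \<partial>lborel)" for n z
  proof -
    have f_eq: "(\<integral>\<zeta>. cauchy_reg (reg_param n) (z - \<zeta>) * f \<zeta> \<partial>lborel)
      = (\<integral>\<zeta>. cauchy_reg' (reg_param n) (z - \<zeta>) d * (of_real (\<eta> \<zeta>) * a \<zeta>) \<partial>lborel)"
      unfolding f_def
      by (rule weak_deriv_cauchy_reg[OF d w ai bi \<eta>(1,3) rr(4) \<eta>1 C[unfolded real_norm_def] reg_param_pos, symmetric])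
    have "(\<integral>\<zeta>. cauchy_reg (reg_param n) (z - \<zeta>) * f \<zeta> \<partial>lborel)
      + (\<integral>\<zeta>. cauchy_reg' (reg_param n) (z - \<zeta>) d * g \<zeta> \<partial>lborel)
      = (\<integral>\<zeta>. cauchy_reg' (reg_param n) (z - \<zeta>) d * (of_real (\<eta> \<zeta>) * a \<zeta>)
          + cauchy_reg' (reg_param n) (z - \<zeta>) d * g \<zeta> \<partial>lborel)"
      unfolding f_eq
    proof (rule Bochner_Integration.integral_add[symmetric])
      show "integrable lborel (\<lambda>\<zeta>. cauchy_reg' (reg_param n) (z - \<zeta>) d * (of_real (\<eta> \<zeta>) * a \<zeta>))"
        by (rule integrable_bounded_mult[OF hi _ norm_cauchy_reg'_le[OF reg_param_pos]]) measurable
      show "integrable lborel (\<lambda>\<zeta>. cauchy_reg' (reg_param n) (z - \<zeta>) d * g \<zeta>)"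
        by (rule integrable_bounded_mult[OF gi _ norm_cauchy_reg'_le[OF reg_param_pos]]) measurable
    qed
    also have "(\<lambda>\<zeta>. cauchy_reg' (reg_param n) (z - \<zeta>) d * (of_real (\<eta> \<zeta>) * a \<zeta>)
          + cauchy_reg' (reg_param n) (z - \<zeta>) d * g \<zeta>) = (\<lambda>\<zeta>. cauchy_reg' (reg_param n) (z - \<zeta>) d * a \<zeta>)"
    proof
      have split: "k * (of_real t * x) + k * (of_real (1 - t) * x) = k * x" for k x :: complex and t
        by (simp only: distrib_left[symmetric] distrib_right[symmetric] of_real_add[symmetric]) simp
      show "cauchy_reg' (reg_param n) (z - \<zeta>) d * (of_real (\<eta> \<zeta>) * a \<zeta>)
          + cauchy_reg' (reg_param n) (z - \<zeta>) d * g \<zeta> = cauchy_reg' (reg_param n) (z - \<zeta>) d * a \<zeta>" for \<zeta>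
        unfolding g_def by (rule split)
    qed
    finally show ?thesis .
  qed
  ultimately show ?thesis by (simp only:) (rule exI)
qed

text \<open>The regularised transforms converge and their gradients converge uniformly on smaller
  discs, so the limit is differentiable with the limit gradient. The last property is handed on
  because \<open>X 1 z + \<i> * X \<i> z\<close> is later identified through the same
  approximations.\<close>

lemma cauchy_transform_C1:
  assumes a: "Lq_disc q a" "Lq_disc q ax" "Lq_disc q ay" and q: "q > 2"
    and w: "weak_deriv_disc 1 a ax" "weak_deriv_disc \<i> a ay"
  obtains X where "\<And>d. d \<in> {1, \<i>} \<Longrightarrow> continuous_on (ball 0 1) (X d)"
    "\<And>z. z \<in> ball 0 1 \<Longrightarrow> ((\<lambda>z. \<integral>\<zeta>. a \<zeta> / (z - \<zeta>) \<partial>lborel) has_derivative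
       (\<lambda>h. Re h *\<^sub>R X 1 z + Im h *\<^sub>R X \<i> z)) (at z)"
    "\<And>d r. d \<in> {1, \<i>} \<Longrightarrow> 0 < r \<Longrightarrow> r < 1 \<Longrightarrow>
       uniform_limit (cball 0 r) (\<lambda>n z. \<integral>\<zeta>. cauchy_reg' (reg_param n) (z - \<zeta>) d * a \<zeta> \<partial>lborel) (X d) sequentially"
proof -
  have q1: "q > 1" using q by simp
  note ai = Lq_disc_integrable[OF a(1) q1]
  define U where "U d n z = (\<integral>\<zeta>. cauchy_reg' (reg_param n) (z - \<zeta>) d * a \<zeta> \<partial>lborel)" for d n z
  \<comment> \<open>Taken as a pointwise limit, \<open>X\<close> does not depend on the radius of
    the disc on which uniform convergence is shown.\<close>
  define X where "X d z = lim (\<lambda>n. U d n z)" for d z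
  let ?\<alpha> = "\<lambda>z. \<integral>\<zeta>. a \<zeta> / (z - \<zeta>) \<partial>lborel"
  have ul: "uniform_limit (cball 0 r) (U d) (X d) sequentially" if "d \<in> {1, \<i>}" "0 < r" "r < 1" for d r
  proof -
    have "\<exists>L. uniform_limit (cball 0 r) (U d) L sequentially"
      using uniform_limit_cauchy_reg'[OF a(1,2) q _ w(1)] uniform_limit_cauchy_reg'[OF a(1,3) q _ w(2)] that
      unfolding U_def[abs_def] by blast
    then show ?thesis
      unfolding X_def[abs_def] uniformly_convergent_on_def[symmetric] uniformly_convergent_uniform_limit_iff .
  qed
  have Uc: "continuous_on UNIV (U d n)" for d n
    unfolding U_def[abs_def]
    by (rule continuous_on_convolution[OF ai continuous_on_cauchy_reg'[OF reg_param_pos continuous_on_id]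
          norm_cauchy_reg'_le[OF reg_param_pos]])
  have Xc: "continuous_on (cball 0 r) (X d)" if "d \<in> {1, \<i>}" "0 < r" "r < 1" for d r
    by (rule uniform_limit_theorem[OF _ ul[OF that]])
      (simp_all add: continuous_on_subset[OF Uc])
  have "continuous_on (ball 0 1) (X d)" if "d \<in> {1, \<i>}" for d
  proof (rule continuous_at_imp_continuous_on, rule ballI)
    fix z :: complex assume z: "z \<in> ball 0 1"
    define r where "r = (1 + cmod z) / 2"
    have r: "0 < r" "r < 1" "z \<in> ball 0 r" using z by (auto simp: r_def add_pos_nonneg)
    have "continuous_on (ball 0 r) (X d)"
      using Xc[OF that r(1,2)] ball_subset_cball continuous_on_subset by blast
    then show "isCont (X d) z" using r(3) by (simp add: continuous_on_eq_continuous_at)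
  qed
  moreover have "(?\<alpha> has_derivative (\<lambda>h. Re h *\<^sub>R X 1 z + Im h *\<^sub>R X \<i> z)) (at z)" if z: "z \<in> ball 0 1" for z
  proof -
    define r where "r = (1 + cmod z) / 2"
    have r: "0 < r" "r < 1" "z \<in> ball 0 r" using z by (auto simp: r_def add_pos_nonneg)
    define f where "f n z = (\<integral>\<zeta>. cauchy_reg (reg_param n) (z - \<zeta>) * a \<zeta> \<partial>lborel)" for n z
    have lim: "(\<lambda>n. f n x) \<longlonglongrightarrow> ?\<alpha> x" for x
      using tendsto_uniform_limitI[OF uniform_limit_cauchy_reg[OF a(1) q], of x] by (simp add: f_def)
    have der: "(f n has_derivative (\<lambda>h. Re h *\<^sub>R U 1 n x + Im h *\<^sub>R U \<i> n x)) (at x)" for n x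
    proof -
      have D: "(f n has_derivative (\<lambda>h. U h n x)) (at x)"
        unfolding f_def[abs_def] U_def
        by (rule has_derivative_convolution[OF ai has_derivative_cauchy_reg[OF reg_param_pos]
              norm_cauchy_reg_le[OF reg_param_pos] _ borel_measurable_cauchy_reg', where M="1 / reg_param n"])
          (use norm_cauchy_reg'_le[OF reg_param_pos] in simp)
      have "(\<lambda>h. U h n x) = (\<lambda>h. Re h *\<^sub>R U 1 n x + Im h *\<^sub>R U \<i> n x)"
        by (rule ext) (rule linear_Re_Im_split[OF has_derivative_linear[OF D]])
      then show ?thesis using D by (simp only:)
    qed
    have "\<exists>g. \<forall>x\<in>ball 0 r. (\<lambda>n. f n x) \<longlonglongrightarrow> g x \<and>
        (g has_derivative (\<lambda>h. Re h *\<^sub>R X 1 x + Im h *\<^sub>R X \<i> x)) (at x within ball 0 r)"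
    proof (rule has_derivative_sequence[OF convex_ball has_derivative_at_withinI[OF der] _ r(3) lim])
      fix e :: real assume e: "e > 0"
      have "\<forall>\<^sub>F n in sequentially. \<forall>x\<in>cball 0 r. dist (U 1 n x) (X 1 x) < e / 2"
        "\<forall>\<^sub>F n in sequentially. \<forall>x\<in>cball 0 r. dist (U \<i> n x) (X \<i> x) < e / 2"
        by (rule uniform_limitD[OF ul]; use e r in simp)+
      then show "\<forall>\<^sub>F n in sequentially. \<forall>x\<in>ball 0 r. \<forall>h. norm ((Re h *\<^sub>R U 1 n x + Im h *\<^sub>R U \<i> n x)
          - (Re h *\<^sub>R X 1 x + Im h *\<^sub>R X \<i> x)) \<le> e * norm h"
      proof eventually_elim
        case (elim n)
        show ?case
        proof (intro ballI allI)
          fix x h :: complex assume x: "x \<in> ball 0 r"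
          have "norm ((Re h *\<^sub>R U 1 n x + Im h *\<^sub>R U \<i> n x) - (Re h *\<^sub>R X 1 x + Im h *\<^sub>R X \<i> x))
            = norm (Re h *\<^sub>R (U 1 n x - X 1 x) + Im h *\<^sub>R (U \<i> n x - X \<i> x))"
            by (simp add: scaleR_diff_right algebra_simps)
          also have "\<dots> \<le> \<bar>Re h\<bar> * norm (U 1 n x - X 1 x) + \<bar>Im h\<bar> * norm (U \<i> n x - X \<i> x)"
            by (metis norm_triangle_ineq norm_scaleR)
          also have "\<dots> \<le> norm h * (e / 2) + norm h * (e / 2)"
            using elim x by (intro add_mono mult_mono abs_Re_le_cmod abs_Im_le_cmod)
              (auto simp: dist_norm less_imp_le)
          finally show "norm ((Re h *\<^sub>R U 1 n x + Im h *\<^sub>R U \<i> n x) - (Re h *\<^sub>R X 1 x + Im h *\<^sub>R X \<i> x)) \<le> e * norm h"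
            by (simp add: field_simps)
        qed
      qed
    qed
    \<comment> \<open>The limit function supplied by the convergence theorem is the Cauchy
      transform, by uniqueness of limits.\<close>
    then obtain g where g: "\<And>x. x \<in> ball 0 r \<Longrightarrow> (\<lambda>n. f n x) \<longlonglongrightarrow> g x"
      "\<And>x. x \<in> ball 0 r \<Longrightarrow> (g has_derivative (\<lambda>h. Re h *\<^sub>R X 1 x + Im h *\<^sub>R X \<i> x)) (at x within ball 0 r)"
      by blast
    have "(g has_derivative (\<lambda>h. Re h *\<^sub>R X 1 z + Im h *\<^sub>R X \<i> z)) (at z)"
      using g(2)[OF r(3)] at_within_open[OF r(3) open_ball] by simp
    then show ?thesis
      by (rule has_derivative_transform_within_open[OF _ open_ball r(3)])
        (use LIMSEQ_unique[OF g(1) lim] in simp)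
  qed
  ultimately show ?thesis using that[of X] ul unfolding U_def[abs_def] by blast
qed

section \<open>The approximate identity and the dbar-derivative of the Cauchy transform\<close>

lemma integral_lborel_rescale:
  fixes f :: "'a::euclidean_space \<Rightarrow> real"
  assumes [measurable]: "f \<in> borel_measurable borel" and c: "c \<noteq> 0"
  shows "(\<integral>z. f z \<partial>lborel) = (\<integral>x. \<bar>c\<bar> ^ DIM('a) * f (t + c *\<^sub>R x) \<partial>lborel)"
  by (subst lborel_affine[OF c, of t], subst integral_density)
    (simp_all add: integral_distr)

definition dbar_mass :: real where
  "dbar_mass = (\<integral>t. 1 / ((cmod t)\<^sup>2 + 1)\<^sup>2 \<partial>lborel)"

text \<open>The integrand is strictly positive, so a vanishing integral would make the whole plane a
  null set. Positivity is what allows the mass to be divided out.\<close>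

lemma dbar_mass_pos: "dbar_mass > 0"
proof -
  let ?f = "\<lambda>t::complex. 1 / ((cmod t)\<^sup>2 + 1)\<^sup>2"
  have pos: "?f t > 0" for t by (intro divide_pos_pos zero_less_power add_nonneg_pos) auto
  have "dbar_mass \<ge> 0" unfolding dbar_mass_def by (rule Bochner_Integration.integral_nonneg) (simp add: less_imp_le)
  moreover have "dbar_mass \<noteq> 0"
  proof
    assume "dbar_mass = 0"
    then have "AE t in lborel. ?f t = 0"
      unfolding dbar_mass_def
      using integral_nonneg_eq_0_iff_AE[OF integrable_dbar_mass_density] pos by (simp add: less_imp_le)
    then have "AE t::complex in lborel. False"
      by eventually_elim (metis pos less_irrefl)
    then show False by (simp add: AE_iff_measurable[OF _ refl] emeasure_lborel_UNIV)
  qed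
  ultimately show ?thesis by simp
qed

definition dbar_kernel :: "real \<Rightarrow> complex \<Rightarrow> real" where
  "dbar_kernel e t = e / ((cmod t)\<^sup>2 + e)\<^sup>2"

text \<open>This combination of directions is twice the derivative by \<open>cnj t\<close>: the
  complex-linear part of \<open>cauchy_reg'\<close> cancels and the conjugate-linear part
  doubles.\<close>

lemma cauchy_reg'_dbar:
  "cauchy_reg' e t 1 + \<i> * cauchy_reg' e t \<i> = 2 * of_real (dbar_kernel e t)"
  unfolding cauchy_reg'_def dbar_kernel_def
  by (simp add: algebra_simps flip: add_divide_distrib diff_divide_distrib)

lemma borel_measurable_dbar_kernel [measurable]: "dbar_kernel e \<in> borel_measurable borel"
  unfolding dbar_kernel_def[abs_def] by measurable

lemma dbar_kernel_nonneg: "e > 0 \<Longrightarrow> dbar_kernel e t \<ge> 0"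
  by (simp add: dbar_kernel_def)

lemma dbar_kernel_le: "e > 0 \<Longrightarrow> dbar_kernel e t \<le> 1 / e"
proof -
  assume e: "e > 0"
  have "e / ((cmod t)\<^sup>2 + e)\<^sup>2 \<le> e / e\<^sup>2"
    using e by (intro divide_left_mono power_mono mult_pos_pos zero_less_power add_nonneg_pos) auto
  then show ?thesis using e by (simp add: dbar_kernel_def power2_eq_square)
qed

text \<open>Substitution of \<open>z = \<zeta> + t / (n + 1)\<close>: the Jacobian absorbs the
  scaling of the kernel and leaves a fixed density under a moving indicator.\<close>

lemma integral_box_dbar_kernel:
  assumes [measurable]: "B \<in> sets borel"
  shows "(\<integral>z. indicator B z * dbar_kernel (reg_param n) (z - \<zeta>) \<partial>lborel) =
    (\<integral>t. indicator B (\<zeta> + (1 / real (Suc n)) *\<^sub>R t) * (1 / ((cmod t)\<^sup>2 + 1)\<^sup>2) \<partial>lborel)"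
proof -
  have "(\<integral>z. indicator B z * dbar_kernel (reg_param n) (z - \<zeta>) \<partial>lborel) =
    (\<integral>t. \<bar>1 / real (Suc n)\<bar> ^ DIM(complex) * (indicator B (\<zeta> + (1 / real (Suc n)) *\<^sub>R t)
       * dbar_kernel (reg_param n) (\<zeta> + (1 / real (Suc n)) *\<^sub>R t - \<zeta>)) \<partial>lborel)"
    by (rule integral_lborel_rescale) auto
  also have "(\<lambda>t. \<bar>1 / real (Suc n)\<bar> ^ DIM(complex) * (indicator B (\<zeta> + (1 / real (Suc n)) *\<^sub>R t)
       * dbar_kernel (reg_param n) (\<zeta> + (1 / real (Suc n)) *\<^sub>R t - \<zeta>))) =
     (\<lambda>t. indicator B (\<zeta> + (1 / real (Suc n)) *\<^sub>R t) * (1 / ((cmod t)\<^sup>2 + 1)\<^sup>2))"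
  proof
    fix t :: complex
    define N where "N = real (Suc n)"
    have N: "N > 0" by (simp add: N_def)
    have "(1 / N)\<^sup>2 * ((1 / N\<^sup>2) / ((cmod t / N)\<^sup>2 + 1 / N\<^sup>2)\<^sup>2) = 1 / ((cmod t)\<^sup>2 + 1)\<^sup>2"
    proof -
      have "(cmod t / N)\<^sup>2 + 1 / N\<^sup>2 = ((cmod t)\<^sup>2 + 1) / N\<^sup>2"
        by (simp add: power_divide add_divide_distrib)
      then show ?thesis using N by (simp add: power_divide power2_eq_square)
    qed
    then show "\<bar>1 / real (Suc n)\<bar> ^ DIM(complex) * (indicator B (\<zeta> + (1 / real (Suc n)) *\<^sub>R t)
       * dbar_kernel (reg_param n) (\<zeta> + (1 / real (Suc n)) *\<^sub>R t - \<zeta>)) =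
       indicator B (\<zeta> + (1 / real (Suc n)) *\<^sub>R t) * (1 / ((cmod t)\<^sup>2 + 1)\<^sup>2)"
      unfolding dbar_kernel_def reg_param_def N_def[symmetric]
      using N by (simp add: indicator_def norm_divide)
  qed
  finally show ?thesis .
qed

text \<open>Off the frontier the indicator of \<open>B\<close> is constant near \<zeta>, so the
  rescaled integrands converge pointwise, dominated by the fixed density.\<close>

lemma dbar_kernel_approximate_identity:
  assumes [measurable]: "B \<in> sets borel" and \<zeta>: "\<zeta> \<notin> frontier B"
  shows "(\<lambda>n. \<integral>z. indicator B z * dbar_kernel (reg_param n) (z - \<zeta>) \<partial>lborel) \<longlonglongrightarrow> dbar_mass * indicator B \<zeta>"
proof -
  have "(\<lambda>n. \<integral>t. indicator B (\<zeta> + (1 / real (Suc n)) *\<^sub>R t) * (1 / ((cmod t)\<^sup>2 + 1)\<^sup>2) \<partial>lborel)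
      \<longlonglongrightarrow> (\<integral>t. indicator B \<zeta> * (1 / ((cmod t)\<^sup>2 + 1)\<^sup>2) \<partial>lborel)"
  proof (rule integral_dominated_convergence[OF _ _ integrable_dbar_mass_density])
    show "AE t in lborel. (\<lambda>n. indicator B (\<zeta> + (1 / real (Suc n)) *\<^sub>R t) * (1 / ((cmod t)\<^sup>2 + 1)\<^sup>2))
        \<longlonglongrightarrow> indicator B \<zeta> * (1 / ((cmod t)\<^sup>2 + 1)\<^sup>2)"
    proof (rule AE_I2)
      fix t :: complex
      have "(\<lambda>n. 1 / real (Suc n)) \<longlonglongrightarrow> 0"
        using LIMSEQ_inverse_real_of_nat by (simp add: inverse_eq_divide)
      then have "(\<lambda>n. \<zeta> + (1 / real (Suc n)) *\<^sub>R t) \<longlonglongrightarrow> \<zeta> + 0 *\<^sub>R t"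
        by (intro tendsto_add tendsto_const tendsto_scaleR)
      then have lim: "(\<lambda>n. \<zeta> + (1 / real (Suc n)) *\<^sub>R t) \<longlonglongrightarrow> \<zeta>" by simp
      have "\<zeta> \<in> interior B \<or> \<zeta> \<in> - closure B" using \<zeta> by (auto simp: frontier_def)
      then have "\<forall>\<^sub>F n in sequentially. indicator B \<zeta> = (indicator B (\<zeta> + (1 / real (Suc n)) *\<^sub>R t) :: real)"
      proof
        assume i: "\<zeta> \<in> interior B"
        have "\<forall>\<^sub>F n in sequentially. \<zeta> + (1 / real (Suc n)) *\<^sub>R t \<in> interior B"
          by (rule topological_tendstoD[OF lim open_interior i])
        then show ?thesis using i interior_subset[of B]
          by (auto elim!: eventually_mono simp: indicator_def)
      next
        assume i: "\<zeta> \<in> - closure B"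
        have "\<forall>\<^sub>F n in sequentially. \<zeta> + (1 / real (Suc n)) *\<^sub>R t \<in> - closure B"
          by (rule topological_tendstoD[OF lim open_Compl[OF closed_closure] i])
        then show ?thesis using i closure_subset[of B]
          by (auto elim!: eventually_mono simp: indicator_def)
      qed
      then have "(\<lambda>n. indicator B (\<zeta> + (1 / real (Suc n)) *\<^sub>R t) :: real) \<longlonglongrightarrow> indicator B \<zeta>"
        by (rule Lim_transform_eventually[OF tendsto_const])
      then show "(\<lambda>n. indicator B (\<zeta> + (1 / real (Suc n)) *\<^sub>R t) * (1 / ((cmod t)\<^sup>2 + 1)\<^sup>2))
        \<longlonglongrightarrow> indicator B \<zeta> * (1 / ((cmod t)\<^sup>2 + 1)\<^sup>2)"
        by (rule tendsto_mult_right)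
    qed
    show "AE t in lborel. norm (indicator B (\<zeta> + (1 / real (Suc n)) *\<^sub>R t) * (1 / ((cmod t)\<^sup>2 + 1)\<^sup>2))
        \<le> 1 / ((cmod t)\<^sup>2 + 1)\<^sup>2" for n
      by (intro AE_I2) (auto simp: indicator_def)
  qed measurable
  then show ?thesis
    unfolding integral_box_dbar_kernel[OF assms(1)] dbar_mass_def integral_mult_right_zero
    by (simp only: mult.commute)
qed

lemma integral_box_dbar_kernel_bounds:
  assumes [measurable]: "B \<in> sets borel"
  shows "\<bar>\<integral>z. indicator B z * dbar_kernel (reg_param n) (z - \<zeta>) \<partial>lborel\<bar> \<le> dbar_mass"
proof -
  have "norm (\<integral>t. indicator B (\<zeta> + (1 / real (Suc n)) *\<^sub>R t) * (1 / ((cmod t)\<^sup>2 + 1)\<^sup>2) \<partial>lborel) \<le> dbar_mass"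
    unfolding dbar_mass_def
  proof (rule norm_integral_le_integral[OF _ integrable_dbar_mass_density])
    show le: "norm (indicator B (\<zeta> + (1 / real (Suc n)) *\<^sub>R t) * (1 / ((cmod t)\<^sup>2 + 1)\<^sup>2))
        \<le> 1 / ((cmod t)\<^sup>2 + 1)\<^sup>2" for t
      by (auto simp: indicator_def)
    show "integrable lborel (\<lambda>t. indicator B (\<zeta> + (1 / real (Suc n)) *\<^sub>R t) * (1 / ((cmod t)\<^sup>2 + 1)\<^sup>2) :: real)"
      by (rule Bochner_Integration.integrable_bound[OF integrable_dbar_mass_density])
        (use le in \<open>auto intro!: AE_I2 simp: indicator_def\<close>)
  qed
  then show ?thesis unfolding integral_box_dbar_kernel[OF assms(1)] by simp
qed

text \<open>Fubini moves the kernel from \<open>a\<close>, which is merely integrable, onto the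
  indicator of the box, where pointwise convergence holds off the frontier. That frontier is a null
  set and the masses are bounded, so dominated convergence applies.\<close>

lemma integral_box_dbar_convolution:
  assumes a: "integrable lborel a"
  shows "(\<lambda>n. \<integral>z. indicator (cbox l u) z *\<^sub>R (\<integral>\<zeta>. dbar_kernel (reg_param n) (z - \<zeta>) *\<^sub>R a \<zeta> \<partial>lborel) \<partial>lborel)
    \<longlonglongrightarrow> dbar_mass *\<^sub>R (\<integral>\<zeta>. indicator (cbox l u) \<zeta> *\<^sub>R (a \<zeta> :: complex) \<partial>lborel)"
proof -
  let ?B = "cbox l u"
  have [measurable]: "a \<in> borel_measurable borel" using a by (simp add: borel_measurable_integrable)
  have B [measurable]: "?B \<in> sets borel" by simp
  have Bi: "integrable lborel (indicator ?B :: complex \<Rightarrow> real)"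
    using emeasure_bounded_finite[OF bounded_cbox, of l u] by (intro integrable_real_indicator) auto
  define W where "W n \<zeta> = (\<integral>z. indicator ?B z * dbar_kernel (reg_param n) (z - \<zeta>) \<partial>lborel)" for n \<zeta>
  have fub: "(\<integral>z. indicator ?B z *\<^sub>R (\<integral>\<zeta>. dbar_kernel (reg_param n) (z - \<zeta>) *\<^sub>R a \<zeta> \<partial>lborel) \<partial>lborel)
      = (\<integral>\<zeta>. W n \<zeta> *\<^sub>R a \<zeta> \<partial>lborel)" for n
  proof -
    define C where "C = 1 / reg_param n"
    let ?P = "dbar_kernel (reg_param n)"
    have P: "0 \<le> ?P t" "?P t \<le> C" for t
      using dbar_kernel_nonneg dbar_kernel_le reg_param_pos by (auto simp: C_def)
    have C: "C \<ge> 0" using P order_trans by blast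
    define f where "f z \<zeta> = indicator ?B z *\<^sub>R (?P (z - \<zeta>) *\<^sub>R a \<zeta>)" for z \<zeta>
    have fi: "integrable lborel (f z)" for z
    proof (rule Bochner_Integration.integrable_bound)
      show "integrable lborel (\<lambda>\<zeta>. C * cmod (a \<zeta>))" using a by simp
      show "AE \<zeta> in lborel. norm (f z \<zeta>) \<le> norm (C * cmod (a \<zeta>))"
        using P C by (intro AE_I2) (auto simp: f_def indicator_def intro: mult_right_mono)
      show "f z \<in> borel_measurable lborel" unfolding f_def[abs_def] by measurable
    qed
    have m: "case_prod f \<in> borel_measurable (lborel \<Otimes>\<^sub>M lborel)"
      unfolding f_def[abs_def] by measurable
    \<comment> \<open>For fixed \<open>n\<close> the kernel is bounded and the box has finite
      measure, so the double integrand is dominated by a product of integrable functions.\<close>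
    have "integrable (lborel \<Otimes>\<^sub>M lborel) (case_prod f)"
    proof (rule lborel_pair.Fubini_integrable[OF m])
      show "integrable lborel (\<lambda>x. \<integral>y. norm (case_prod f (x, y)) \<partial>lborel)"
      proof (rule Bochner_Integration.integrable_bound)
        show "integrable lborel (\<lambda>z. indicator ?B z * (\<integral>\<zeta>. C * cmod (a \<zeta>) \<partial>lborel))"
          using Bi by (rule integrable_mult_left)
        show "(\<lambda>x. \<integral>y. norm (case_prod f (x, y)) \<partial>lborel) \<in> borel_measurable lborel"
          using m by measurable
        show "AE z in lborel. norm (\<integral>y. norm (case_prod f (z, y)) \<partial>lborel)
            \<le> norm (indicator ?B z * (\<integral>\<zeta>. C * cmod (a \<zeta>) \<partial>lborel))"
        proof (rule AE_I2)
          fix z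
          have "(\<integral>y. norm (f z y) \<partial>lborel) \<le> (\<integral>\<zeta>. indicator ?B z * (C * cmod (a \<zeta>)) \<partial>lborel)"
          proof (rule integral_mono)
            show "integrable lborel (\<lambda>y. norm (f z y))" using fi by simp
            show "integrable lborel (\<lambda>\<zeta>. indicator ?B z * (C * cmod (a \<zeta>)) :: real)" using a by simp
            show "norm (f z \<zeta>) \<le> indicator ?B z * (C * cmod (a \<zeta>))" for \<zeta>
              using P C by (auto simp: f_def indicator_def intro: mult_right_mono)
          qed
          then show "norm (\<integral>y. norm (case_prod f (z, y)) \<partial>lborel)
            \<le> norm (indicator ?B z * (\<integral>\<zeta>. C * cmod (a \<zeta>) \<partial>lborel))"
            by simp
        qed
      qed
      show "AE x in lborel. integrable lborel (\<lambda>y. case_prod f (x, y))" using fi by simp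
    qed
    then have "(\<integral>\<zeta>. (\<integral>z. f z \<zeta> \<partial>lborel) \<partial>lborel) = (\<integral>z. (\<integral>\<zeta>. f z \<zeta> \<partial>lborel) \<partial>lborel)"
      by (rule lborel_pair.Fubini_integral)
    moreover have "(\<integral>\<zeta>. f z \<zeta> \<partial>lborel) = indicator ?B z *\<^sub>R (\<integral>\<zeta>. ?P (z - \<zeta>) *\<^sub>R a \<zeta> \<partial>lborel)" for z
      unfolding f_def by (rule integral_scaleR_right)
    moreover have "(\<integral>z. f z \<zeta> \<partial>lborel) = W n \<zeta> *\<^sub>R a \<zeta>" for \<zeta>
    proof -
      have "integrable lborel (\<lambda>z. indicator ?B z * ?P (z - \<zeta>))"
      proof (rule Bochner_Integration.integrable_bound[OF integrable_mult_right[OF Bi, of C]])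
        show "AE z in lborel. norm (indicator ?B z * ?P (z - \<zeta>)) \<le> norm (C * indicator ?B z)"
          using P C by (intro AE_I2) (auto simp: indicator_def)
      qed measurable
      then show ?thesis unfolding f_def W_def scaleR_scaleR by (intro integral_scaleR_left)
    qed
    ultimately show ?thesis by (simp only:)
  qed
  have "(\<lambda>n. \<integral>\<zeta>. W n \<zeta> *\<^sub>R a \<zeta> \<partial>lborel) \<longlonglongrightarrow> (\<integral>\<zeta>. (dbar_mass * indicator ?B \<zeta>) *\<^sub>R a \<zeta> \<partial>lborel)"
  proof (rule integral_dominated_convergence[where w="\<lambda>\<zeta>. dbar_mass * cmod (a \<zeta>)"])
    show "integrable lborel (\<lambda>\<zeta>. dbar_mass * cmod (a \<zeta>))" using a by simp
    have "frontier ?B \<in> null_sets lborel"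
      using negligible_convex_frontier[OF convex_box(1), of l u]
      by (simp add: negligible_iff_null_sets null_sets_completion_iff)
    then have "AE \<zeta> in lborel. \<zeta> \<notin> frontier ?B" by (rule AE_not_in)
    then show "AE \<zeta> in lborel. (\<lambda>n. W n \<zeta> *\<^sub>R a \<zeta>) \<longlonglongrightarrow> (dbar_mass * indicator ?B \<zeta>) *\<^sub>R a \<zeta>"
    proof eventually_elim
      case (elim \<zeta>)
      show ?case unfolding W_def
        by (rule tendsto_scaleR[OF dbar_kernel_approximate_identity[OF B elim] tendsto_const])
    qed
    show "AE \<zeta> in lborel. norm (W n \<zeta> *\<^sub>R a \<zeta>) \<le> dbar_mass * cmod (a \<zeta>)" for n
      unfolding W_def norm_scaleR
      by (intro AE_I2 mult_right_mono integral_box_dbar_kernel_bounds B norm_ge_zero)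
    show "(\<lambda>\<zeta>. W n \<zeta> *\<^sub>R a \<zeta>) \<in> borel_measurable lborel" for n
      unfolding W_def by measurable
  qed measurable
  then show ?thesis unfolding fub scaleR_scaleR[symmetric] integral_scaleR_right .
qed

text \<open>\<open>a\<close> is determined only up to null sets, so the sides are compared through
  integrals over boxes: uniform convergence treats the left one, the approximate identity the right
  one. Lebesgue differentiation along shrinking squares then gives equality almost
  everywhere.\<close>

lemma cauchy_transform_dbar:
  assumes a: "integrable lborel a"
    and Xc: "\<And>d. d \<in> {1, \<i>} \<Longrightarrow> continuous_on (ball 0 1) (X d)"
    and ul: "\<And>d r. d \<in> {1, \<i>} \<Longrightarrow> 0 < r \<Longrightarrow> r < 1 \<Longrightarrow>
       uniform_limit (cball 0 r) (\<lambda>n z. \<integral>\<zeta>. cauchy_reg' (reg_param n) (z - \<zeta>) d * a \<zeta> \<partial>lborel) (X d) sequentially"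
  shows "AE z in lborel. z \<in> ball 0 1 \<longrightarrow> X 1 z + \<i> * X \<i> z = (2 * dbar_mass) *\<^sub>R a z"
proof -
  define U where "U d n z = (\<integral>\<zeta>. cauchy_reg' (reg_param n) (z - \<zeta>) d * a \<zeta> \<partial>lborel)" for d n z
  define S where "S n z = U 1 n z + \<i> * U \<i> n z" for n z
  define G where "G z = X 1 z + \<i> * X \<i> z" for z
  have [measurable]: "a \<in> borel_measurable borel" using a by (simp add: borel_measurable_integrable)
  have ai: "integrable lborel (\<lambda>x. indicator K x *\<^sub>R a x)" if "K \<in> sets borel" for K
    using integrable_mult_indicator[of K lborel a] a that by simp
  have Uc: "continuous_on UNIV (U d n)" for d n
    unfolding U_def[abs_def]
    by (rule continuous_on_convolution[OF a continuous_on_cauchy_reg'[OF reg_param_pos continuous_on_id]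
          norm_cauchy_reg'_le[OF reg_param_pos]])
  have Sc: "continuous_on UNIV (S n)" for n
    unfolding S_def[abs_def] by (intro continuous_intros Uc)
  have Gc: "continuous_on (ball 0 1) G"
    unfolding G_def[abs_def] using Xc by (intro continuous_intros) auto
  have S_eq: "S n z = 2 *\<^sub>R (\<integral>\<zeta>. dbar_kernel (reg_param n) (z - \<zeta>) *\<^sub>R a \<zeta> \<partial>lborel)" for n z
  proof -
    have i: "integrable lborel (\<lambda>\<zeta>. cauchy_reg' (reg_param n) (z - \<zeta>) d * a \<zeta>)" for d
      by (rule integrable_bounded_mult[OF a _ norm_cauchy_reg'_le[OF reg_param_pos]]) measurable
    have "S n z = (\<integral>\<zeta>. cauchy_reg' (reg_param n) (z - \<zeta>) 1 * a \<zeta>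
        + \<i> * (cauchy_reg' (reg_param n) (z - \<zeta>) \<i> * a \<zeta>) \<partial>lborel)"
      unfolding S_def U_def integral_mult_right_zero[symmetric]
      by (rule Bochner_Integration.integral_add[symmetric, OF i integrable_mult_right[OF i]])
    also have "(\<lambda>\<zeta>. cauchy_reg' (reg_param n) (z - \<zeta>) 1 * a \<zeta> + \<i> * (cauchy_reg' (reg_param n) (z - \<zeta>) \<i> * a \<zeta>))
        = (\<lambda>\<zeta>. 2 *\<^sub>R (dbar_kernel (reg_param n) (z - \<zeta>) *\<^sub>R a \<zeta>))"
      unfolding mult.assoc[symmetric] distrib_right[symmetric] cauchy_reg'_dbar
      by (simp add: scaleR_conv_of_real mult.assoc)
    finally show ?thesis by (simp only: integral_scaleR_right)
  qed
  have box: "integral (cbox l u) G = (2 * dbar_mass) *\<^sub>R integral (cbox l u) a"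
    if sub: "cbox l u \<subseteq> cball 0 r" and r: "0 < r" "r < 1" for l u r
  proof -
    have "uniform_limit (cbox l u) S G sequentially"
      unfolding S_def[abs_def] G_def[abs_def] U_def[abs_def]
      by (rule uniform_limit_on_subset[OF _ sub])
        (intro uniform_limit_add ul r bounded_linear.uniform_limit[OF bounded_linear_mult_right]; simp)
    then obtain I J where IJ: "\<And>n. (S n has_integral I n) (cbox l u)" "(G has_integral J) (cbox l u)" "I \<longlonglongrightarrow> J"
      by (rule uniform_limit_integral_cbox) (auto intro: continuous_on_subset[OF Sc])
    have "I n = 2 *\<^sub>R (\<integral>z. indicator (cbox l u) z *\<^sub>R (\<integral>\<zeta>. dbar_kernel (reg_param n) (z - \<zeta>) *\<^sub>R a \<zeta> \<partial>lborel) \<partial>lborel)" for n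
    proof -
      have "set_integrable lborel (cbox l u) (S n)"
        unfolding set_integrable_def
        by (rule borel_integrable_compact[OF compact_cbox continuous_on_subset[OF Sc subset_UNIV]])
      then have "I n = (LINT z:cbox l u|lborel. S n z)"
        using IJ(1)[of n] by (metis integral_unique set_borel_integral_eq_integral(2))
      also have "\<dots> = (\<integral>z. 2 *\<^sub>R (indicator (cbox l u) z *\<^sub>R (\<integral>\<zeta>. dbar_kernel (reg_param n) (z - \<zeta>) *\<^sub>R a \<zeta> \<partial>lborel)) \<partial>lborel)"
        unfolding set_lebesgue_integral_def S_eq by (simp only: scaleR_left_commute)
      finally show ?thesis by (simp only: integral_scaleR_right)
    qed
    then have "I \<longlonglongrightarrow> 2 *\<^sub>R (dbar_mass *\<^sub>R (\<integral>\<zeta>. indicator (cbox l u) \<zeta> *\<^sub>R a \<zeta> \<partial>lborel))"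
      using tendsto_scaleR[OF tendsto_const integral_box_dbar_convolution[OF a, of l u], of 2] by presburger
    then have "J = 2 *\<^sub>R (dbar_mass *\<^sub>R (\<integral>\<zeta>. indicator (cbox l u) \<zeta> *\<^sub>R a \<zeta> \<partial>lborel))"
      using IJ(3) LIMSEQ_unique by blast
    moreover have "(\<integral>\<zeta>. indicator (cbox l u) \<zeta> *\<^sub>R a \<zeta> \<partial>lborel) = integral (cbox l u) a"
      using set_borel_integral_eq_integral(2)[of "cbox l u" a] ai[of "cbox l u"]
      by (simp add: set_integrable_def set_lebesgue_integral_def)
    ultimately show ?thesis using IJ(2) by (simp add: integral_unique)
  qed
  have AEr: "AE z in lborel. z \<in> ball 0 r \<longrightarrow> G z = (2 * dbar_mass) *\<^sub>R a z" if r: "0 < r" "r < 1" for r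
  proof -
    \<comment> \<open>Cutting off at radius \<open>r < 1\<close> makes the difference integrable
      over the plane; continuity of \<open>G\<close> is known only in the open disc.\<close>
    define F where "F z = indicator (cball 0 r) z *\<^sub>R G z - (2 * dbar_mass) *\<^sub>R (indicator (cball 0 r) z *\<^sub>R a z)" for z
    have Gi: "integrable lborel (\<lambda>z. indicator (cball 0 r) z *\<^sub>R G z)"
      by (rule borel_integrable_compact[OF compact_cball continuous_on_subset[OF Gc]]) (use r in auto)
    have "integrable lborel F"
      unfolding F_def[abs_def]
      by (rule Bochner_Integration.integrable_diff[OF Gi integrable_scaleR_right[OF ai]]) simp
    then have "F integrable_on UNIV" using has_integral_integral_lborel by blast
    then have "F integrable_on cbox l u" for l u by (rule integrable_on_subcbox) simp
    then obtain N where N: "negligible N" "\<And>x e. \<lbrakk>x \<notin> N; 0 < e\<rbrakk> \<Longrightarrow>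
        \<exists>d>0. \<forall>h. 0 < h \<and> h < d \<longrightarrow> norm (integral (cbox x (x + h *\<^sub>R One)) F /\<^sub>R h ^ DIM(complex) - F x) < e"
      using integrable_ccontinuous_explicit by blast
    have "F x = 0" if x: "x \<in> ball 0 r" "x \<notin> N" for x
    proof (rule ccontr)
      assume F: "F x \<noteq> 0"
      then obtain d where d: "d > 0" "\<And>h. 0 < h \<Longrightarrow> h < d \<Longrightarrow>
          norm (integral (cbox x (x + h *\<^sub>R One)) F /\<^sub>R h ^ DIM(complex) - F x) < norm (F x)"
        using N(2)[OF x(2), of "norm (F x)"] by auto
      \<comment> \<open>The first bound keeps \<open>h\<close> in the range of the differentiation
        estimate; the second keeps the square of side \<open>h\<close>, whose points lie within
        \<open>2 * h\<close> of \<open>x\<close>, inside the disc.\<close>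
      define h where "h = min (d / 2) ((r - cmod x) / 2)"
      have h: "0 < h" "h < d" "2 * h \<le> r - cmod x" using d(1) x(1) by (auto simp: h_def min_def)
      have sub: "cbox x (x + h *\<^sub>R One) \<subseteq> cball 0 r"
      proof
        fix y assume "y \<in> cbox x (x + h *\<^sub>R One)"
        then have "Re x \<le> Re y" "Re y \<le> Re x + h" "Im x \<le> Im y" "Im y \<le> Im x + h"
          by (simp_all add: in_cbox_complex_iff Basis_complex_def)
        then have "cmod (y - x) \<le> 2 * h"
          using cmod_le[of "y - x"] by simp
        then have "cmod y \<le> r" using h norm_triangle_sub[of y x] by simp
        then show "y \<in> cball 0 r" by simp
      qed
      have "integral (cbox x (x + h *\<^sub>R One)) F = integral (cbox x (x + h *\<^sub>R One)) (\<lambda>z. G z - (2 * dbar_mass) *\<^sub>R a z)"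
        by (rule integral_cong) (use sub in \<open>auto simp: F_def\<close>)
      also have "\<dots> = integral (cbox x (x + h *\<^sub>R One)) G - integral (cbox x (x + h *\<^sub>R One)) (\<lambda>z. (2 * dbar_mass) *\<^sub>R a z)"
      proof (rule Henstock_Kurzweil_Integration.integral_diff)
        show "G integrable_on cbox x (x + h *\<^sub>R One)"
          by (rule integrable_continuous[OF continuous_on_subset[OF Gc]]) (use sub r in auto)
        have "a integrable_on UNIV" using has_integral_integral_lborel[OF a] by blast
        then show "(\<lambda>z. (2 * dbar_mass) *\<^sub>R a z) integrable_on cbox x (x + h *\<^sub>R One)"
          by (intro integrable_cmul integrable_on_subcbox[of a UNIV]) auto
      qed
      also have "\<dots> = 0" using box[OF sub r] by simp
      finally show False using d(2)[OF h(1,2)] by simp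
    qed
    moreover have "AE x in lebesgue. x \<notin> N"
      using N(1) by (simp add: negligible_iff_null_sets AE_not_in)
    ultimately have "AE x in lebesgue. x \<in> ball 0 r \<longrightarrow> F x = 0"
      by (auto elim!: eventually_mono)
    then have "AE x in lebesgue. x \<in> ball 0 r \<longrightarrow> G x = (2 * dbar_mass) *\<^sub>R a x"
      by eventually_elim (auto simp: F_def)
    then show ?thesis
      by (subst (asm) AE_completion_iff) simp_all
  qed
  \<comment> \<open>Countably many smaller discs exhaust the unit disc; \<open>n + 2\<close> in
    place of \<open>n + 1\<close> keeps the first radius positive.\<close>
  have "AE z in lborel. \<forall>n::nat. z \<in> ball 0 (1 - 1 / (real n + 2)) \<longrightarrow> G z = (2 * dbar_mass) *\<^sub>R a z"
    by (subst AE_all_countable, intro allI AEr) (simp_all add: field_simps)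
  then show ?thesis
  proof eventually_elim
    case (elim z)
    show ?case
    proof
      assume "z \<in> ball 0 1"
      then have "1 - cmod z > 0" by simp
      then obtain n where "inverse (real (Suc n)) < 1 - cmod z" using reals_Archimedean by blast
      moreover have "1 / (real n + 2) \<le> inverse (real (Suc n))" by (simp add: field_simps)
      ultimately have "z \<in> ball 0 (1 - 1 / (real n + 2))" by simp
      then show "X 1 z + \<i> * X \<i> z = (2 * dbar_mass) *\<^sub>R a z" using elim unfolding G_def by blast
    qed
  qed
qed

section \<open>The minus component\<close>

lemma bounded_linear_bc_minus: "bounded_linear bc_minus"
  by (rule linear_conv_bounded_linear[THEN iffD1], rule linearI)
    (simp_all add: bc_minus_def plus_bicomplex_def scaleR_bicomplex_def algebra_simps)

text \<open>\<open>u\<close> times the idempotent \<open>(1 - \<i> j) / 2\<close>: the bicomplex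
  number with \<open>w\<^sup>+ = 0\<close> and \<open>w\<^sup>- = u\<close>.\<close>

definition minus_embed :: "complex \<Rightarrow> bicomplex" where
  "minus_embed u = Bicomplex (u / 2) (- \<i> * u / 2)"

lemma bc_minus_embed: "bc_minus (minus_embed u) = u"
  by (simp add: bc_minus_def minus_embed_def algebra_simps)

text \<open>The embedded numbers form an ideal on which a bicomplex factor acts through its minus
  component alone. In particular \<open>j\<close> acts as \<open>\<i>\<close>, so
  \<open>dbar\<close> becomes the scalar derivative by \<open>cnj z\<close>.\<close>

lemma mult_minus_embed: "x * minus_embed u = minus_embed (bc_minus x * u)"
  by (simp add: bc_minus_def minus_embed_def times_bicomplex_def algebra_simps add_divide_distrib)

lemma bc_j_mult_minus_embed: "bc_j * minus_embed u = minus_embed (\<i> * u)"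
  unfolding mult_minus_embed by (simp add: bc_minus_def bc_j_def)

lemma bounded_linear_minus_embed: "bounded_linear minus_embed"
  by (rule linear_conv_bounded_linear[THEN iffD1], rule linearI)
    (simp_all add: minus_embed_def plus_bicomplex_def scaleR_bicomplex_def add_divide_distrib
      diff_divide_distrib complex_eq_iff algebra_simps)

lemma norm_bc_minus_le: "cmod (bc_minus w) \<le> sqrt 2 * norm w"
proof -
  have "sqrt 2 * norm w = sqrt ((cmod (bc_plus w))\<^sup>2 + (cmod (bc_minus w))\<^sup>2)"
    unfolding norm_bicomplex_def by (simp flip: real_sqrt_mult)
  moreover have "cmod (bc_minus w) \<le> sqrt ((cmod (bc_plus w))\<^sup>2 + (cmod (bc_minus w))\<^sup>2)"
    by (rule real_le_rsqrt) simp
  ultimately show ?thesis by simp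
qed

lemma L_space_set_integrable:
  assumes g: "g \<in> L_space q (ball 0 1)" and q: "q > 1"
  shows "integrable lebesgue (\<lambda>z. indicator (ball 0 1) z *\<^sub>R g z)"
proof (rule Bochner_Integration.integrable_bound)
  have "integrable lebesgue (\<lambda>z. indicator (ball 0 1) z *\<^sub>R norm (g z) powr q)"
    using g by (simp add: L_space_def set_integrable_def)
  moreover have "integrable lebesgue (indicator (ball 0 1) :: complex \<Rightarrow> real)"
    using integrable_indicator_ball by (subst integrable_completion) simp_all
  ultimately show "integrable lebesgue (\<lambda>z. indicator (ball 0 1) z *\<^sub>R norm (g z) powr q + indicator (ball (0::complex) 1) z)"
    by (rule Bochner_Integration.integrable_add)
  show "(\<lambda>z. indicator (ball 0 1) z *\<^sub>R g z) \<in> borel_measurable lebesgue"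
    using g by (simp add: L_space_def set_borel_measurable_def)
  have "x \<le> x powr q + 1" if "x \<ge> 0" for x :: real
    using mult_le_powr_add_powr[of x 1 q] that q by simp
  then show "AE z in lebesgue. norm (indicator (ball 0 1) z *\<^sub>R g z)
      \<le> norm (indicator (ball 0 1) z *\<^sub>R norm (g z) powr q + indicator (ball (0::complex) 1) z)"
    by (intro AE_I2) (auto simp: indicator_def)
qed

text \<open>Passes from Lebesgue to Borel measurability by a change on a null set, made separately
  for real and imaginary part; the factor \<open>sqrt 2\<close> in \<open>norm_bc_minus_le\<close>
  only affects the size of the \<open>L\<^sup>q\<close> integral.\<close>

lemma L_space_minus_component:
  assumes g: "g \<in> L_space q (ball 0 1)" and q: "q > 1"
  obtains h where "Lq_disc q h"
    "AE z in lebesgue. h z = bc_minus (indicator (ball 0 1) z *\<^sub>R g z)"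
proof -
  define f where "f z = bc_minus (indicator (ball 0 1) z *\<^sub>R g z)" for z
  have "continuous_on UNIV bc_minus"
    by (rule linear_continuous_on[OF bounded_linear_bc_minus])
  then have f [measurable]: "f \<in> borel_measurable lebesgue"
    unfolding f_def[abs_def]
    by (rule borel_measurable_continuous_on)
      (use g in \<open>simp add: L_space_def set_borel_measurable_def\<close>)
  obtain r where r [measurable]: "r \<in> borel_measurable lborel" "AE z in lborel. Re (f z) = r z"
    using completion_ex_borel_measurable_real[of "\<lambda>z. Re (f z)" lborel] by auto
  obtain s where s [measurable]: "s \<in> borel_measurable lborel" "AE z in lborel. Im (f z) = s z"
    using completion_ex_borel_measurable_real[of "\<lambda>z. Im (f z)" lborel] by auto
  \<comment> \<open>The Borel representatives may be nonzero on a null set outside the disc; the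
    indicator restores exact vanishing there.\<close>
  define h where "h z = indicator (ball 0 1) z *\<^sub>R Complex (r z) (s z)" for z
  have "AE z in lborel. h z = f z"
    using r(2) s(2)
  proof eventually_elim
    case (elim z)
    then have "Complex (r z) (s z) = f z" by (simp add: complex_eq_iff)
    then show ?case
      by (auto simp: h_def f_def indicator_def linear_0[OF bounded_linear.linear[OF bounded_linear_bc_minus]])
  qed
  then have ae: "AE z in lebesgue. h z = f z" by (rule AE_completion)
  have "h = (\<lambda>z. indicator (ball 0 1) z *\<^sub>R (of_real (r z) + \<i> * of_real (s z)))"
    by (simp add: h_def fun_eq_iff Complex_eq)
  then have h [measurable]: "h \<in> borel_measurable borel" by simp
  have "integrable lebesgue (\<lambda>z. cmod (h z) powr q)"
  proof (rule Bochner_Integration.integrable_bound)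
    show "integrable lebesgue (\<lambda>z. sqrt 2 powr q * (indicator (ball 0 1) z *\<^sub>R norm (g z) powr q))"
      using g by (simp add: L_space_def set_integrable_def)
    show "(\<lambda>z. cmod (h z) powr q) \<in> borel_measurable lebesgue"
      by (rule measurable_completion) simp
    show "AE z in lebesgue. norm (cmod (h z) powr q) \<le> norm (sqrt 2 powr q * (indicator (ball 0 1) z *\<^sub>R norm (g z) powr q))"
      using ae
    proof eventually_elim
      case (elim z)
      have "cmod (f z) powr q \<le> (sqrt 2 * norm (indicator (ball 0 1) z *\<^sub>R g z)) powr q"
        unfolding f_def using q by (intro powr_mono2 norm_bc_minus_le) auto
      also have "\<dots> = sqrt 2 powr q * (indicator (ball 0 1) z *\<^sub>R norm (g z) powr q)"
        by (simp add: powr_mult indicator_def)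
      finally show ?case by (simp add: elim)
    qed
  qed
  then have "integrable lborel (\<lambda>z. cmod (h z) powr q)"
    by (subst (asm) integrable_completion) simp_all
  then have "Lq_disc q h" using h by (auto simp: Lq_disc_def h_def)
  then show ?thesis using that ae unfolding f_def by blast
qed

text \<open>\<open>bc_minus\<close> is bounded and linear, so it commutes with both integrals;
  passing to representatives and from \<open>lebesgue\<close> to \<open>lborel\<close> changes no
  integral.\<close>

lemma has_weak_deriv_minus_component:
  assumes w: "has_weak_deriv (ball 0 1) d f g" and d: "d \<in> {1, \<i>}"
    and fg: "integrable lebesgue (\<lambda>z. indicator (ball 0 1) z *\<^sub>R f z)"
      "integrable lebesgue (\<lambda>z. indicator (ball 0 1) z *\<^sub>R g z)"
    and a: "a \<in> borel_measurable borel" "AE z in lebesgue. a z = bc_minus (indicator (ball 0 1) z *\<^sub>R f z)"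
    and b: "b \<in> borel_measurable borel" "AE z in lebesgue. b z = bc_minus (indicator (ball 0 1) z *\<^sub>R g z)"
  shows "weak_deriv_disc d a b"
  unfolding weak_deriv_disc_def
proof (intro allI impI)
  fix \<phi> assume \<phi>: "test_function (ball 0 1) \<phi>"
  obtain K where K: "compact K" "K \<subseteq> ball 0 1" "\<And>z. z \<notin> K \<Longrightarrow> \<phi> z = 0"
    "\<And>z e. z \<notin> K \<Longrightarrow> frechet_derivative \<phi> (at z) e = 0"
    using test_function_support[OF \<phi>] by blast
  have transfer: "(\<integral>z. \<psi> z *\<^sub>R c z \<partial>lborel) = bc_minus (LINT z:ball 0 1|lebesgue. \<psi> z *\<^sub>R k z)"
    if \<psi>: "continuous_on UNIV \<psi>" "\<And>z. z \<notin> K \<Longrightarrow> \<psi> z = 0"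
      and k: "integrable lebesgue (\<lambda>z. indicator (ball 0 1) z *\<^sub>R k z)"
      and c: "c \<in> borel_measurable borel" "AE z in lebesgue. c z = bc_minus (indicator (ball 0 1) z *\<^sub>R k z)"
    for \<psi> c and k :: "complex \<Rightarrow> bicomplex"
  proof -
    have [measurable]: "\<psi> \<in> borel_measurable borel" "c \<in> borel_measurable borel"
      using borel_measurable_continuous_onI[OF \<psi>(1)] c(1) by auto
    have i: "integrable lebesgue (\<lambda>z. \<psi> z *\<^sub>R (indicator (ball 0 1) z *\<^sub>R k z))"
      by (rule integrable_scaleR_compact_support[OF k _ \<psi>(1) K(1) \<psi>(2)]) (rule measurable_completion, simp)
    have "(\<integral>z. \<psi> z *\<^sub>R c z \<partial>lborel) = (\<integral>z. \<psi> z *\<^sub>R c z \<partial>lebesgue)"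
      by (rule integral_completion[symmetric]) simp
    also have "\<dots> = (\<integral>z. bc_minus (\<psi> z *\<^sub>R (indicator (ball 0 1) z *\<^sub>R k z)) \<partial>lebesgue)"
    proof (rule integral_cong_AE)
      show "(\<lambda>z. \<psi> z *\<^sub>R c z) \<in> borel_measurable lebesgue"
        by (rule measurable_completion) simp
      show "(\<lambda>z. bc_minus (\<psi> z *\<^sub>R (indicator (ball 0 1) z *\<^sub>R k z))) \<in> borel_measurable lebesgue"
        by (rule borel_measurable_integrable, rule integrable_bounded_linear[OF bounded_linear_bc_minus i])
      show "AE z in lebesgue. \<psi> z *\<^sub>R c z = bc_minus (\<psi> z *\<^sub>R (indicator (ball 0 1) z *\<^sub>R k z))"
        using c(2) by eventually_elim
          (simp only: linear_cmul[OF bounded_linear.linear[OF bounded_linear_bc_minus]])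
    qed
    also have "\<dots> = bc_minus (\<integral>z. \<psi> z *\<^sub>R (indicator (ball 0 1) z *\<^sub>R k z) \<partial>lebesgue)"
      by (rule integral_bounded_linear[OF bounded_linear_bc_minus i])
    also have "(\<integral>z. \<psi> z *\<^sub>R (indicator (ball 0 1) z *\<^sub>R k z) \<partial>lebesgue) = (LINT z:ball 0 1|lebesgue. \<psi> z *\<^sub>R k z)"
      unfolding set_lebesgue_integral_def by (simp only: scaleR_left_commute)
    finally show ?thesis .
  qed
  have "(\<integral>z. frechet_derivative \<phi> (at z) d *\<^sub>R a z \<partial>lborel)
      = bc_minus (LINT z:ball 0 1|lebesgue. frechet_derivative \<phi> (at z) d *\<^sub>R f z)"
    by (rule transfer[OF C_k_continuous[OF test_functionD(3)[OF \<phi> d]] K(4) fg(1) a])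
  also have "\<dots> = bc_minus (- (LINT z:ball 0 1|lebesgue. \<phi> z *\<^sub>R g z))"
    using w \<phi> unfolding has_weak_deriv_def by simp
  also have "\<dots> = - bc_minus (LINT z:ball 0 1|lebesgue. \<phi> z *\<^sub>R g z)"
    by (rule linear_neg[OF bounded_linear.linear[OF bounded_linear_bc_minus]])
  also have "bc_minus (LINT z:ball 0 1|lebesgue. \<phi> z *\<^sub>R g z) = (\<integral>z. \<phi> z *\<^sub>R b z \<partial>lborel)"
    by (rule transfer[OF C_k_continuous[OF test_functionD(1)[OF \<phi>]] K(3) fg(2) b, symmetric])
  finally show "(\<integral>z. frechet_derivative \<phi> (at z) d *\<^sub>R a z \<partial>lborel) = - (\<integral>z. \<phi> z *\<^sub>R b z \<partial>lborel)" .
qed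

text \<open>The Cauchy transform divided by \<open>dbar_mass\<close>. Continuity on the plane serves
  the boundary values, continuous partial derivatives in the disc serve the classical product rule,
  and the factor \<open>2\<close> cancels the \<open>1/2\<close> in \<open>dbar\<close>.\<close>

lemma W1_dbar_primitive:
  assumes q: "q > 2" and A: "A \<in> W1_space q (ball 0 1)"
  obtains \<alpha> Y where "continuous_on UNIV \<alpha>" "\<And>d. d \<in> {1, \<i>} \<Longrightarrow> continuous_on (ball 0 1) (Y d)"
    "\<And>z. z \<in> ball 0 1 \<Longrightarrow> (\<alpha> has_derivative (\<lambda>h. Re h *\<^sub>R Y 1 z + Im h *\<^sub>R Y \<i> z)) (at z)"
    "AE z in lebesgue. z \<in> ball 0 1 \<longrightarrow> Y 1 z + \<i> * Y \<i> z = 2 * bc_minus (A z)"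
proof -
  have q1: "q > 1" using q by simp
  obtain Ax Ay where L: "A \<in> L_space q (ball 0 1)" "Ax \<in> L_space q (ball 0 1)" "Ay \<in> L_space q (ball 0 1)"
    and w: "has_weak_deriv (ball 0 1) 1 A Ax" "has_weak_deriv (ball 0 1) \<i> A Ay"
    using A unfolding W1_space_def by blast
  note I = L[THEN L_space_set_integrable[OF _ q1]]
  obtain a where a: "Lq_disc q a" "AE z in lebesgue. a z = bc_minus (indicator (ball 0 1) z *\<^sub>R A z)"
    using L_space_minus_component[OF L(1) q1] by blast
  obtain ax where ax: "Lq_disc q ax" "AE z in lebesgue. ax z = bc_minus (indicator (ball 0 1) z *\<^sub>R Ax z)"
    using L_space_minus_component[OF L(2) q1] by blast
  obtain ay where ay: "Lq_disc q ay" "AE z in lebesgue. ay z = bc_minus (indicator (ball 0 1) z *\<^sub>R Ay z)"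
    using L_space_minus_component[OF L(3) q1] by blast
  have m: "a \<in> borel_measurable borel" "ax \<in> borel_measurable borel" "ay \<in> borel_measurable borel"
    using a ax ay by (simp_all add: Lq_disc_def)
  have wx: "weak_deriv_disc 1 a ax"
    by (rule has_weak_deriv_minus_component[OF w(1) _ I(1,2) m(1) a(2) m(2) ax(2)]) simp
  have wy: "weak_deriv_disc \<i> a ay"
    by (rule has_weak_deriv_minus_component[OF w(2) _ I(1,3) m(1) a(2) m(3) ay(2)]) simp
  let ?\<alpha> = "\<lambda>z. \<integral>\<zeta>. a \<zeta> / (z - \<zeta>) \<partial>lborel"
  obtain X where X: "\<And>d. d \<in> {1, \<i>} \<Longrightarrow> continuous_on (ball 0 1) (X d)"
    "\<And>z. z \<in> ball 0 1 \<Longrightarrow> (?\<alpha> has_derivative (\<lambda>h. Re h *\<^sub>R X 1 z + Im h *\<^sub>R X \<i> z)) (at z)"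
    "\<And>d r. d \<in> {1, \<i>} \<Longrightarrow> 0 < r \<Longrightarrow> r < 1 \<Longrightarrow>
       uniform_limit (cball 0 r) (\<lambda>n z. \<integral>\<zeta>. cauchy_reg' (reg_param n) (z - \<zeta>) d * a \<zeta> \<partial>lborel) (X d) sequentially"
    using cauchy_transform_C1[OF a(1) ax(1) ay(1) q wx wy] by blast
  note ai = Lq_disc_integrable[OF a(1) q1]
  have ac: "continuous_on UNIV ?\<alpha>"
    by (rule uniform_limit_theorem[OF _ uniform_limit_cauchy_reg[OF a(1) q]])
      (simp_all add: continuous_on_convolution[OF ai continuous_on_cauchy_reg[OF reg_param_pos continuous_on_id]
          norm_cauchy_reg_le[OF reg_param_pos]])
  have "AE z in lebesgue. z \<in> ball 0 1 \<longrightarrow> X 1 z + \<i> * X \<i> z = (2 * dbar_mass) *\<^sub>R a z"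
    by (rule AE_completion[OF cauchy_transform_dbar[OF ai X(1,3)]])
  then have dbar: "AE z in lebesgue. z \<in> ball 0 1 \<longrightarrow>
      inverse dbar_mass *\<^sub>R X 1 z + \<i> * (inverse dbar_mass *\<^sub>R X \<i> z) = 2 * bc_minus (A z)"
    using a(2)
  proof eventually_elim
    case (elim z)
    have "inverse dbar_mass *\<^sub>R X 1 z + \<i> * (inverse dbar_mass *\<^sub>R X \<i> z)
        = inverse dbar_mass *\<^sub>R (X 1 z + \<i> * X \<i> z)"
      by (simp add: scaleR_add_right)
    with elim dbar_mass_pos show ?case by (auto simp: scaleR_conv_of_real)
  qed
  show ?thesis
  proof (rule that[OF _ _ _ dbar])
    show "continuous_on UNIV (\<lambda>z. inverse dbar_mass *\<^sub>R ?\<alpha> z)"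
      by (intro continuous_on_scaleR continuous_on_const ac)
    show "continuous_on (ball 0 1) (\<lambda>z. inverse dbar_mass *\<^sub>R X d z)" if "d \<in> {1, \<i>}" for d
      by (intro continuous_on_scaleR continuous_on_const X(1) that)
    show "((\<lambda>z. inverse dbar_mass *\<^sub>R ?\<alpha> z) has_derivative
        (\<lambda>h. Re h *\<^sub>R (inverse dbar_mass *\<^sub>R X 1 z) + Im h *\<^sub>R (inverse dbar_mass *\<^sub>R X \<i> z))) (at z)"
      if "z \<in> ball 0 1" for z
      using has_derivative_scaleR_right[OF X(2)[OF that], of "inverse dbar_mass"]
      by (simp only: scaleR_add_right scaleR_left_commute)
  qed
qed

text \<open>Reduces one application of the operator to a scalar computation with a
  \<open>C\<^sup>1\<close> function. The equation for \<open>v\<close> is asked only almost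
  everywhere, because the one for the primitive of the minus component holds only in that
  sense.\<close>

lemma dbar_minus_embed:
  assumes Du: "\<And>z. z \<in> ball 0 1 \<Longrightarrow> (u has_derivative u' z) (at z)"
    and c: "continuous_on (ball 0 1) (\<lambda>z. u' z 1)" "continuous_on (ball 0 1) (\<lambda>z. u' z \<i>)"
    and w: "\<And>z. z \<in> ball 0 1 \<Longrightarrow> w z = minus_embed (u z)"
    and eq: "AE z in lebesgue. z \<in> ball 0 1 \<longrightarrow> v z = minus_embed ((u' z 1 + \<i> * u' z \<i>) / 2 - bc_minus (A z) * u z)"
  shows "dbar_minus (ball 0 1) A w v"
  unfolding dbar_minus_def
proof (intro exI conjI)
  have D: "(w has_derivative (\<lambda>h. minus_embed (u' z h))) (at z)" if z: "z \<in> ball 0 1" for z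
    by (rule has_derivative_transform_within_open[OF bounded_linear.has_derivative[OF bounded_linear_minus_embed Du[OF z]]
          open_ball z]) (simp add: w)
  have C: "continuous_on (ball 0 1) (\<lambda>z. minus_embed (u' z d))" if "d \<in> {1, \<i>}" for d
    using c that by (auto intro: bounded_linear.continuous_on[OF bounded_linear_minus_embed])
  show "has_weak_deriv (ball 0 1) 1 w (\<lambda>z. minus_embed (u' z 1))"
    by (rule has_weak_deriv_classical[OF open_ball _ D C]) simp_all
  show "has_weak_deriv (ball 0 1) \<i> w (\<lambda>z. minus_embed (u' z \<i>))"
    by (rule has_weak_deriv_classical[OF open_ball _ D C]) simp_all
  note lin = bounded_linear.linear[OF bounded_linear_minus_embed]
  show "AE z in lebesgue. z \<in> ball 0 1 \<longrightarrow>
      v z = (1/2) *\<^sub>R (minus_embed (u' z 1) + bc_j * minus_embed (u' z \<i>)) - A z * w z"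
    using eq
  proof eventually_elim
    case (elim z)
    have "(1/2) *\<^sub>R (minus_embed (u' z 1) + bc_j * minus_embed (u' z \<i>)) - A z * minus_embed (u z)
        = minus_embed ((1/2) *\<^sub>R (u' z 1 + \<i> * u' z \<i>) - bc_minus (A z) * u z)"
      unfolding bc_j_mult_minus_embed unfolding mult_minus_embed linear_diff[OF lin] linear_cmul[OF lin] linear_add[OF lin] ..
    also have "(1/2) *\<^sub>R (u' z 1 + \<i> * u' z \<i>) = (u' z 1 + \<i> * u' z \<i>) / 2"
      by (simp add: scaleR_conv_of_real)
    finally show ?case using elim w by simp
  qed
qed

section \<open>A one-parameter family of solutions\<close>

theorem theorem3p12:
  fixes A :: "complex \<Rightarrow> bicomplex" and q :: real
  assumes "q > 2" and "A \<in> W1_space q (ball 0 1)"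
  shows "infinite {w. dirichlet_solution A w}"
proof
  assume fin: "finite {w. dirichlet_solution A w}"
  obtain \<alpha> Y where \<alpha>: "continuous_on UNIV \<alpha>"
    and Yc: "\<And>d. d \<in> {1, \<i>} \<Longrightarrow> continuous_on (ball 0 1) (Y d)"
    and D\<alpha>: "\<And>z. z \<in> ball 0 1 \<Longrightarrow> (\<alpha> has_derivative (\<lambda>h. Re h *\<^sub>R Y 1 z + Im h *\<^sub>R Y \<i> z)) (at z)"
    and dbar: "AE z in lebesgue. z \<in> ball 0 1 \<longrightarrow> Y 1 z + \<i> * Y \<i> z = 2 * bc_minus (A z)"
    using W1_dbar_primitive[OF assms] by blast
  define \<alpha>' where "\<alpha>' z h = Re h *\<^sub>R Y 1 z + Im h *\<^sub>R Y \<i> z" for z h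
  have \<alpha>1: "\<alpha>' z 1 = Y 1 z" "\<alpha>' z \<i> = Y \<i> z" for z by (simp_all add: \<alpha>'_def)
  have \<alpha>c: "continuous_on (ball 0 1) \<alpha>" by (rule continuous_on_subset[OF \<alpha>]) simp
  have Dexp: "((\<lambda>z. exp (\<alpha> z)) has_derivative (\<lambda>h. exp (\<alpha> z) * \<alpha>' z h)) (at z)" if "z \<in> ball 0 1" for z
    using has_derivative_compose[OF D\<alpha>[OF that] DERIV_exp[unfolded has_field_derivative_def]]
    unfolding \<alpha>'_def .
  have Dcnj: "(cnj has_derivative cnj) (at z)" for z
    by (rule bounded_linear_imp_has_derivative[OF bounded_linear_cnj])
  define u where "u k z = of_real k * (1 - z * cnj z) * exp (\<alpha> z)" for k :: real and z
  define u' where "u' k z h = of_real k * (1 - z * cnj z) * (exp (\<alpha> z) * \<alpha>' z h)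
      + of_real k * (0 - (z * cnj h + h * cnj z)) * exp (\<alpha> z)" for k :: real and z h
  define v where "v k z = - of_real k * z * exp (\<alpha> z)" for k :: real and z
  define v' where "v' k z h = - of_real k * z * (exp (\<alpha> z) * \<alpha>' z h) + - of_real k * h * exp (\<alpha> z)"
    for k :: real and z h
  \<comment> \<open>\<open>restrict\<close> meets the extensionality condition; the derivatives are
    unaffected, since only values in the open disc enter them.\<close>
  define W where "W k = restrict (\<lambda>z. minus_embed (u k z)) (cball 0 1)" for k
  have Du: "(u k has_derivative u' k z) (at z)" if "z \<in> ball 0 1" for k z
    unfolding u_def[abs_def] u'_def
    by (rule has_derivative_mult[OF has_derivative_mult_right[OF has_derivative_diff[OF has_derivative_const
              has_derivative_mult[OF has_derivative_ident Dcnj]]] Dexp[OF that]])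
  have Dv: "(v k has_derivative v' k z) (at z)" if "z \<in> ball 0 1" for k z
    unfolding v_def[abs_def] v'_def
    by (rule has_derivative_mult[OF has_derivative_mult_right[OF has_derivative_ident] Dexp[OF that]])
  have uc: "continuous_on (ball 0 1) (\<lambda>z. u' k z d)" "continuous_on (ball 0 1) (\<lambda>z. v' k z d)" for k d
    unfolding u'_def v'_def \<alpha>'_def using Yc \<alpha>c by (auto intro!: continuous_intros)
  have "dirichlet_solution A (W k)" for k
    unfolding dirichlet_solution_def
  proof (intro conjI ballI)
    show "W k \<in> extensional (cball 0 1)" by (simp add: W_def)
    have "continuous_on UNIV (u k)" unfolding u_def[abs_def] by (intro continuous_intros \<alpha>)
    then have "continuous_on (cball 0 1) (\<lambda>z. minus_embed (u k z))"
      using continuous_on_subset by (intro bounded_linear.continuous_on[OF bounded_linear_minus_embed]) blast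
    then show "continuous_on (cball 0 1) (W k)"
      by (rule continuous_on_eq) (simp add: W_def)
    show "W k z = 0" if "z \<in> sphere 0 1" for z
    proof -
      have "z * cnj z = 1" using that complex_norm_square[of z] by simp
      then show ?thesis using that
        by (simp add: W_def u_def minus_embed_def zero_bicomplex_def)
    qed
    have "dbar_minus (ball 0 1) A (W k) (\<lambda>z. minus_embed (v k z))"
    proof (rule dbar_minus_embed[OF Du uc(1) uc(1)])
      show "AE z in lebesgue. z \<in> ball 0 1 \<longrightarrow> minus_embed (v k z)
          = minus_embed ((u' k z 1 + \<i> * u' k z \<i>) / 2 - bc_minus (A z) * u k z)"
        using dbar
      proof eventually_elim
        case (elim z)
        \<comment> \<open>Since \<open>cnj 1 = 1\<close> and \<open>cnj \<i> = - \<i>\<close>, the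
          factor \<open>1 - z * cnj z\<close> contributes \<open>- 2 * z\<close>, which is the term
          \<open>2 * v k z\<close>.\<close>
        have "u' k z 1 + \<i> * u' k z \<i> = u k z * (Y 1 z + \<i> * Y \<i> z) + 2 * v k z"
          unfolding u'_def u_def v_def \<alpha>1 by (simp add: algebra_simps)
        with elim have "z \<in> ball 0 1 \<longrightarrow> u' k z 1 + \<i> * u' k z \<i> = u k z * (2 * bc_minus (A z)) + 2 * v k z"
          by (auto simp only:)
        then show ?case by (simp add: add_divide_distrib mult.commute)
      qed
    qed (simp_all add: W_def)
    moreover have "dbar_minus (ball 0 1) A (\<lambda>z. minus_embed (v k z)) (\<lambda>z. 0)"
    proof (rule dbar_minus_embed[OF Dv uc(2) uc(2)])
      show "AE z in lebesgue. z \<in> ball 0 1 \<longrightarrow> 0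
          = minus_embed ((v' k z 1 + \<i> * v' k z \<i>) / 2 - bc_minus (A z) * v k z)"
        using dbar
      proof eventually_elim
        case (elim z)
        \<comment> \<open>The factor \<open>z\<close> contributes
          \<open>1 + \<i> * \<i> = 0\<close>, so only the derivative of the exponential
          survives.\<close>
        have "v' k z 1 + \<i> * v' k z \<i> = v k z * (Y 1 z + \<i> * Y \<i> z)"
          unfolding v'_def v_def \<alpha>1 by (simp add: algebra_simps)
        with elim have "z \<in> ball 0 1 \<longrightarrow> v' k z 1 + \<i> * v' k z \<i> = v k z * (2 * bc_minus (A z))"
          by (auto simp only:)
        then show ?case by (simp add: mult.commute minus_embed_def zero_bicomplex_def)
      qed
    qed simp_all
    ultimately show "(dbar_minus (ball 0 1) A OO dbar_minus (ball 0 1) A) (W k) (\<lambda>z. 0)"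
      unfolding relcompp_apply by blast
  qed
  then have "range W \<subseteq> {w. dirichlet_solution A w}" by blast
  then have "finite (range W)" using fin by (rule finite_subset)
  moreover have "inj W"
  proof (rule injI)
    fix k l assume "W k = W l"
    \<comment> \<open>At the centre \<open>u k 0\<close> is \<open>k\<close> times
      \<open>exp (\<alpha> 0)\<close>, and the exponential never vanishes, so the parameter can be
      recovered.\<close>
    then have "W k 0 = W l 0" by simp
    then have "minus_embed (u k 0) = minus_embed (u l 0)" by (simp add: W_def)
    then have "u k 0 = u l 0" by (metis bc_minus_embed)
    then show "k = l" by (simp add: u_def)
  qed
  ultimately have "finite (UNIV :: real set)" by (rule finite_imageD)
  then show False using infinite_UNIV_char_0 by blast
qed

end
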